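(* Fix $\alpha\in[0,1]$ and $H\in(0,1)$, and let $X^{\alpha,H}$ be the weighted tensorized fractional Brownian field. Almost surely, for all bounded intervals $I,J$ of $\mathbb{R}$ with nonempty interior, one has $$\sup\ \frac{|\Delta X^{\alpha,H}_{(h_1,h_2);(x_1,x_2)}|}{\left(\max\{|h_1|,|h_2|\}^{1-\alpha}\min\{|h_1|,|h_2|\}^{1+\alpha}\right)^{H}} = +\infty,$$ where the supremum is taken over all $(x_1,x_2)$ and $(h_1,h_2)$ in $\mathbb{R}^2$ with $(x_1,x_2)\in I\times J$, $(x_1+h_1,x_2+h_2)\in I\times J$, $h_1\ne0$ and $h_2\neq 0$.
   Context: Definition of the field: for $\alpha\in[0,1]$ and $H\in(0,1)$ put $H_\alpha^+=(1+\alpha)H$, $H_\alpha^-=(1-\alpha)H$ and $$\phi_{\alpha,H}(\xi_1,\xi_2)=\min(|\xi_1|,|\xi_2|)^{H_\alpha^-+\frac12}\max(|\xi_1|,|\xi_2|)^{H_\alpha^++\frac12}.$$ The weighted tensorized fractional Brownian field is the real centered Gaussian field $$X^{\alpha,H}_{(x_1,x_2)}=\int_{\mathbb{R}^2}\frac{(e^{ix_1\xi_1}-1)(e^{ix_2\xi_2}-1)}{\phi_{\alpha,H}(\xi_1,\xi_2)}\,d\widehat{\mathbf W}(\boldsymbol\xi),\qquad (x_1,x_2)\in\mathbb{R}^2,$$ where $\widehat{\mathbf W}$ is the Fourier transform of the real Brownian measure (white noise) $\mathbf W$ on $\mathbb{R}^2$: for $f\in L^2(\mathbb{R}^2;\mathbb{C})$,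 $\int f\,d\widehat{\mathbf W}:=\int \mathcal{F}^{-1}f\,d\mathbf W$ with $\mathcal F$ the unitary Fourier transform, so that $\mathbb{E}\big[\int f\,d\widehat{\mathbf W}\,\overline{\int g\,d\widehat{\mathbf W}}\big]=\int_{\mathbb{R}^2} f\bar g\,d\boldsymbol\xi$. Here $X^{\alpha,H}$ denotes a version of this field with continuous sample paths. Rectangular increments: $\Delta X_{(h_1,h_2);(x_1,x_2)} := X_{(x_1+h_1,x_2+h_2)}-X_{(x_1+h_1,x_2)}-X_{(x_1,x_2+h_2)}+X_{(x_1,x_2)}$. *)

theory Defs
  imports "HOL-Probability.Probability"
begin

definition square_integrable :: "(real \<times> real \<Rightarrow> 'a::{real_normed_vector}) \<Rightarrow> bool" where
  "square_integrable f \<longleftrightarrow>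
     f \<in> borel_measurable lborel \<and> (\<integral>\<^sup>+ x. ennreal ((norm (f x))\<^sup>2) \<partial>lborel) < \<infinity>"


subsection \<open>The unitary Fourier transform on the plane\<close>

text \<open>For absolutely integrable \<open>g\<close>; the factor \<open>1 / (2 * pi)\<close> is \<open>(2 * pi) powr (- d / 2)\<close>
  with \<open>d = 2\<close>.\<close>

definition fourier_integral :: "(real \<times> real \<Rightarrow> complex) \<Rightarrow> real \<times> real \<Rightarrow> complex" where
  "fourier_integral g \<xi> = complex_of_real (1 / (2 * pi)) * (LINT x|lborel. cis (- (x \<bullet> \<xi>)) * g x)"

text \<open>The extension to square integrable functions: \<open>f\<close> represents the Fourier transform of \<open>g\<close>
  if it is the \<open>L\<^sup>2\<close>-limit of the Fourier integrals of the truncations of \<open>g\<close> to balls. As the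
  transform is a bijection on \<open>L\<^sup>2\<close> (up to null sets), the same relation, read from \<open>f\<close> to \<open>g\<close>,
  says that \<open>g\<close> represents the inverse Fourier transform of \<open>f\<close>.\<close>

definition has_fourier_transform ::
    "(real \<times> real \<Rightarrow> complex) \<Rightarrow> (real \<times> real \<Rightarrow> complex) \<Rightarrow> bool" where
  "has_fourier_transform g f \<longleftrightarrow>
     square_integrable g \<and> square_integrable f \<and>
     (\<lambda>n. \<integral>\<^sup>+ \<xi>. ennreal ((norm (fourier_integral (\<lambda>x. indicator (cball 0 (real n)) x * g x) \<xi> - f \<xi>))\<^sup>2)
        \<partial>lborel) \<longlonglongrightarrow> 0"


subsection \<open>Real Brownian measure and its stochastic integral\<close>

text \<open>Centered Gaussian laws include the degenerate one, which \<^const>\<open>normal_density\<close> does not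
  cover.\<close>

definition centered_gaussian :: "'w measure \<Rightarrow> ('w \<Rightarrow> real) \<Rightarrow> bool" where
  "centered_gaussian M Y \<longleftrightarrow>
     Y \<in> borel_measurable M \<and>
     ((AE \<omega> in M. Y \<omega> = 0) \<or> (\<exists>\<sigma>>0. distributed M lborel Y (\<lambda>y. ennreal (normal_density 0 \<sigma> y))))"

definition finite_area_sets :: "(real \<times> real) set set" where
  "finite_area_sets = {A \<in> sets borel. emeasure lborel A < \<infinity>}"

text \<open>A centered Gaussian process indexed by the Borel sets of finite area, with covariance
  \<open>E [W(A) W(B)] = area (A \<inter> B)\<close>; almost sure additivity and independence on disjoint sets
  follow from this.\<close>

definition brownian_measure :: "'w measure \<Rightarrow> ((real \<times> real) set \<Rightarrow> 'w \<Rightarrow> real) \<Rightarrow> bool" where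
  "brownian_measure M W \<longleftrightarrow>
     (\<forall>S c. finite S \<longrightarrow> S \<subseteq> finite_area_sets \<longrightarrow>
        centered_gaussian M (\<lambda>\<omega>. \<Sum>A\<in>S. c A * W A \<omega>)) \<and>
     (\<forall>A\<in>finite_area_sets. \<forall>B\<in>finite_area_sets.
        (LINT \<omega>|M. W A \<omega> * W B \<omega>) = measure lborel (A \<inter> B))"

text \<open>\<open>Y\<close> is a version of the integral of \<open>f\<close> against \<open>W\<close>: the \<open>L\<^sup>2\<close>-limit of the integrals of
  simple functions \<open>\<Sum>A\<in>S n. c n A * indicator A\<close> that converge to \<open>f\<close> in \<open>L\<^sup>2\<close>. The relation
  determines \<open>Y\<close> up to almost sure equality.\<close>

definition has_wiener_integral ::
    "'w measure \<Rightarrow> ((real \<times> real) set \<Rightarrow> 'w \<Rightarrow> real) \<Rightarrow> (real \<times> real \<Rightarrow> real) \<Rightarrow> ('w \<Rightarrow> real) \<Rightarrow> bool" where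
  "has_wiener_integral M W f Y \<longleftrightarrow>
     square_integrable f \<and> Y \<in> borel_measurable M \<and>
     (\<exists>S c. (\<forall>n::nat. finite (S n) \<and> S n \<subseteq> finite_area_sets) \<and>
        (\<lambda>n. \<integral>\<^sup>+ x. ennreal (((\<Sum>A\<in>S n. c n A * indicator A x) - f x)\<^sup>2) \<partial>lborel) \<longlonglongrightarrow> 0 \<and>
        (\<lambda>n. \<integral>\<^sup>+ \<omega>. ennreal (((\<Sum>A\<in>S n. c n A * W A \<omega>) - Y \<omega>)\<^sup>2) \<partial>M) \<longlonglongrightarrow> 0)"

definition has_complex_wiener_integral ::
    "'w measure \<Rightarrow> ((real \<times> real) set \<Rightarrow> 'w \<Rightarrow> real) \<Rightarrow> (real \<times> real \<Rightarrow> complex) \<Rightarrow> ('w \<Rightarrow> complex) \<Rightarrow> bool" where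
  "has_complex_wiener_integral M W g Z \<longleftrightarrow>
     has_wiener_integral M W (\<lambda>x. Re (g x)) (\<lambda>\<omega>. Re (Z \<omega>)) \<and>
     has_wiener_integral M W (\<lambda>x. Im (g x)) (\<lambda>\<omega>. Im (Z \<omega>))"

text \<open>The integral of \<open>f\<close> against the Fourier transform of \<open>W\<close> is the integral of the inverse
  Fourier transform of \<open>f\<close> against \<open>W\<close>.\<close>

definition has_fourier_wiener_integral ::
    "'w measure \<Rightarrow> ((real \<times> real) set \<Rightarrow> 'w \<Rightarrow> real) \<Rightarrow> (real \<times> real \<Rightarrow> complex) \<Rightarrow> ('w \<Rightarrow> complex) \<Rightarrow> bool" where
  "has_fourier_wiener_integral M W f Z \<longleftrightarrow>
     (\<exists>g. has_fourier_transform g f \<and> has_complex_wiener_integral M W g Z)"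


subsection \<open>The weighted tensorized fractional Brownian field\<close>

definition H_plus :: "real \<Rightarrow> real \<Rightarrow> real" where
  "H_plus \<alpha> H = (1 + \<alpha>) * H"

definition H_minus :: "real \<Rightarrow> real \<Rightarrow> real" where
  "H_minus \<alpha> H = (1 - \<alpha>) * H"

definition phi :: "real \<Rightarrow> real \<Rightarrow> real \<times> real \<Rightarrow> real" where
  "phi \<alpha> H = (\<lambda>(\<xi>1, \<xi>2).
     min \<bar>\<xi>1\<bar> \<bar>\<xi>2\<bar> powr (H_minus \<alpha> H + 1/2) * max \<bar>\<xi>1\<bar> \<bar>\<xi>2\<bar> powr (H_plus \<alpha> H + 1/2))"

text \<open>On the axes, a null set, \<^const>\<open>phi\<close> vanishes and the kernel takes the value 0.\<close>

definition wtfbf_kernel :: "real \<Rightarrow> real \<Rightarrow> real \<times> real \<Rightarrow> real \<times> real \<Rightarrow> complex" where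
  "wtfbf_kernel \<alpha> H = (\<lambda>(x1, x2) (\<xi>1, \<xi>2).
     (cis (x1 * \<xi>1) - 1) * (cis (x2 * \<xi>2) - 1) / complex_of_real (phi \<alpha> H (\<xi>1, \<xi>2)))"

text \<open>\<open>X\<close> is a version (modification) of the field driven by \<open>W\<close>: each \<open>X x\<close> is only determined
  up to almost sure equality. The defining integral is almost surely real because
  the kernel is Hermitian in \<open>\<xi>\<close>.\<close>

definition is_wtfbf ::
    "'w measure \<Rightarrow> ((real \<times> real) set \<Rightarrow> 'w \<Rightarrow> real) \<Rightarrow> real \<Rightarrow> real \<Rightarrow> (real \<times> real \<Rightarrow> 'w \<Rightarrow> real) \<Rightarrow> bool" where
  "is_wtfbf M W \<alpha> H X \<longleftrightarrow>
     (\<forall>x. has_fourier_wiener_integral M W (wtfbf_kernel \<alpha> H x) (\<lambda>\<omega>. complex_of_real (X x \<omega>)))"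

definition rect_increment :: "(real \<times> real \<Rightarrow> real) \<Rightarrow> real \<times> real \<Rightarrow> real \<times> real \<Rightarrow> real" where
  "rect_increment F = (\<lambda>(h1, h2) (x1, x2).
     F (x1 + h1, x2 + h2) - F (x1 + h1, x2) - F (x1, x2 + h2) + F (x1, x2))"

end

theory Submission
  imports Defs
begin

text \<open>For fixed \<open>x\<close> put \<open>Y h = h powr (- 2 * H) * \<Delta>X\<^bsub>(h,h);x\<^esub>\<close>. By Plancherel and the homogeneity
  of \<^const>\<open>phi\<close>, each \<open>Y h\<close> is a centered Gaussian variable whose variance \<open>Q > 0\<close> does not depend on
  \<open>h\<close>, and the covariance of \<open>Y h\<close> and \<open>Y k\<close> tends to \<open>0\<close> as \<open>h / k \<rightarrow> 0\<close>, because the two spectral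
  densities live on different frequency scales. Along a sparse geometric sequence of scales the
  variables \<open>exp (s * Y h)\<close> are therefore nearly uncorrelated, and their averages concentrate around
  \<open>exp (s\<^sup>2 * Q / 2)\<close>. For large \<open>s\<close> this exceeds \<open>exp (s * K)\<close>, so \<open>Y h \<le> K\<close> for all small \<open>h\<close> has
  probability zero. Increments over squares with rational lower corner thus suffice.\<close>

subsection \<open>Squared norms in \<open>L\<^sup>2\<close>\<close>

text \<open>The estimates only involve sums of two normalised increments. Such a sum is again a
  spectral integral by linearity, hence centered Gaussian, and its variance alone determines the
  mixed exponential moment. This is why exponentials are averaged: their pair moments are explicit
  and increasing in that variance, so an upper bound for the overlap of two spectral weights is
  enough and phases can be discarded. Diagonal steps \<open>h1 = h2 = h\<close> turn the denominator
  into \<open>h powr (2 * H)\<close> for every \<alpha>, and the two exponents of \<open>phi\<close>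
  add up to \<open>2 * H + 1\<close> in the same way. The field is given only through
  \<open>L\<^sup>2\<close> limits, of truncated Fourier integrals and of simple functions. A
  variance can be computed only after Plancherel and the Wiener isometry have been carried through
  these limits. For fixed \<open>x\<close> the event that no small \<open>h\<close> exceeds
  \<open>K\<close> is an intersection over uncountably many \<open>h\<close>. Instead of proving it
  measurable, the argument encloses it in measurable sets of arbitrarily small probability.\<close>

definition L2_sq :: "'a measure \<Rightarrow> ('a \<Rightarrow> 'b::real_normed_vector) \<Rightarrow> ennreal" where
  "L2_sq M f = (\<integral>\<^sup>+ x. ennreal ((norm (f x))\<^sup>2) \<partial>M)"

text \<open>Young's inequality with a free parameter. A small \<open>t\<close> keeps the factor of
  the first term close to 1, which the convergence of squared norms requires; \<open>t = 1\<close>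
  gives the usual factor 2.\<close>

lemma norm_add_sq_le:
  fixes a b :: "'a::real_normed_vector"
  assumes "t > 0"
  shows "(norm (a + b))\<^sup>2 \<le> (1 + t) * (norm a)\<^sup>2 + (1 + 1 / t) * (norm b)\<^sup>2"
proof -
  have "(norm (a + b))\<^sup>2 \<le> (norm a + norm b)\<^sup>2"
    by (intro power_mono norm_triangle_ineq) auto
  also have "\<dots> = (norm a)\<^sup>2 + 2 * (norm a * norm b) + (norm b)\<^sup>2"
    by (simp add: power2_sum)
  also have "2 * (norm a * norm b) \<le> t * (norm a)\<^sup>2 + (1 / t) * (norm b)\<^sup>2"
  proof -
    have "0 \<le> (t * norm a - norm b)\<^sup>2 / t" using assms by simp
    also have "(t * norm a - norm b)\<^sup>2 / t = t * (norm a)\<^sup>2 + (1 / t) * (norm b)\<^sup>2 - 2 * (norm a * norm b)"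
      using assms by (simp add: power2_diff field_simps power2_eq_square)
    finally show ?thesis by simp
  qed
  finally show ?thesis by (simp add: algebra_simps)
qed

lemma ennreal_lincomb:
  "0 \<le> p \<Longrightarrow> 0 \<le> q \<Longrightarrow> 0 \<le> x \<Longrightarrow> 0 \<le> y \<Longrightarrow>
    ennreal (p * x + q * y) = ennreal p * ennreal x + ennreal q * ennreal y"
  by (subst ennreal_plus) (auto simp: ennreal_mult' simp del: ennreal_plus)

lemma L2_sq_add_le:
  fixes f g :: "'a \<Rightarrow> 'b::{real_normed_vector, second_countable_topology}"
  assumes [measurable]: "f \<in> borel_measurable M" "g \<in> borel_measurable M" and t: "t > 0"
  shows "L2_sq M (\<lambda>x. f x + g x) \<le> ennreal (1 + t) * L2_sq M f + ennreal (1 + 1 / t) * L2_sq M g"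
proof -
  have "L2_sq M (\<lambda>x. f x + g x) \<le>
      (\<integral>\<^sup>+ x. ennreal (1 + t) * ennreal ((norm (f x))\<^sup>2) + ennreal (1 + 1 / t) * ennreal ((norm (g x))\<^sup>2) \<partial>M)"
    unfolding L2_sq_def
  proof (intro nn_integral_mono)
    fix x
    have "ennreal ((norm (f x + g x))\<^sup>2) \<le>
        ennreal ((1 + t) * (norm (f x))\<^sup>2 + (1 + 1 / t) * (norm (g x))\<^sup>2)"
      by (intro ennreal_leI norm_add_sq_le t)
    also have "\<dots> = ennreal (1 + t) * ennreal ((norm (f x))\<^sup>2) + ennreal (1 + 1 / t) * ennreal ((norm (g x))\<^sup>2)"
      using t by (intro ennreal_lincomb) auto
    finally show "ennreal ((norm (f x + g x))\<^sup>2) \<le> \<dots>" .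
  qed
  also have "\<dots> = ennreal (1 + t) * L2_sq M f + ennreal (1 + 1 / t) * L2_sq M g"
    unfolding L2_sq_def by (simp add: nn_integral_add nn_integral_cmult)
  finally show ?thesis .
qed

lemma L2_sq_add_le2:
  fixes f g :: "'a \<Rightarrow> 'b::{real_normed_vector, second_countable_topology}"
  assumes "f \<in> borel_measurable M" "g \<in> borel_measurable M"
  shows "L2_sq M (\<lambda>x. f x + g x) \<le> 2 * L2_sq M f + 2 * L2_sq M g"
  using L2_sq_add_le[OF assms, of 1] by (simp add: one_add_one)

lemma L2_sq_uminus [simp]: "L2_sq M (\<lambda>x. - f x) = L2_sq M f"
  by (simp add: L2_sq_def)

lemma L2_sq_minus_commute: "L2_sq M (\<lambda>x. f x - g x) = L2_sq M (\<lambda>x. g x - f x)"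
  by (simp add: L2_sq_def norm_minus_commute)

lemma L2_sq_scaleR:
  fixes f :: "'a \<Rightarrow> 'b::{real_normed_vector, second_countable_topology}"
  assumes "f \<in> borel_measurable M"
  shows "L2_sq M (\<lambda>x. c *\<^sub>R f x) = ennreal (c\<^sup>2) * L2_sq M f"
  using assms unfolding L2_sq_def
  by (simp add: power_mult_distrib ennreal_mult nn_integral_cmult)

text \<open>The bound with parameter \<open>t\<close> is applied in both directions, to
  \<open>u n = f + (u n - f)\<close> and to \<open>f = u n + (f - u n)\<close>. It takes the place
  of the triangle inequality for the square root of \<open>L2_sq\<close>.\<close>

lemma L2_sq_tendsto:
  fixes f :: "'a \<Rightarrow> 'b::{real_normed_vector, second_countable_topology}"
  assumes [measurable]: "f \<in> borel_measurable M" "\<And>n::nat. u n \<in> borel_measurable M"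
    and fin: "L2_sq M f < \<infinity>" and lim: "(\<lambda>n. L2_sq M (\<lambda>x. u n x - f x)) \<longlonglongrightarrow> 0"
  shows "(\<lambda>n. L2_sq M (u n)) \<longlonglongrightarrow> L2_sq M f"
proof -
  define b where "b = enn2real (L2_sq M f)"
  define e where "e = (\<lambda>n. enn2real (L2_sq M (\<lambda>x. u n x - f x)))"
  define a where "a = (\<lambda>n. enn2real (L2_sq M (u n)))"
  have b: "L2_sq M f = ennreal b" "0 \<le> b" using fin by (auto simp: b_def)
  have "eventually (\<lambda>n. L2_sq M (\<lambda>x. u n x - f x) < 1) sequentially"
    using lim by (rule order_tendstoD) simp
  then have e: "eventually (\<lambda>n. L2_sq M (\<lambda>x. u n x - f x) = ennreal (e n)) sequentially"
    by eventually_elim (auto simp: e_def ennreal_enn2real_if dest: less_trans[OF _ ennreal_one_less_top])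
  have e0: "0 \<le> e n" for n by (simp add: e_def)
  have elim: "e \<longlonglongrightarrow> 0"
    using tendsto_enn2real[of _ 0] lim unfolding e_def by simp
  have up: "L2_sq M (u n) \<le> ennreal (1 + t) * L2_sq M f + ennreal (1 + 1 / t) * L2_sq M (\<lambda>x. u n x - f x)"
    if "t > 0" for n t
    using L2_sq_add_le[of f M "\<lambda>x. u n x - f x" t] that by simp
  have lo: "L2_sq M f \<le> ennreal (1 + t) * L2_sq M (u n) + ennreal (1 + 1 / t) * L2_sq M (\<lambda>x. u n x - f x)"
    if "t > 0" for n t
    using L2_sq_add_le[of "u n" M "\<lambda>x. f x - u n x" t] that by (simp add: L2_sq_minus_commute[of M f])
  have up': "eventually (\<lambda>n. L2_sq M (u n) = ennreal (a n) \<and> (\<forall>t>0. a n \<le> (1 + t) * b + (1 + 1 / t) * e n)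
       \<and> (\<forall>t>0. b \<le> (1 + t) * a n + (1 + 1 / t) * e n)) sequentially"
    using e
  proof eventually_elim
    case (elim n)
    have *: "L2_sq M (u n) \<le> ennreal ((1 + t) * b + (1 + 1 / t) * e n)" if "t > 0" for t
      using up[OF that, of n] that b e0[of n]
      by (simp add: elim ennreal_lincomb del: ennreal_plus)
    have "L2_sq M (u n) \<noteq> \<infinity>" using *[of 1] by (auto simp: top_unique)
    then have an: "L2_sq M (u n) = ennreal (a n)" "0 \<le> a n" by (auto simp: a_def less_top)
    have "a n \<le> (1 + t) * b + (1 + 1 / t) * e n" if "t > 0" for t
      using *[OF that] an that b e0[of n] by (simp del: ennreal_plus)
    moreover have "b \<le> (1 + t) * a n + (1 + 1 / t) * e n" if "t > 0" for t
    proof -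
      have "ennreal b \<le> ennreal ((1 + t) * a n + (1 + 1 / t) * e n)"
        using lo[OF that, of n] that b e0[of n] an
        by (simp add: elim ennreal_lincomb del: ennreal_plus)
      then show ?thesis using an that b e0[of n] by (simp del: ennreal_plus)
    qed
    ultimately show ?case using an by blast
  qed
  have "a \<longlonglongrightarrow> b"
  proof (rule LIMSEQ_I)
    fix r :: real assume r: "r > 0"
    \<comment> \<open>The case \<open>t = 1\<close> of the bound gives
      \<open>a n \<le> 2 * b + 2\<close> once \<open>e n < 1\<close>, so this choice makes both
      \<open>t * a n\<close> and \<open>t * b\<close> at most \<open>r / 2\<close>. The other half
      of \<open>r\<close> is left for the term with \<open>1 / t\<close>.\<close>
    define t where "t = r / (2 * (2 * b + 2))"
    have t: "t > 0" "t * (2 * b + 2) = r / 2" using r b by (auto simp: t_def field_simps)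
    have "(\<lambda>n. (1 + 1 / t) * e n) \<longlonglongrightarrow> 0" using tendsto_mult_right_zero[OF elim] by simp
    then have "eventually (\<lambda>n. (1 + 1 / t) * e n < r / 2) sequentially"
      by (rule order_tendstoD) (use r in simp)
    moreover have "eventually (\<lambda>n. e n < 1) sequentially" using elim by (rule order_tendstoD) simp
    ultimately have "eventually (\<lambda>n. norm (a n - b) < r) sequentially"
      using up'
    proof eventually_elim
      case (elim n)
      have 1: "a n \<le> (1 + t) * b + (1 + 1 / t) * e n" "b \<le> (1 + t) * a n + (1 + 1 / t) * e n"
        using elim(3) t by auto
      have "a n \<le> (1 + 1) * b + (1 + 1 / 1) * e n" using elim(3) zero_less_one by blast
      then have "a n \<le> 2 * b + 2" using elim(2) by simp
      then have "t * a n \<le> r / 2" using t(1) mult_left_mono[of "a n" "2 * b + 2" t] unfolding t(2) by simp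
      moreover have "t * b \<le> r / 2" using t(1) mult_left_mono[of "b" "2 * b + 2" t] b unfolding t(2) by simp
      moreover have "(1 + t) * b = b + t * b" "(1 + t) * a n = a n + t * a n"
        by (simp_all add: algebra_simps)
      ultimately have "a n - b < r" "b - a n < r" using 1 elim(1) by linarith+
      then show ?case by (simp add: abs_less_iff)
    qed
    then show "\<exists>no. \<forall>n\<ge>no. norm (a n - b) < r" by (simp add: eventually_sequentially)
  qed
  then have "(\<lambda>n. ennreal (a n)) \<longlonglongrightarrow> ennreal b" by (rule tendsto_ennrealI)
  then show ?thesis unfolding b(1)
    by (rule Lim_transform_eventually) (use up' in eventually_elim, simp)
qed

subsection \<open>Approximation by continuous functions\<close>

lemma ennreal_small_real:
  assumes "(0::ennreal) < a"
  obtains r where "0 < r" "ennreal r < a"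
proof -
  obtain c where c: "0 < c" "c < a" using dense[OF assms] by auto
  then obtain r where "c = ennreal r" "0 \<le> r" by (cases c) auto
  with c that[of r] show thesis by (cases "r = 0") auto
qed

lemma cball_in_borel [measurable]: "cball (a::'a::metric_space) r \<in> sets borel"
  by (intro borel_closed closed_cball)

lemma norm_sq_le_indicator_cball:
  assumes "\<And>x. x \<notin> cball 0 R \<Longrightarrow> norm (f x) = 0" "\<And>x. norm (f x) \<le> K"
  shows "(norm (f x))\<^sup>2 \<le> K\<^sup>2 * indicator (cball 0 R) x"
proof (cases "x \<in> cball 0 R")
  case True
  then show ?thesis using power_mono[OF assms(2)[of x], of 2] by simp
qed (use assms(1)[of x] in simp)

lemma L2_sq_tendsto_0_dominated:
  fixes f :: "nat \<Rightarrow> 'a::euclidean_space \<Rightarrow> 'b::{real_normed_vector, second_countable_topology}"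
  assumes [measurable]: "\<And>n. f n \<in> borel_measurable borel"
    and supp: "\<And>n x. x \<notin> cball 0 R \<Longrightarrow> f n x = 0" and bd: "\<And>n x. norm (f n x) \<le> K"
    and lim: "AE x in lborel. (\<lambda>n. f n x) \<longlonglongrightarrow> 0"
  shows "(\<lambda>n. L2_sq lborel (f n)) \<longlonglongrightarrow> 0"
proof -
  have "(\<lambda>n. \<integral>\<^sup>+ x. ennreal ((norm (f n x))\<^sup>2) \<partial>lborel) \<longlonglongrightarrow> (\<integral>\<^sup>+ x. 0 \<partial>(lborel :: 'a measure))"
  proof (rule nn_integral_dominated_convergence[where w="\<lambda>x. ennreal (K\<^sup>2) * indicator (cball 0 R) x"])
    show "AE x in lborel. ennreal ((norm (f j x))\<^sup>2) \<le> ennreal (K\<^sup>2) * indicator (cball 0 R) x" for j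
    proof (intro AE_I2)
      fix x
      have "ennreal ((norm (f j x))\<^sup>2) \<le> ennreal (K\<^sup>2 * indicator (cball 0 R) x)"
        by (intro ennreal_leI norm_sq_le_indicator_cball) (auto simp: supp bd)
      then show "ennreal ((norm (f j x))\<^sup>2) \<le> ennreal (K\<^sup>2) * indicator (cball 0 R) x"
        by (simp add: ennreal_mult' ennreal_indicator)
    qed
    show "(\<integral>\<^sup>+ x. ennreal (K\<^sup>2) * indicator (cball 0 R) x \<partial>(lborel :: 'a measure)) < \<infinity>"
      by (simp add: nn_integral_cmult_indicator ennreal_mult_less_top emeasure_bounded_finite[simplified])
    show "AE x in lborel. (\<lambda>i. ennreal ((norm (f i x))\<^sup>2)) \<longlonglongrightarrow> 0"
      using lim
    proof eventually_elim
      case (elim x)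
      have "(\<lambda>i. ennreal ((norm (f i x))\<^sup>2)) \<longlonglongrightarrow> ennreal ((norm (0::'b))\<^sup>2)"
        by (intro tendsto_ennrealI tendsto_intros elim)
      then show ?case by simp
    qed
  qed auto
  then show ?thesis by (simp add: L2_sq_def)
qed

text \<open>The map is the radial retraction onto the closed ball of radius \<open>K\<close>. It
  imposes a uniform bound on continuous approximants without moving values that already obey
  it.\<close>

lemma continuous_clip:
  "K > 0 \<Longrightarrow> continuous_on UNIV (\<lambda>z::'b::real_normed_vector. (K / max K (norm z)) *\<^sub>R z)"
  by (intro continuous_intros) (auto simp: max_def)

lemma norm_clip_le:
  assumes "K > 0"
  shows "norm ((K / max K (norm z)) *\<^sub>R z) \<le> K"
proof -
  have "norm ((K / max K (norm z)) *\<^sub>R z) = K * (norm z / max K (norm z))" using assms by simp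
  also have "\<dots> \<le> K * 1" using assms by (intro mult_left_mono) (auto simp: divide_simps)
  finally show ?thesis by simp
qed

lemma clip_id: "K > 0 \<Longrightarrow> norm z \<le> K \<Longrightarrow> (K / max K (norm z)) *\<^sub>R z = z"
  by (simp add: max_def)

lemma L2_approx_bounded_support:
  fixes g :: "'a::euclidean_space \<Rightarrow> 'b::{real_normed_vector, second_countable_topology}"
  assumes [measurable]: "g \<in> borel_measurable borel" and fin: "L2_sq lborel g < \<infinity>"
  shows "(\<lambda>n. L2_sq lborel (\<lambda>x. g x - (if norm x \<le> real n \<and> norm (g x) \<le> real n then g x else 0))) \<longlonglongrightarrow> 0"
proof -
  let ?g = "\<lambda>n x. if norm x \<le> real n \<and> norm (g x) \<le> real n then g x else 0"
  have "(\<lambda>n. \<integral>\<^sup>+ x. ennreal ((norm (g x - ?g n x))\<^sup>2) \<partial>lborel) \<longlonglongrightarrow> (\<integral>\<^sup>+ x. 0 \<partial>(lborel :: 'a measure))"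
  proof (rule nn_integral_dominated_convergence[where w="\<lambda>x. ennreal ((norm (g x))\<^sup>2)"])
    show "AE x in lborel. ennreal ((norm (g x - ?g j x))\<^sup>2) \<le> ennreal ((norm (g x))\<^sup>2)" for j
      by (intro AE_I2) auto
    show "AE x in lborel. (\<lambda>i. ennreal ((norm (g x - ?g i x))\<^sup>2)) \<longlonglongrightarrow> 0"
    proof (intro AE_I2 tendsto_eventually)
      fix x :: 'a
      have "eventually (\<lambda>n. max (norm x) (norm (g x)) \<le> real n) sequentially"
        using filterlim_real_sequentially unfolding filterlim_at_top by blast
      then show "eventually (\<lambda>i. ennreal ((norm (g x - ?g i x))\<^sup>2) = 0) sequentially"
        by eventually_elim auto
    qed
    show "(\<integral>\<^sup>+ x. ennreal ((norm (g x))\<^sup>2) \<partial>lborel) < \<infinity>" using fin by (simp add: L2_sq_def)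
  qed auto
  then show ?thesis by (simp add: L2_sq_def)
qed

text \<open>A measurable function is an almost everywhere limit of continuous functions, but these
  need neither a common bound nor bounded support. Clipping restores the first and a radial cutoff
  the second, after which dominated convergence applies.\<close>

lemma L2_dense_continuous_bounded:
  fixes g :: "'a::euclidean_space \<Rightarrow> 'b::euclidean_space"
  assumes [measurable]: "g \<in> borel_measurable borel" and K: "K > 0"
    and bd: "\<And>x. norm (g x) \<le> K" and supp: "\<And>x. x \<notin> cball 0 R \<Longrightarrow> g x = 0" and e: "(e::ennreal) > 0"
  shows "\<exists>u. continuous_on UNIV u \<and> (\<forall>x. norm (u x) \<le> K) \<and> (\<forall>x. x \<notin> cball 0 (R + 1) \<longrightarrow> u x = 0) \<and>
    L2_sq lborel (\<lambda>x. g x - u x) < e"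
proof -
  have "g measurable_on UNIV"
    by (rule lebesgue_measurable_imp_measurable_on) (auto intro!: measurable_completion)
  then obtain N v where N: "negligible N" and v: "\<And>n. continuous_on UNIV (v n)"
    and lim: "\<And>x. x \<notin> N \<Longrightarrow> (\<lambda>n::nat. v n x) \<longlonglongrightarrow> g x"
    unfolding measurable_on_def by auto
  define C where "C = (\<lambda>z::'b. (K / max K (norm z)) *\<^sub>R z)"
  \<comment> \<open>The cutoff is 1 on the ball of radius \<open>R\<close> and 0 outside radius
    \<open>R + 1\<close>. In the shell between them \<open>g\<close> vanishes and the clipped
    approximants tend to 0, so the limit is still \<open>g\<close>.\<close>
  define w where "w n x = max 0 (min 1 (R + 1 - norm x)) *\<^sub>R C (v n x)" for n x
  have Cc: "continuous_on UNIV C" unfolding C_def using K by (rule continuous_clip)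
  have Cb: "norm (C z) \<le> K" for z unfolding C_def using K by (rule norm_clip_le)
  have Cid: "norm z \<le> K \<Longrightarrow> C z = z" for z unfolding C_def using K by (rule clip_id)
  have wc: "continuous_on UNIV (w n)" for n
    unfolding w_def by (intro continuous_intros continuous_on_compose2[OF Cc v]) auto
  have wb: "norm (w n x) \<le> K" for n x
  proof -
    have "norm (w n x) = \<bar>max 0 (min 1 (R + 1 - norm x))\<bar> * norm (C (v n x))" by (simp add: w_def)
    also have "\<dots> \<le> 1 * K" by (intro mult_mono Cb) auto
    finally show ?thesis by simp
  qed
  have ws: "x \<notin> cball 0 (R + 1) \<Longrightarrow> w n x = 0" for n x by (auto simp: w_def)
  have wm[measurable]: "w n \<in> borel_measurable borel" for n
    using wc by (rule borel_measurable_continuous_onI)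
  have "(\<lambda>n. L2_sq lborel (\<lambda>x. g x - w n x)) \<longlonglongrightarrow> 0"
  proof (rule L2_sq_tendsto_0_dominated[where R="R + 1" and K="K + K"])
    show "norm (g x - w n x) \<le> K + K" for n x
      using norm_triangle_ineq4[of "g x" "w n x"] bd[of x] wb[of n x] by linarith
    show "x \<notin> cball 0 (R + 1) \<Longrightarrow> g x - w n x = 0" for n x
      using ws[of x n] supp[of x] by auto
    have "AE x in lebesgue. x \<notin> N" using N by (auto simp: negligible_iff_null_sets AE_not_in)
    then have "AE x in lborel. x \<notin> N" by (simp add: AE_completion_iff)
    then show "AE x in lborel. (\<lambda>n. g x - w n x) \<longlonglongrightarrow> 0"
    proof eventually_elim
      case (elim x)
      have "(\<lambda>n. C (v n x)) \<longlonglongrightarrow> C (g x)"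
        by (rule continuous_on_tendsto_compose[OF Cc lim[OF elim]]) auto
      then have "(\<lambda>n. g x - w n x) \<longlonglongrightarrow> g x - max 0 (min 1 (R + 1 - norm x)) *\<^sub>R C (g x)"
        unfolding w_def by (intro tendsto_intros)
      also have "g x - max 0 (min 1 (R + 1 - norm x)) *\<^sub>R C (g x) = 0"
      proof (cases "x \<in> cball 0 R")
        case True
        then show ?thesis by (simp add: Cid[OF bd])
      next
        case False
        then show ?thesis by (simp add: supp Cid K less_imp_le)
      qed
      finally show ?case .
    qed
  qed auto
  then have "eventually (\<lambda>n. L2_sq lborel (\<lambda>x. g x - w n x) < e) sequentially"
    by (rule order_tendstoD) (rule e)
  then obtain n where "L2_sq lborel (\<lambda>x. g x - w n x) < e" by (auto simp: eventually_sequentially)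
  then show ?thesis using wc[of n] wb[of n] ws[of _ n] by blast
qed

lemma L2_dense_continuous:
  fixes g :: "'a::euclidean_space \<Rightarrow> 'b::euclidean_space"
  assumes [measurable]: "g \<in> borel_measurable borel" and fin: "L2_sq lborel g < \<infinity>" and e: "(e::ennreal) > 0"
  obtains u K R where "continuous_on UNIV u" "\<And>x. norm (u x) \<le> K" "\<And>x. x \<notin> cball 0 R \<Longrightarrow> u x = 0"
    "L2_sq lborel (\<lambda>x. g x - u x) < e"
proof -
  obtain r where r: "0 < r" "ennreal r < e" using e by (rule ennreal_small_real)
  let ?g = "\<lambda>n x. if norm x \<le> real n \<and> norm (g x) \<le> real n then g x else 0"
  have "eventually (\<lambda>n. L2_sq lborel (\<lambda>x. g x - ?g n x) < ennreal (r / 4)) sequentially"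
    by (rule order_tendstoD[OF L2_approx_bounded_support]) (use r fin in auto)
  then obtain n where n: "L2_sq lborel (\<lambda>x. g x - ?g n x) < ennreal (r / 4)"
    by (auto simp: eventually_sequentially)
  \<comment> \<open>\<open>Suc n\<close> keeps the bound strictly positive when
    \<open>n = 0\<close>. Two errors of \<open>r / 4\<close>, each doubled, add up to
    \<open>r\<close>.\<close>
  have "\<exists>u. continuous_on UNIV u \<and> (\<forall>x. norm (u x) \<le> real (Suc n)) \<and>
      (\<forall>x. x \<notin> cball 0 (real n + 1) \<longrightarrow> u x = 0) \<and> L2_sq lborel (\<lambda>x. ?g n x - u x) < ennreal (r / 4)"
    by (rule L2_dense_continuous_bounded) (use r in auto)
  then obtain u where u: "continuous_on UNIV u" "\<And>x. norm (u x) \<le> real (Suc n)"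
    "\<And>x. x \<notin> cball 0 (real n + 1) \<Longrightarrow> u x = 0" "L2_sq lborel (\<lambda>x. ?g n x - u x) < ennreal (r / 4)"
    by blast
  have [measurable]: "u \<in> borel_measurable borel" using u(1) by (rule borel_measurable_continuous_onI)
  have "L2_sq lborel (\<lambda>x. (g x - ?g n x) + (?g n x - u x)) \<le>
      2 * L2_sq lborel (\<lambda>x. g x - ?g n x) + 2 * L2_sq lborel (\<lambda>x. ?g n x - u x)"
    by (rule L2_sq_add_le2) auto
  also have "\<dots> \<le> 2 * ennreal (r / 4) + 2 * ennreal (r / 4)"
    using n u(4) by (intro add_mono mult_left_mono) auto
  also have "\<dots> = ennreal r"
    using r by (simp add: ennreal_mult'[symmetric] ennreal_plus[symmetric] flip: ennreal_numeral del: ennreal_plus)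
  finally have "L2_sq lborel (\<lambda>x. g x - u x) < e" using r by (simp add: le_less_trans)
  then show thesis using that u by blast
qed

section \<open>Continuity of translations in \<open>L\<^sup>2\<close>\<close>

lemma nn_integral_lborel_translate:
  fixes f :: "'a::euclidean_space \<Rightarrow> ennreal"
  assumes [measurable]: "f \<in> borel_measurable borel"
  shows "(\<integral>\<^sup>+ x. f (x + w) \<partial>lborel) = (\<integral>\<^sup>+ x. f x \<partial>lborel)"
proof -
  have "(\<integral>\<^sup>+ x. f x \<partial>lborel) = (\<integral>\<^sup>+ x. f x \<partial>distr lborel borel ((+) w))"
    by (simp add: lborel_distr_plus)
  also have "\<dots> = (\<integral>\<^sup>+ x. f (x + w) \<partial>lborel)"
    by (subst nn_integral_distr) (auto simp: add.commute)
  finally show ?thesis ..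
qed

lemma L2_sq_translate:
  fixes f :: "'a::euclidean_space \<Rightarrow> 'b::{real_normed_vector, second_countable_topology}"
  assumes [measurable]: "f \<in> borel_measurable borel"
  shows "L2_sq lborel (\<lambda>x. f (x + w)) = L2_sq lborel f"
  unfolding L2_sq_def by (rule nn_integral_lborel_translate) simp

text \<open>Translations are isometries, so an approximation of \<open>g\<close> by \<open>u\<close>
  stays equally good after the shift. For continuous \<open>u\<close> of bounded support the claim
  is dominated convergence: the sequence \<open>w\<close> is bounded, so all shifts of
  \<open>u\<close> live in one ball.\<close>

lemma L2_translation_continuous:
  fixes g :: "'a::euclidean_space \<Rightarrow> 'b::euclidean_space"
  assumes [measurable]: "g \<in> borel_measurable borel" and fin: "L2_sq lborel g < \<infinity>"
    and w: "w \<longlonglongrightarrow> 0"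
  shows "(\<lambda>n::nat. L2_sq lborel (\<lambda>x. g (x + w n) - g x)) \<longlonglongrightarrow> 0"
proof (rule order_tendstoI)
  fix a :: ennreal assume "0 < a"
  then obtain r where r: "0 < r" "ennreal r < a" by (rule ennreal_small_real)
  \<comment> \<open>Splitting into three differences weights the errors by 2, 4 and 4, hence a tenth
    of \<open>r\<close> for each.\<close>
  obtain u K R where u: "continuous_on UNIV u" "\<And>x. norm (u x) \<le> K" "\<And>x. x \<notin> cball 0 R \<Longrightarrow> u x = 0"
    "L2_sq lborel (\<lambda>x. g x - u x) < ennreal (r / 10)"
    by (rule L2_dense_continuous[of g "ennreal (r / 10)"]) (use r fin in auto)
  have um[measurable]: "u \<in> borel_measurable borel" using u(1) by (rule borel_measurable_continuous_onI)
  obtain B where B: "\<And>n. norm (w n) \<le> B"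
    using convergent_imp_Bseq[OF convergentI[OF w]] by (auto simp: Bseq_def)
  have "(\<lambda>n. L2_sq lborel (\<lambda>x. u (x + w n) - u x)) \<longlonglongrightarrow> 0"
  proof (rule L2_sq_tendsto_0_dominated[where R="R + B" and K="K + K"])
    show "norm (u (x + w n) - u x) \<le> K + K" for n x
      using norm_triangle_ineq4[of "u (x + w n)" "u x"] u(2)[of x] u(2)[of "x + w n"] by linarith
    show "u (x + w n) - u x = 0" if "x \<notin> cball 0 (R + B)" for n x
    proof -
      have "norm x \<le> norm (x + w n) + norm (w n)"
        by (metis add_diff_cancel_right' norm_triangle_ineq4)
      then have "norm (x + w n) > R" using that B[of n] by simp
      moreover have "norm x > R" using that B[of n] order_trans[OF norm_ge_zero B[of n]] by simp
      ultimately show ?thesis by (simp add: u(3))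
    qed
    show "AE x in lborel. (\<lambda>n. u (x + w n) - u x) \<longlonglongrightarrow> 0"
    proof (intro AE_I2)
      fix x
      have "(\<lambda>n. x + w n) \<longlonglongrightarrow> x + 0" by (intro tendsto_intros w)
      then have "(\<lambda>n. u (x + w n)) \<longlonglongrightarrow> u x"
        by (intro continuous_on_tendsto_compose[OF u(1)]) auto
      then show "(\<lambda>n. u (x + w n) - u x) \<longlonglongrightarrow> 0" by (simp add: LIM_zero_iff)
    qed
  qed auto
  then have "eventually (\<lambda>n. L2_sq lborel (\<lambda>x. u (x + w n) - u x) < ennreal (r / 10)) sequentially"
    by (rule order_tendstoD) (use r in simp)
  then show "eventually (\<lambda>n. L2_sq lborel (\<lambda>x. g (x + w n) - g x) < a) sequentially"
  proof eventually_elim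
    case (elim n)
    have 1: "L2_sq lborel (\<lambda>x. g (x + w n) - u (x + w n)) = L2_sq lborel (\<lambda>x. g x - u x)"
      using L2_sq_translate[of "\<lambda>x. g x - u x" "w n"] by simp
    have "L2_sq lborel (\<lambda>x. g (x + w n) - g x) =
        L2_sq lborel (\<lambda>x. (g (x + w n) - u (x + w n)) + ((u (x + w n) - u x) + (u x - g x)))" by simp
    also have "\<dots> \<le> 2 * L2_sq lborel (\<lambda>x. g (x + w n) - u (x + w n)) +
        2 * L2_sq lborel (\<lambda>x. (u (x + w n) - u x) + (u x - g x))"
      by (rule L2_sq_add_le2) auto
    also have "\<dots> \<le> 2 * L2_sq lborel (\<lambda>x. g x - u x) +
        2 * (2 * L2_sq lborel (\<lambda>x. u (x + w n) - u x) + 2 * L2_sq lborel (\<lambda>x. u x - g x))"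
      unfolding 1 by (intro add_mono mult_left_mono L2_sq_add_le2) auto
    also have "\<dots> \<le> 2 * ennreal (r / 10) + 2 * (2 * ennreal (r / 10) + 2 * ennreal (r / 10))"
      using u(4) elim by (intro add_mono mult_left_mono) (auto simp: L2_sq_minus_commute[of _ u])
    also have "\<dots> = ennreal r"
      using r by (simp add: ennreal_mult'[symmetric] ennreal_plus[symmetric] flip: ennreal_numeral del: ennreal_plus)
    finally show ?case using r by (simp add: le_less_trans)
  qed
qed auto

subsection \<open>Plancherel's theorem\<close>

lemma lborel_integral_affine:
  fixes f :: "'a::euclidean_space \<Rightarrow> 'b::{banach, second_countable_topology}"
  assumes [measurable]: "f \<in> borel_measurable borel" and c: "c \<noteq> 0"
  shows "(\<integral>x. f x \<partial>lborel) = \<bar>c\<bar> ^ DIM('a) *\<^sub>R (\<integral>x. f (t + c *\<^sub>R x) \<partial>lborel)"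
  by (subst lborel_affine[OF c, of t], subst integral_density)
    (simp_all add: integral_distr)

lemma nn_integral_lborel_affine:
  fixes f :: "'a::euclidean_space \<Rightarrow> ennreal"
  assumes [measurable]: "f \<in> borel_measurable borel" and c: "c \<noteq> 0"
  shows "(\<integral>\<^sup>+ x. f x \<partial>lborel) = ennreal (\<bar>c\<bar> ^ DIM('a)) * (\<integral>\<^sup>+ x. f (t + c *\<^sub>R x) \<partial>lborel)"
  by (subst lborel_affine[OF c, of t])
    (simp add: nn_integral_density nn_integral_distr nn_integral_cmult flip: ennreal_power)

lemma integral_lborel_prod_mult:
  fixes f g :: "real \<Rightarrow> complex"
  assumes f: "integrable lborel f" and g: "integrable lborel g"
  shows "integrable lborel (\<lambda>z. f (fst z) * g (snd z))"
    and "(\<integral>z. f (fst z) * g (snd z) \<partial>lborel) = (\<integral>x. f x \<partial>lborel) * (\<integral>y. g y \<partial>lborel)"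
proof -
  have [measurable]: "f \<in> borel_measurable borel" "g \<in> borel_measurable borel"
    using f g by (auto dest: borel_measurable_integrable)
  have *: "integrable (lborel \<Otimes>\<^sub>M lborel) (\<lambda>z. f (fst z) * g (snd z))"
  proof (rule lborel_pair.Fubini_integrable)
    show "integrable lborel (\<lambda>x. \<integral>y. norm (f (fst (x, y)) * g (snd (x, y))) \<partial>lborel)"
      using f by (simp add: norm_mult)
    show "AE x in lborel. integrable lborel (\<lambda>y. f (fst (x, y)) * g (snd (x, y)))"
      using g by simp
  qed simp
  then show "integrable lborel (\<lambda>z. f (fst z) * g (snd z))" by (simp add: lborel_prod)
  show "(\<integral>z. f (fst z) * g (snd z) \<partial>lborel) = (\<integral>x. f x \<partial>lborel) * (\<integral>y. g y \<partial>lborel)"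
    using lborel_pair.integral_fst'[OF *] by (simp add: lborel_prod)
qed

text \<open>The standard normal density of the plane. It serves as damping factor in frequency and,
  through its own transform, as averaging kernel in space.\<close>

definition gauss2 :: "real \<times> real \<Rightarrow> real" where
  "gauss2 z = exp (- (norm z)\<^sup>2 / 2) / (2 * pi)"

lemma gauss2_eq: "gauss2 z = std_normal_density (fst z) * std_normal_density (snd z)"
  by (cases z) (simp add: gauss2_def std_normal_density_def norm_Pair exp_add[symmetric] add_divide_distrib
      flip: exp_minus exp_add)

lemma gauss2_nonneg [simp]: "0 \<le> gauss2 z"
  by (simp add: gauss2_def)

lemma gauss2_measurable [measurable]: "gauss2 \<in> borel_measurable borel"
  unfolding gauss2_def by simp

lemma std_normal_char:
  "(\<integral>x. cis (t * x) * of_real (std_normal_density x) \<partial>lborel) = of_real (exp (- t\<^sup>2 / 2))"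
proof -
  have "of_real (exp (- t\<^sup>2 / 2)) = char std_normal_distribution t"
    by (simp add: char_std_normal_distribution)
  also have "\<dots> = (\<integral>x. cis (t * x) * of_real (std_normal_density x) \<partial>lborel)"
    unfolding char_def
    by (subst integral_density) (auto simp: cis_conv_exp scaleR_conv_of_real mult.commute)
  finally show ?thesis ..
qed

lemma measurable_cis [measurable]: "cis \<in> borel_measurable borel"
  by (intro borel_measurable_continuous_onI continuous_intros)

lemma measurable_cnj [measurable]: "cnj \<in> borel_measurable borel"
  by (intro borel_measurable_continuous_onI continuous_intros)

lemma std_normal_cis_integrable:
  "integrable lborel (\<lambda>x. cis (t * x) * complex_of_real (std_normal_density x))"
proof (rule Bochner_Integration.integrable_bound[where f="\<lambda>x. std_normal_density x"])
  show "AE x in lborel. norm (cis (t * x) * complex_of_real (std_normal_density x)) \<le> norm (std_normal_density x)"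
    by (simp add: norm_mult)
qed auto

lemma gauss2_char:
  shows "integrable lborel (\<lambda>\<xi>. cis (- (z \<bullet> \<xi>)) * of_real (gauss2 \<xi>))"
    and "(\<integral>\<xi>. cis (- (z \<bullet> \<xi>)) * of_real (gauss2 \<xi>) \<partial>lborel) = of_real (exp (- (norm z)\<^sup>2 / 2))"
proof -
  have *: "(\<lambda>\<xi>. cis (- (z \<bullet> \<xi>)) * of_real (gauss2 \<xi>)) =
    (\<lambda>\<xi>. (cis (- fst z * fst \<xi>) * complex_of_real (std_normal_density (fst \<xi>))) *
         (cis (- snd z * snd \<xi>) * complex_of_real (std_normal_density (snd \<xi>))))"
    by (rule ext) (simp add: gauss2_eq inner_prod_def algebra_simps cis_mult)
  show "integrable lborel (\<lambda>\<xi>. cis (- (z \<bullet> \<xi>)) * of_real (gauss2 \<xi>))"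
    unfolding * by (rule integral_lborel_prod_mult(1)[OF std_normal_cis_integrable std_normal_cis_integrable])
  show "(\<integral>\<xi>. cis (- (z \<bullet> \<xi>)) * of_real (gauss2 \<xi>) \<partial>lborel) = of_real (exp (- (norm z)\<^sup>2 / 2))"
    unfolding * integral_lborel_prod_mult(2)[OF std_normal_cis_integrable std_normal_cis_integrable] std_normal_char
    by (cases z) (simp add: norm_Pair add_divide_distrib flip: exp_add of_real_mult)
qed

lemma gauss2_integrable [simp]: "integrable lborel gauss2"
  and gauss2_integral [simp]: "(\<integral>\<xi>. gauss2 \<xi> \<partial>lborel) = 1"
proof -
  have 1: "integrable lborel (\<lambda>\<xi>. complex_of_real (gauss2 \<xi>))"
    using gauss2_char(1)[of 0] by simp
  then show "integrable lborel gauss2"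
    unfolding complex_of_real_integrable_eq .
  have "complex_of_real (\<integral>\<xi>. gauss2 \<xi> \<partial>lborel) = 1"
    using gauss2_char(2)[of 0] by simp
  then show "(\<integral>\<xi>. gauss2 \<xi> \<partial>lborel) = 1" by simp
qed

lemma gauss2_scaled_integrable:
  assumes "s \<noteq> 0"
  shows "integrable lborel (\<lambda>\<xi>. gauss2 (s *\<^sub>R \<xi>))"
proof -
  have "(\<integral>\<^sup>+ x. ennreal (gauss2 x) \<partial>lborel) < \<infinity>"
    using gauss2_integrable by (simp add: integrable_iff_bounded)
  moreover have "(\<integral>\<^sup>+ x. ennreal (gauss2 x) \<partial>lborel) = ennreal (\<bar>s\<bar>\<^sup>2) * (\<integral>\<^sup>+ x. ennreal (gauss2 (s *\<^sub>R x)) \<partial>lborel)"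
    using nn_integral_lborel_affine[of "\<lambda>x. ennreal (gauss2 x)" s 0] assms by (simp add: power2_eq_square)
  ultimately show ?thesis
    using assms by (auto simp: integrable_iff_bounded ennreal_mult_less_top)
qed

text \<open>Damping at frequencies of order \<open>1 / s\<close> corresponds to averaging over
  distances of order \<open>s\<close>, which concentrates at 0 as \<open>s\<close>
  decreases.\<close>

lemma gauss2_scaled_char:
  assumes s: "s > 0"
  shows "(\<integral>\<xi>. cis (- (z \<bullet> \<xi>)) * of_real (gauss2 (s *\<^sub>R \<xi>)) \<partial>lborel) =
    of_real (2 * pi / s\<^sup>2 * gauss2 ((1 / s) *\<^sub>R z))"
proof -
  have "of_real (2 * pi * gauss2 ((1 / s) *\<^sub>R z)) =
      (\<integral>\<xi>. cis (- (((1 / s) *\<^sub>R z) \<bullet> \<xi>)) * of_real (gauss2 \<xi>) \<partial>lborel)"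
    by (subst gauss2_char(2)) (simp add: gauss2_def)
  also have "\<dots> = \<bar>s\<bar> ^ DIM(real \<times> real) *\<^sub>R
      (\<integral>\<xi>. cis (- (((1 / s) *\<^sub>R z) \<bullet> (0 + s *\<^sub>R \<xi>))) * of_real (gauss2 (0 + s *\<^sub>R \<xi>)) \<partial>lborel)"
    by (rule lborel_integral_affine) (use s in auto)
  also have "\<dots> = of_real (s\<^sup>2) * (\<integral>\<xi>. cis (- (z \<bullet> \<xi>)) * of_real (gauss2 (s *\<^sub>R \<xi>)) \<partial>lborel)"
    using s by (simp add: scaleR_conv_of_real power2_eq_square)
  finally have "(\<integral>\<xi>. cis (- (z \<bullet> \<xi>)) * of_real (gauss2 (s *\<^sub>R \<xi>)) \<partial>lborel) =
      of_real (2 * pi * gauss2 ((1 / s) *\<^sub>R z)) / of_real (s\<^sup>2)" using s by simp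
  then show ?thesis by simp
qed

lemma (in pair_sigma_finite) integrable_pair_mult:
  fixes f g :: "_ \<Rightarrow> real"
  assumes f: "integrable M1 f" and g: "integrable M2 g"
  shows "integrable (M1 \<Otimes>\<^sub>M M2) (\<lambda>z. f (fst z) * g (snd z))"
proof (rule Fubini_integrable)
  have [measurable]: "f \<in> borel_measurable M1" "g \<in> borel_measurable M2"
    using f g by (auto dest: borel_measurable_integrable)
  show "(\<lambda>z. f (fst z) * g (snd z)) \<in> borel_measurable (M1 \<Otimes>\<^sub>M M2)" by simp
  show "integrable M1 (\<lambda>x. \<integral>y. norm (f (fst (x, y)) * g (snd (x, y))) \<partial>M2)"
    using f by (simp add: abs_mult)
  show "AE x in M1. integrable M2 (\<lambda>y. f (fst (x, y)) * g (snd (x, y)))"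
    using g by simp
qed

section \<open>Cauchy-Schwarz and autocorrelations\<close>

lemma L2_mult_integrable:
  fixes f g :: "'a \<Rightarrow> complex"
  assumes [measurable]: "f \<in> borel_measurable M" "g \<in> borel_measurable M"
    and f: "L2_sq M f < \<infinity>" and g: "L2_sq M g < \<infinity>"
  shows "integrable M (\<lambda>x. f x * g x)"
    and "(ennreal (norm (\<integral>x. f x * g x \<partial>M)))\<^sup>2 \<le> L2_sq M f * L2_sq M g"
proof -
  have CS: "(\<integral>\<^sup>+ x. ennreal (norm (f x * g x)) \<partial>M)\<^sup>2 \<le> L2_sq M f * L2_sq M g"
    using Cauchy_Schwarz_nn_integral[of "\<lambda>x. ennreal (norm (f x))" M "\<lambda>x. ennreal (norm (g x))"]
    by (simp add: L2_sq_def norm_mult ennreal_mult ennreal_power)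
  have "L2_sq M f * L2_sq M g < \<infinity>" using f g by (simp add: ennreal_mult_less_top)
  with CS have "(\<integral>\<^sup>+ x. ennreal (norm (f x * g x)) \<partial>M)\<^sup>2 < \<infinity>" by (rule le_less_trans)
  then have "(\<integral>\<^sup>+ x. ennreal (norm (f x * g x)) \<partial>M) < \<infinity>"
    by (auto simp: power2_eq_square ennreal_mult_less_top less_top)
  then show "integrable M (\<lambda>x. f x * g x)" by (simp add: integrable_iff_bounded)
  have "ennreal (norm (\<integral>x. f x * g x \<partial>M)) \<le> (\<integral>\<^sup>+ x. ennreal (norm (f x * g x)) \<partial>M)"
    by (rule integral_norm_bound_ennreal) fact
  then have "(ennreal (norm (\<integral>x. f x * g x \<partial>M)))\<^sup>2 \<le> (\<integral>\<^sup>+ x. ennreal (norm (f x * g x)) \<partial>M)\<^sup>2"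
    by (rule power_mono) simp
  with CS show "(ennreal (norm (\<integral>x. f x * g x \<partial>M)))\<^sup>2 \<le> L2_sq M f * L2_sq M g" by simp
qed

lemma fourier_integral_measurable [measurable]:
  assumes [measurable]: "g \<in> borel_measurable borel"
  shows "fourier_integral g \<in> borel_measurable borel"
  unfolding fourier_integral_def by measurable

lemma fourier_integral_bound:
  assumes "integrable lborel g"
  shows "norm (fourier_integral g \<xi>) \<le> (1 / (2 * pi)) * (\<integral>x. norm (g x) \<partial>lborel)"
proof -
  have "norm (\<integral>x. cis (- (x \<bullet> \<xi>)) * g x \<partial>lborel) \<le> (\<integral>x. norm (cis (- (x \<bullet> \<xi>)) * g x) \<partial>lborel)"
    by (rule integral_norm_bound)
  then show ?thesis
    by (simp add: fourier_integral_def norm_mult norm_divide divide_right_mono)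
qed

text \<open>Up to a constant and a reflection its Fourier transform is the squared modulus of the
  transform of \<open>g\<close>. Since its value at 0 is the squared norm of \<open>g\<close>,
  Plancherel becomes a statement about continuity at 0.\<close>

definition autocorr :: "(real \<times> real \<Rightarrow> complex) \<Rightarrow> real \<times> real \<Rightarrow> complex" where
  "autocorr g v = (\<integral>x. g x * cnj (g (x + v)) \<partial>lborel)"

lemma L2_sq_cnj: "L2_sq M (\<lambda>x. cnj (f x)) = L2_sq M f"
  by (simp add: L2_sq_def)

lemma autocorr_measurable [measurable]:
  assumes [measurable]: "g \<in> borel_measurable borel"
  shows "autocorr g \<in> borel_measurable borel"
  unfolding autocorr_def by measurable

lemma autocorr_bound:
  assumes [measurable]: "g \<in> borel_measurable borel" and fin: "L2_sq lborel g < \<infinity>"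
  shows "norm (autocorr g v) \<le> enn2real (L2_sq lborel g)"
proof -
  have "L2_sq lborel (\<lambda>x. cnj (g (x + v))) = L2_sq lborel g"
    unfolding L2_sq_cnj by (rule L2_sq_translate) simp
  then have "(ennreal (norm (autocorr g v)))\<^sup>2 \<le> (L2_sq lborel g)\<^sup>2"
    unfolding autocorr_def
    using L2_mult_integrable(2)[of g lborel "\<lambda>x. cnj (g (x + v))"] fin by (simp add: power2_eq_square)
  also have "L2_sq lborel g = ennreal (enn2real (L2_sq lborel g))" using fin by simp
  finally have "(norm (autocorr g v))\<^sup>2 \<le> (enn2real (L2_sq lborel g))\<^sup>2"
    by (simp add: ennreal_power)
  then show ?thesis by (rule power2_le_imp_le) simp
qed

lemma autocorr_0:
  assumes [measurable]: "g \<in> borel_measurable borel" and fin: "L2_sq lborel g < \<infinity>"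
  shows "autocorr g 0 = of_real (enn2real (L2_sq lborel g))"
proof -
  have "autocorr g 0 = (\<integral>x. complex_of_real ((norm (g x))\<^sup>2) \<partial>lborel)"
    unfolding autocorr_def complex_norm_square by simp
  also have "\<dots> = of_real (\<integral>x. (norm (g x))\<^sup>2 \<partial>lborel)" by (rule integral_complex_of_real)
  also have "(\<integral>x. (norm (g x))\<^sup>2 \<partial>lborel) = enn2real (L2_sq lborel g)"
    unfolding L2_sq_def by (rule integral_eq_nn_integral) auto
  finally show ?thesis .
qed

text \<open>The difference of the two values is the inner product of \<open>g\<close> with a
  translate of \<open>g\<close> minus \<open>g\<close>, which Cauchy-Schwarz and the continuity of
  translations make small.\<close>

lemma autocorr_tendsto:
  assumes [measurable]: "g \<in> borel_measurable borel" and fin: "L2_sq lborel g < \<infinity>"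
    and v: "v \<longlonglongrightarrow> 0"
  shows "(\<lambda>n::nat. autocorr g (v n)) \<longlonglongrightarrow> autocorr g 0"
proof -
  have i: "integrable lborel (\<lambda>x. g x * cnj (g (x + w)))" for w
  proof -
    have "L2_sq lborel (\<lambda>x. cnj (g (x + w))) = L2_sq lborel g"
      unfolding L2_sq_cnj by (rule L2_sq_translate) simp
    then show ?thesis using fin by (intro L2_mult_integrable) auto
  qed
  have le: "(ennreal (norm (autocorr g w - autocorr g 0)))\<^sup>2 \<le> L2_sq lborel g * L2_sq lborel (\<lambda>x. g (x + w) - g x)"
    for w
  proof -
    have "L2_sq lborel (\<lambda>x. g (x + w) - g x) \<le> 2 * L2_sq lborel (\<lambda>x. g (x + w)) + 2 * L2_sq lborel (\<lambda>x. - g x)"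
      using L2_sq_add_le2[of "\<lambda>x. g (x + w)" lborel "\<lambda>x. - g x"] by simp
    also have "\<dots> < \<infinity>" using fin by (simp add: L2_sq_translate ennreal_mult_less_top ennreal_add_less_top)
    finally have f: "L2_sq lborel (\<lambda>x. cnj (g (x + w) - g x)) < \<infinity>" by (simp only: L2_sq_cnj)
    have "autocorr g w - autocorr g 0 = (\<integral>x. g x * cnj (g (x + w) - g x) \<partial>lborel)"
      unfolding autocorr_def using i[of w] i[of 0]
      by (subst Bochner_Integration.integral_diff[symmetric]) (auto simp: algebra_simps)
    moreover have "(ennreal (norm (\<integral>x. g x * cnj (g (x + w) - g x) \<partial>lborel)))\<^sup>2 \<le>
        L2_sq lborel g * L2_sq lborel (\<lambda>x. cnj (g (x + w) - g x))"
      by (rule L2_mult_integrable(2)[OF _ _ fin f]) measurable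
    ultimately show ?thesis by (simp only: L2_sq_cnj)
  qed
  have lim: "(\<lambda>n. L2_sq lborel g * L2_sq lborel (\<lambda>x. g (x + v n) - g x)) \<longlonglongrightarrow> L2_sq lborel g * 0"
    using fin by (intro tendsto_mult_ennreal tendsto_const L2_translation_continuous v) auto
  have "(\<lambda>n. (ennreal (norm (autocorr g (v n) - autocorr g 0)))\<^sup>2) \<longlonglongrightarrow> 0"
  proof (rule tendsto_sandwich)
    show "(\<lambda>_. 0 :: ennreal) \<longlonglongrightarrow> 0" by simp
    show "(\<lambda>n. L2_sq lborel g * L2_sq lborel (\<lambda>x. g (x + v n) - g x)) \<longlonglongrightarrow> 0"
      using lim by simp
  qed (simp_all add: le)
  then have "(\<lambda>n. (norm (autocorr g (v n) - autocorr g 0))\<^sup>2) \<longlonglongrightarrow> 0"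
    by (simp add: ennreal_power ennreal_tendsto_0_iff)
  then have "(\<lambda>n. sqrt ((norm (autocorr g (v n) - autocorr g 0))\<^sup>2)) \<longlonglongrightarrow> sqrt 0"
    by (rule tendsto_real_sqrt)
  then have "(\<lambda>n. norm (autocorr g (v n) - autocorr g 0)) \<longlonglongrightarrow> 0" by simp
  then show ?thesis by (rule LIM_zero_cancel[OF tendsto_norm_zero_cancel])
qed

text \<open>The factor \<open>2 * pi * gauss2 (s *\<^sub>R \<xi>)\<close> equals
  \<open>exp (- (norm (s *\<^sub>R \<xi>))\<^sup>2 / 2)\<close>, so the left side is a damped
  squared norm of the transform. Damping makes the integrals over \<xi> and the two space variables
  absolutely convergent, so \<xi> can be integrated first. This leaves a Gaussian of width
  \<open>s\<close> in the difference of the space variables.\<close>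

lemma fourier_integral_regularised:
  assumes [measurable]: "g \<in> borel_measurable borel" and int: "integrable lborel g"
    and fin: "L2_sq lborel g < \<infinity>" and s: "s > 0"
  shows "(\<integral>\<xi>. fourier_integral g \<xi> * cnj (fourier_integral g \<xi>) * of_real (2 * pi * gauss2 (s *\<^sub>R \<xi>)) \<partial>lborel) =
    (\<integral>w. of_real (gauss2 w) * autocorr g (s *\<^sub>R w) \<partial>lborel)"
proof -
  define c :: complex where "c = of_real (1 / (2 * pi))"
  define G where "G = fourier_integral g"
  define \<gamma> where "\<gamma> \<xi> = gauss2 (s *\<^sub>R \<xi>)" for \<xi>
  have Gm[measurable]: "G \<in> borel_measurable borel" unfolding G_def by simp
  have \<gamma>m[measurable]: "\<gamma> \<in> borel_measurable borel" unfolding \<gamma>_def by simp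
  have \<gamma>0: "0 \<le> \<gamma> \<xi>" for \<xi> by (simp add: \<gamma>_def)
  have \<gamma>i: "integrable lborel \<gamma>" unfolding \<gamma>_def using s by (intro gauss2_scaled_integrable) auto
  obtain C where C: "\<And>\<xi>. norm (G \<xi>) \<le> C" unfolding G_def using fourier_integral_bound[OF int] by blast
  have cG: "cnj (G \<xi>) = (\<integral>y. c * cis (y \<bullet> \<xi>) * cnj (g y) \<partial>lborel)" for \<xi>
  proof -
    have "(\<integral>y. c * cis (y \<bullet> \<xi>) * cnj (g y) \<partial>lborel) = (\<integral>y. cnj (c * (cis (- (y \<bullet> \<xi>)) * g y)) \<partial>lborel)"
      by (intro Bochner_Integration.integral_cong refl) (simp add: c_def cis_cnj mult.assoc)
    also have "\<dots> = cnj (G \<xi>)"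
      unfolding Bochner_Integration.integral_cnj integral_mult_right_zero by (simp add: G_def fourier_integral_def c_def)
    finally show ?thesis ..
  qed
  have inner: "(\<integral>\<xi>. c * cis (- (x \<bullet> \<xi>)) * \<gamma> \<xi> * cnj (G \<xi>) \<partial>lborel) =
      c * (\<integral>w. of_real (gauss2 w) * cnj (g (x + s *\<^sub>R w)) \<partial>lborel)" for x
  proof -
    have i2: "integrable (lborel \<Otimes>\<^sub>M lborel) (\<lambda>(\<xi>, y). c * c * cis (- ((x - y) \<bullet> \<xi>)) * \<gamma> \<xi> * cnj (g y))"
    proof (rule Bochner_Integration.integrable_bound)
      show "integrable (lborel \<Otimes>\<^sub>M lborel) (\<lambda>z. (norm (c * c) * \<gamma> (fst z)) * norm (g (snd z)))"
        by (rule lborel_pair.integrable_pair_mult) (use \<gamma>i int in auto)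
    qed (auto simp: norm_mult \<gamma>0)
    have "(\<integral>\<xi>. c * cis (- (x \<bullet> \<xi>)) * \<gamma> \<xi> * cnj (G \<xi>) \<partial>lborel) =
        (\<integral>\<xi>. (\<integral>y. c * c * cis (- ((x - y) \<bullet> \<xi>)) * \<gamma> \<xi> * cnj (g y) \<partial>lborel) \<partial>lborel)"
      unfolding cG integral_mult_right_zero[symmetric]
      by (intro Bochner_Integration.integral_cong refl)
        (simp add: inner_diff_left algebra_simps cis_mult)
    also have "\<dots> = (\<integral>y. (\<integral>\<xi>. c * c * cis (- ((x - y) \<bullet> \<xi>)) * \<gamma> \<xi> * cnj (g y) \<partial>lborel) \<partial>lborel)"
      by (rule lborel_pair.Fubini_integral[OF i2, symmetric])
    also have "\<dots> = (\<integral>y. c / s\<^sup>2 * gauss2 ((1 / s) *\<^sub>R (x - y)) * cnj (g y) \<partial>lborel)"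
    proof (intro Bochner_Integration.integral_cong refl)
      fix y
      have "(\<integral>\<xi>. c * c * cis (- ((x - y) \<bullet> \<xi>)) * \<gamma> \<xi> * cnj (g y) \<partial>lborel) =
          c * c * cnj (g y) * (\<integral>\<xi>. cis (- ((x - y) \<bullet> \<xi>)) * \<gamma> \<xi> \<partial>lborel)"
        unfolding integral_mult_right_zero[symmetric]
        by (intro Bochner_Integration.integral_cong refl) (simp add: mult_ac)
      also have "\<dots> = c / s\<^sup>2 * gauss2 ((1 / s) *\<^sub>R (x - y)) * cnj (g y)"
        unfolding \<gamma>_def gauss2_scaled_char[OF s] by (simp add: c_def field_simps)
      finally show "(\<integral>\<xi>. c * c * cis (- ((x - y) \<bullet> \<xi>)) * \<gamma> \<xi> * cnj (g y) \<partial>lborel) =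
         c / s\<^sup>2 * gauss2 ((1 / s) *\<^sub>R (x - y)) * cnj (g y)" .
    qed
    \<comment> \<open>Substitution \<open>y = x + s *\<^sub>R w\<close>: the Jacobian
      \<open>s\<^sup>2\<close> cancels the factor \<open>1 / s\<^sup>2\<close>, and the Gaussian is
      even.\<close>
    also have "\<dots> = \<bar>s\<bar> ^ DIM(real \<times> real) *\<^sub>R
        (\<integral>w. c / s\<^sup>2 * gauss2 ((1 / s) *\<^sub>R (x - (x + s *\<^sub>R w))) * cnj (g (x + s *\<^sub>R w)) \<partial>lborel)"
      by (rule lborel_integral_affine) (use s in auto)
    also have "\<dots> = c * (\<integral>w. of_real (gauss2 w) * cnj (g (x + s *\<^sub>R w)) \<partial>lborel)"
      unfolding integral_mult_right_zero[symmetric] integral_scaleR_right[symmetric]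
      by (intro Bochner_Integration.integral_cong refl)
       (use s in \<open>simp add: scaleR_conv_of_real gauss2_def power2_eq_square\<close>)
    finally show ?thesis .
  qed
  have i1: "integrable (lborel \<Otimes>\<^sub>M lborel) (\<lambda>(\<xi>, x). c * cis (- (x \<bullet> \<xi>)) * g x * (cnj (G \<xi>) * \<gamma> \<xi>))"
  proof (rule Bochner_Integration.integrable_bound)
    show "integrable (lborel \<Otimes>\<^sub>M lborel) (\<lambda>z. (norm c * C * \<gamma> (fst z)) * norm (g (snd z)))"
      by (rule lborel_pair.integrable_pair_mult) (use \<gamma>i int in auto)
    have "norm c * norm (g x) * (norm (G \<xi>) * \<gamma> \<xi>) \<le> norm c * C * \<gamma> \<xi> * norm (g x)" for \<xi> x
    proof -
      have "norm c * norm (g x) * (norm (G \<xi>) * \<gamma> \<xi>) \<le> norm c * norm (g x) * (C * \<gamma> \<xi>)"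
        using C[of \<xi>] \<gamma>0[of \<xi>] by (intro mult_left_mono mult_right_mono) auto
      then show ?thesis by (simp add: mult_ac)
    qed
    moreover have "0 \<le> C" using norm_ge_zero C order_trans by blast
    ultimately show "AE z in lborel \<Otimes>\<^sub>M lborel. norm (case z of (\<xi>, x) \<Rightarrow> c * cis (- (x \<bullet> \<xi>)) * g x * (cnj (G \<xi>) * \<gamma> \<xi>))
        \<le> norm ((norm c * C * \<gamma> (fst z)) * norm (g (snd z)))"
      by (intro AE_I2) (auto simp: norm_mult \<gamma>0 abs_mult)
  qed simp
  \<comment> \<open>Here the shift couples the two variables, so no product majorant is at hand. The
    product of \<open>g\<close> and its translate is bounded by the sum of their squares, and each
    square integrates to \<open>L2_sq lborel g\<close> for every \<open>w\<close>.\<close>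
  have i3: "integrable (lborel \<Otimes>\<^sub>M lborel) (\<lambda>(w, x). of_real (gauss2 w) * (g x * cnj (g (x + s *\<^sub>R w))))"
  proof (rule integrableI_bounded)
    have "(\<integral>\<^sup>+ z. norm (case z of (w, x) \<Rightarrow> of_real (gauss2 w) * (g x * cnj (g (x + s *\<^sub>R w)))) \<partial>(lborel \<Otimes>\<^sub>M lborel)) =
       (\<integral>\<^sup>+ w. (\<integral>\<^sup>+ x. norm (of_real (gauss2 w) * (g x * cnj (g (x + s *\<^sub>R w)))) \<partial>lborel) \<partial>lborel)"
      by (subst lborel.nn_integral_fst[symmetric]) auto
    also have "\<dots> \<le> (\<integral>\<^sup>+ w. ennreal (gauss2 w) * (2 * L2_sq lborel g) \<partial>lborel)"
    proof (intro nn_integral_mono)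
      fix w
      have "(\<integral>\<^sup>+ x. norm (of_real (gauss2 w) * (g x * cnj (g (x + s *\<^sub>R w)))) \<partial>lborel) \<le>
        (\<integral>\<^sup>+ x. ennreal (gauss2 w) * (ennreal ((norm (g x))\<^sup>2) + ennreal ((norm (g (x + s *\<^sub>R w)))\<^sup>2)) \<partial>lborel)"
      proof (intro nn_integral_mono)
        fix x
        have "norm (g x) * norm (g (x + s *\<^sub>R w)) \<le> (norm (g x))\<^sup>2 + (norm (g (x + s *\<^sub>R w)))\<^sup>2"
          using sum_squares_bound[of "norm (g x)" "norm (g (x + s *\<^sub>R w))"]
            mult_nonneg_nonneg[OF norm_ge_zero[of "g x"] norm_ge_zero[of "g (x + s *\<^sub>R w)"]] by linarith
        then have "norm (of_real (gauss2 w) * (g x * cnj (g (x + s *\<^sub>R w)))) \<le>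
          gauss2 w * ((norm (g x))\<^sup>2 + (norm (g (x + s *\<^sub>R w)))\<^sup>2)"
          by (simp add: norm_mult mult_left_mono)
        then show "ennreal (norm (of_real (gauss2 w) * (g x * cnj (g (x + s *\<^sub>R w))))) \<le>
          ennreal (gauss2 w) * (ennreal ((norm (g x))\<^sup>2) + ennreal ((norm (g (x + s *\<^sub>R w)))\<^sup>2))"
          by (simp add: ennreal_mult[symmetric] ennreal_plus[symmetric] ennreal_leI del: ennreal_plus)
      qed
      also have "\<dots> = ennreal (gauss2 w) * (2 * L2_sq lborel g)"
        using L2_sq_translate[of g "s *\<^sub>R w"]
        by (simp add: nn_integral_cmult nn_integral_add L2_sq_def mult_2)
      finally show "(\<integral>\<^sup>+ x. norm (of_real (gauss2 w) * (g x * cnj (g (x + s *\<^sub>R w)))) \<partial>lborel) \<le>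
        ennreal (gauss2 w) * (2 * L2_sq lborel g)" .
    qed
    also have "\<dots> = (\<integral>\<^sup>+ w. ennreal (gauss2 w) \<partial>lborel) * (2 * L2_sq lborel g)"
      by (simp add: nn_integral_multc)
    also have "\<dots> < \<infinity>" using fin gauss2_integrable
      by (auto simp: integrable_iff_bounded ennreal_mult_less_top)
    finally show "(\<integral>\<^sup>+ z. norm (case z of (w, x) \<Rightarrow> of_real (gauss2 w) * (g x * cnj (g (x + s *\<^sub>R w)))) \<partial>(lborel \<Otimes>\<^sub>M lborel)) < \<infinity>" .
  qed simp
  have "(\<integral>\<xi>. G \<xi> * cnj (G \<xi>) * \<gamma> \<xi> \<partial>lborel) =
      (\<integral>\<xi>. (\<integral>x. c * cis (- (x \<bullet> \<xi>)) * g x * (cnj (G \<xi>) * \<gamma> \<xi>) \<partial>lborel) \<partial>lborel)"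
  proof (intro Bochner_Integration.integral_cong refl)
    fix \<xi>
    have "G \<xi> = (\<integral>x. c * cis (- (x \<bullet> \<xi>)) * g x \<partial>lborel)"
      by (simp add: G_def fourier_integral_def c_def mult.assoc)
    from arg_cong[OF this, of "\<lambda>u. u * (cnj (G \<xi>) * \<gamma> \<xi>)"]
    show "G \<xi> * cnj (G \<xi>) * \<gamma> \<xi> = (\<integral>x. c * cis (- (x \<bullet> \<xi>)) * g x * (cnj (G \<xi>) * \<gamma> \<xi>) \<partial>lborel)"
      unfolding integral_mult_left_zero[symmetric] by (simp only: mult.assoc)
  qed
  also have "\<dots> = (\<integral>x. (\<integral>\<xi>. c * cis (- (x \<bullet> \<xi>)) * g x * (cnj (G \<xi>) * \<gamma> \<xi>) \<partial>lborel) \<partial>lborel)"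
    by (rule lborel_pair.Fubini_integral[OF i1, symmetric])
  also have "\<dots> = (\<integral>x. g x * (\<integral>\<xi>. c * cis (- (x \<bullet> \<xi>)) * \<gamma> \<xi> * cnj (G \<xi>) \<partial>lborel) \<partial>lborel)"
    unfolding integral_mult_right_zero[symmetric]
    by (intro Bochner_Integration.integral_cong refl) (simp add: mult_ac)
  also have "\<dots> = c * (\<integral>x. (\<integral>w. of_real (gauss2 w) * (g x * cnj (g (x + s *\<^sub>R w))) \<partial>lborel) \<partial>lborel)"
    unfolding inner integral_mult_right_zero[symmetric]
    by (intro Bochner_Integration.integral_cong refl) (simp add: mult_ac)
  also have "(\<integral>x. (\<integral>w. of_real (gauss2 w) * (g x * cnj (g (x + s *\<^sub>R w))) \<partial>lborel) \<partial>lborel) =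
      (\<integral>w. (\<integral>x. of_real (gauss2 w) * (g x * cnj (g (x + s *\<^sub>R w))) \<partial>lborel) \<partial>lborel)"
    by (rule lborel_pair.Fubini_integral[OF i3])
  also have "\<dots> = (\<integral>w. of_real (gauss2 w) * autocorr g (s *\<^sub>R w) \<partial>lborel)"
    by (simp add: autocorr_def)
  finally have J: "(\<integral>\<xi>. G \<xi> * cnj (G \<xi>) * \<gamma> \<xi> \<partial>lborel) = c * (\<integral>w. of_real (gauss2 w) * autocorr g (s *\<^sub>R w) \<partial>lborel)" .
  have "(\<integral>\<xi>. G \<xi> * cnj (G \<xi>) * of_real (2 * pi * gauss2 (s *\<^sub>R \<xi>)) \<partial>lborel) =
     of_real (2 * pi) * (\<integral>\<xi>. G \<xi> * cnj (G \<xi>) * \<gamma> \<xi> \<partial>lborel)"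
    unfolding integral_mult_right_zero[symmetric]
    by (intro Bochner_Integration.integral_cong refl) (simp add: \<gamma>_def mult_ac)
  also have "\<dots> = (\<integral>w. of_real (gauss2 w) * autocorr g (s *\<^sub>R w) \<partial>lborel)"
    unfolding J by (simp add: c_def)
  finally show ?thesis unfolding G_def .
qed

text \<open>Both sides of the regularised identity converge as \<open>s\<close> tends to 0: the
  frequency side by monotone convergence, since the damping factor increases to 1, and the
  autocorrelation side by dominated convergence, since the autocorrelation is bounded by the squared
  norm of \<open>g\<close>. Finiteness of the transform's norm is thus a conclusion.\<close>

lemma plancherel_integrable:
  assumes [measurable]: "g \<in> borel_measurable borel" and int: "integrable lborel g"
    and fin: "L2_sq lborel g < \<infinity>"
  shows "L2_sq lborel (fourier_integral g) = L2_sq lborel g"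
proof -
  define G where "G = fourier_integral g"
  define s where "s n = 1 / real (Suc n)" for n
  define b where "b = enn2real (L2_sq lborel g)"
  have Gm[measurable]: "G \<in> borel_measurable borel" unfolding G_def by simp
  have s: "s n > 0" for n by (simp add: s_def)
  have s0: "s \<longlonglongrightarrow> 0" unfolding s_def by (rule LIMSEQ_Suc[OF lim_1_over_n])
  have sdec: "s (Suc n) \<le> s n" for n by (simp add: s_def field_simps)
  obtain C where C: "\<And>\<xi>. norm (G \<xi>) \<le> C" unfolding G_def using fourier_integral_bound[OF int] by blast
  define r where "r n \<xi> = (norm (G \<xi>))\<^sup>2 * exp (- (norm (s n *\<^sub>R \<xi>))\<^sup>2 / 2)" for n \<xi>
  have r_eq: "r n \<xi> = (norm (G \<xi>))\<^sup>2 * (2 * pi * gauss2 (s n *\<^sub>R \<xi>))" for n \<xi>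
    by (simp add: r_def gauss2_def)
  have rm[measurable]: "r n \<in> borel_measurable borel" for n unfolding r_def by simp
  have r0: "0 \<le> r n \<xi>" for n \<xi> by (simp add: r_def)
  have ri: "integrable lborel (r n)" for n
  proof (rule Bochner_Integration.integrable_bound)
    show "integrable lborel (\<lambda>\<xi>. C\<^sup>2 * (2 * pi * gauss2 (s n *\<^sub>R \<xi>)))"
      using gauss2_scaled_integrable[of "s n"] s[of n] by simp
    show "AE \<xi> in lborel. norm (r n \<xi>) \<le> norm (C\<^sup>2 * (2 * pi * gauss2 (s n *\<^sub>R \<xi>)))"
    proof (intro AE_I2)
      fix \<xi>
      have "(norm (G \<xi>))\<^sup>2 \<le> C\<^sup>2" using C by (intro power_mono) auto
      then show "norm (r n \<xi>) \<le> norm (C\<^sup>2 * (2 * pi * gauss2 (s n *\<^sub>R \<xi>)))"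
        unfolding r_eq by (simp add: abs_mult mult_right_mono)
    qed
  qed simp
  have "complex_of_real (\<integral>\<xi>. r n \<xi> \<partial>lborel) = (\<integral>w. of_real (gauss2 w) * autocorr g (s n *\<^sub>R w) \<partial>lborel)" for n
  proof -
    have "complex_of_real (\<integral>\<xi>. r n \<xi> \<partial>lborel) = (\<integral>\<xi>. complex_of_real (r n \<xi>) \<partial>lborel)"
      by (rule integral_complex_of_real[symmetric])
    also have "\<dots> = (\<integral>\<xi>. G \<xi> * cnj (G \<xi>) * of_real (2 * pi * gauss2 (s n *\<^sub>R \<xi>)) \<partial>lborel)"
      by (intro Bochner_Integration.integral_cong refl) (simp add: r_eq flip: complex_norm_square)
    finally show ?thesis unfolding G_def fourier_integral_regularised[OF assms s] .
  qed
  moreover have "(\<lambda>n. (\<integral>w. of_real (gauss2 w) * autocorr g (s n *\<^sub>R w) \<partial>lborel)) \<longlonglongrightarrow>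
      (\<integral>w. of_real (gauss2 w) * autocorr g 0 \<partial>lborel)"
  proof (rule integral_dominated_convergence[where w="\<lambda>w. gauss2 w * b"])
    show "AE w in lborel. (\<lambda>n. of_real (gauss2 w) * autocorr g (s n *\<^sub>R w)) \<longlonglongrightarrow> of_real (gauss2 w) * autocorr g 0"
      by (intro AE_I2 tendsto_intros autocorr_tendsto fin) (use tendsto_scaleR[OF s0 tendsto_const] in auto)
    show "AE w in lborel. norm (of_real (gauss2 w) * autocorr g (s n *\<^sub>R w)) \<le> gauss2 w * b" for n
      unfolding b_def by (auto simp: norm_mult intro!: mult_left_mono autocorr_bound fin)
  qed auto
  moreover have "(\<integral>w. of_real (gauss2 w) * autocorr g 0 \<partial>lborel) = complex_of_real b"
    by (simp add: autocorr_0[OF assms(1) fin] b_def)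
  ultimately have "(\<lambda>n. complex_of_real (\<integral>\<xi>. r n \<xi> \<partial>lborel)) \<longlonglongrightarrow> complex_of_real b" by simp
  then have "(\<lambda>n. \<integral>\<xi>. r n \<xi> \<partial>lborel) \<longlonglongrightarrow> b" by (simp only: tendsto_of_real_iff)
  then have "(\<lambda>n. ennreal (\<integral>\<xi>. r n \<xi> \<partial>lborel)) \<longlonglongrightarrow> ennreal b" by (rule tendsto_ennrealI)
  then have 1: "(\<lambda>n. \<integral>\<^sup>+\<xi>. ennreal (r n \<xi>) \<partial>lborel) \<longlonglongrightarrow> ennreal b"
    by (simp add: nn_integral_eq_integral ri r0)
  have "(\<lambda>n. \<integral>\<^sup>+\<xi>. ennreal (r n \<xi>) \<partial>lborel) \<longlonglongrightarrow> (\<integral>\<^sup>+\<xi>. ennreal ((norm (G \<xi>))\<^sup>2) \<partial>lborel)"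
  proof (rule nn_integral_LIMSEQ)
    have "r n \<xi> \<le> r (Suc n) \<xi>" for n \<xi>
    proof -
      have "(s (Suc n) * norm \<xi>)\<^sup>2 \<le> (s n * norm \<xi>)\<^sup>2"
        using sdec[of n] s[of "Suc n"] by (intro power_mono mult_right_mono) auto
      then show ?thesis using s[of n] s[of "Suc n"] unfolding r_def by (intro mult_left_mono) auto
    qed
    then show "incseq (\<lambda>n \<xi>. ennreal (r n \<xi>))"
      by (intro incseq_SucI le_funI ennreal_leI)
    show "(\<lambda>n. ennreal (r n \<xi>)) \<longlonglongrightarrow> ennreal ((norm (G \<xi>))\<^sup>2)" for \<xi>
    proof (intro tendsto_ennrealI)
      have "(\<lambda>n. r n \<xi>) \<longlonglongrightarrow> (norm (G \<xi>))\<^sup>2 * exp (- (norm (0 *\<^sub>R \<xi>))\<^sup>2 / 2)"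
        unfolding r_def by (intro tendsto_intros s0) auto
      then show "(\<lambda>n. r n \<xi>) \<longlonglongrightarrow> (norm (G \<xi>))\<^sup>2" by simp
    qed
  qed simp
  with 1 have "(\<integral>\<^sup>+\<xi>. ennreal ((norm (G \<xi>))\<^sup>2) \<partial>lborel) = ennreal b" by (rule LIMSEQ_unique[symmetric])
  then show ?thesis using fin by (simp add: L2_sq_def G_def b_def)
qed

section \<open>Plancherel for square integrable functions\<close>

lemma square_integrable_iff_L2_sq:
  "square_integrable f \<longleftrightarrow> f \<in> borel_measurable borel \<and> L2_sq lborel f < \<infinity>"
  by (simp add: square_integrable_def L2_sq_def)

lemma L2_sq_add_tendsto_0:
  fixes u v :: "nat \<Rightarrow> 'a \<Rightarrow> 'b::{real_normed_vector, second_countable_topology}"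
  assumes "\<And>n. u n \<in> borel_measurable M" "\<And>n. v n \<in> borel_measurable M"
    and "(\<lambda>n. L2_sq M (u n)) \<longlonglongrightarrow> 0" "(\<lambda>n. L2_sq M (v n)) \<longlonglongrightarrow> 0"
  shows "(\<lambda>n. L2_sq M (\<lambda>x. u n x + v n x)) \<longlonglongrightarrow> 0"
proof (rule tendsto_sandwich)
  show "(\<lambda>_. 0 :: ennreal) \<longlonglongrightarrow> 0" by simp
  have "(\<lambda>n. 2 * L2_sq M (u n) + 2 * L2_sq M (v n)) \<longlonglongrightarrow> 2 * 0 + 2 * 0"
    by (intro tendsto_add tendsto_mult_ennreal tendsto_const assms) auto
  then show "(\<lambda>n. 2 * L2_sq M (u n) + 2 * L2_sq M (v n)) \<longlonglongrightarrow> 0" by simp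
qed (use L2_sq_add_le2[OF assms(1,2)] in auto)

lemma L2_sq_scaleR_tendsto_0:
  fixes u :: "nat \<Rightarrow> 'a \<Rightarrow> 'b::{real_normed_vector, second_countable_topology}"
  assumes "\<And>n. u n \<in> borel_measurable M" and "(\<lambda>n. L2_sq M (u n)) \<longlonglongrightarrow> 0"
  shows "(\<lambda>n. L2_sq M (\<lambda>x. c *\<^sub>R u n x)) \<longlonglongrightarrow> 0"
proof -
  have "(\<lambda>n. ennreal (c\<^sup>2) * L2_sq M (u n)) \<longlonglongrightarrow> ennreal (c\<^sup>2) * 0"
    by (intro tendsto_mult_ennreal tendsto_const assms) auto
  then show ?thesis using assms(1) by (simp add: L2_sq_scaleR)
qed

lemma square_integrable_add:
  fixes f g :: "real \<times> real \<Rightarrow> 'b::{real_normed_vector, second_countable_topology}"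
  assumes "square_integrable f" "square_integrable g"
  shows "square_integrable (\<lambda>x. f x + g x)"
proof -
  have [measurable]: "f \<in> borel_measurable borel" "g \<in> borel_measurable borel"
    and fin: "L2_sq lborel f < \<infinity>" "L2_sq lborel g < \<infinity>"
    using assms by (auto simp: square_integrable_iff_L2_sq)
  have "L2_sq lborel (\<lambda>x. f x + g x) \<le> 2 * L2_sq lborel f + 2 * L2_sq lborel g"
    by (rule L2_sq_add_le2) auto
  also have "\<dots> < \<infinity>" using fin by (simp add: ennreal_mult_less_top ennreal_add_less_top)
  finally show ?thesis by (simp add: square_integrable_iff_L2_sq)
qed

lemma square_integrable_scaleR:
  fixes f :: "real \<times> real \<Rightarrow> 'b::{real_normed_vector, second_countable_topology}"
  assumes "square_integrable f"
  shows "square_integrable (\<lambda>x. c *\<^sub>R f x)"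
  using assms by (auto simp: square_integrable_iff_L2_sq L2_sq_scaleR ennreal_mult_less_top)

definition trunc :: "nat \<Rightarrow> (real \<times> real \<Rightarrow> complex) \<Rightarrow> real \<times> real \<Rightarrow> complex" where
  "trunc n g = (\<lambda>x. indicator (cball 0 (real n)) x * g x)"

lemma has_fourier_transform_iff:
  "has_fourier_transform g f \<longleftrightarrow> square_integrable g \<and> square_integrable f \<and>
    (\<lambda>n. L2_sq lborel (\<lambda>\<xi>. fourier_integral (trunc n g) \<xi> - f \<xi>)) \<longlonglongrightarrow> 0"
  by (simp add: has_fourier_transform_def L2_sq_def trunc_def)

lemma trunc_measurable [measurable]: "g \<in> borel_measurable borel \<Longrightarrow> trunc n g \<in> borel_measurable borel"
  unfolding trunc_def by measurable

lemma L2_sq_trunc_le: "L2_sq lborel (trunc n g) \<le> L2_sq lborel g"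
  unfolding L2_sq_def trunc_def by (intro nn_integral_mono) (auto simp: indicator_def)

lemma trunc_integrable:
  assumes "square_integrable g"
  shows "integrable lborel (trunc n g)"
  unfolding trunc_def
proof (rule L2_mult_integrable(1))
  have "L2_sq lborel (indicator (cball (0::real \<times> real) (real n)) :: _ \<Rightarrow> complex) =
      (\<integral>\<^sup>+ x. indicator (cball (0::real \<times> real) (real n)) x \<partial>lborel)"
    unfolding L2_sq_def by (intro nn_integral_cong) (auto simp: indicator_def)
  also have "\<dots> < \<infinity>" using emeasure_bounded_finite[of "cball (0::real \<times> real) (real n)"] by simp
  finally show "L2_sq lborel (indicator (cball (0::real \<times> real) (real n)) :: _ \<Rightarrow> complex) < \<infinity>" .
qed (use assms in \<open>auto simp: square_integrable_iff_L2_sq\<close>)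

lemma L2_sq_trunc_tendsto:
  assumes [measurable]: "g \<in> borel_measurable borel"
  shows "(\<lambda>n. L2_sq lborel (trunc n g)) \<longlonglongrightarrow> L2_sq lborel g"
  unfolding L2_sq_def
proof (rule nn_integral_LIMSEQ)
  show "incseq (\<lambda>n x. ennreal ((norm (trunc n g x))\<^sup>2))"
    by (intro incseq_SucI le_funI ennreal_leI) (auto simp: trunc_def indicator_def)
  show "(\<lambda>n. ennreal ((norm (trunc n g x))\<^sup>2)) \<longlonglongrightarrow> ennreal ((norm (g x))\<^sup>2)" for x
  proof (intro tendsto_eventually)
    have "eventually (\<lambda>n. norm x \<le> real n) sequentially"
      using filterlim_real_sequentially unfolding filterlim_at_top by blast
    then show "eventually (\<lambda>n. ennreal ((norm (trunc n g x))\<^sup>2) = ennreal ((norm (g x))\<^sup>2)) sequentially"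
      by eventually_elim (auto simp: trunc_def)
  qed
qed simp

text \<open>Truncations are integrable as well as square integrable, so the identity is exact for
  each of them. Their norms tend to that of \<open>g\<close> by monotone convergence, and the norms
  of their transforms to that of \<open>f\<close> by the defining limit.\<close>

lemma plancherel:
  assumes "has_fourier_transform g f"
  shows "L2_sq lborel g = L2_sq lborel f"
proof -
  have g: "square_integrable g" and f: "square_integrable f"
    and lim: "(\<lambda>n. L2_sq lborel (\<lambda>\<xi>. fourier_integral (trunc n g) \<xi> - f \<xi>)) \<longlonglongrightarrow> 0"
    using assms by (auto simp: has_fourier_transform_iff)
  have [measurable]: "g \<in> borel_measurable borel" "f \<in> borel_measurable borel"
    and fin: "L2_sq lborel g < \<infinity>" "L2_sq lborel f < \<infinity>"
    using g f by (auto simp: square_integrable_iff_L2_sq)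
  have "(\<lambda>n. L2_sq lborel (fourier_integral (trunc n g))) \<longlonglongrightarrow> L2_sq lborel f"
    by (rule L2_sq_tendsto) (use fin lim in auto)
  moreover have "L2_sq lborel (fourier_integral (trunc n g)) = L2_sq lborel (trunc n g)" for n
    by (rule plancherel_integrable)
      (use trunc_integrable[OF g] L2_sq_trunc_le[of n g] fin in \<open>auto intro: le_less_trans\<close>)
  ultimately have "(\<lambda>n. L2_sq lborel (trunc n g)) \<longlonglongrightarrow> L2_sq lborel f" by simp
  then show ?thesis using L2_sq_trunc_tendsto[of g] by (intro LIMSEQ_unique) auto
qed

section \<open>Linearity of the Fourier transform\<close>

lemma integrable_cis_mult:
  assumes "integrable lborel g"
  shows "integrable lborel (\<lambda>x. cis (- (x \<bullet> \<xi>)) * g x)"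
proof (rule Bochner_Integration.integrable_bound[OF assms])
  have [measurable]: "g \<in> borel_measurable borel" using assms by (auto dest: borel_measurable_integrable)
  show "(\<lambda>x. cis (- (x \<bullet> \<xi>)) * g x) \<in> borel_measurable lborel" by simp
qed (simp add: norm_mult)

lemma fourier_integral_add:
  assumes "integrable lborel g" "integrable lborel h"
  shows "fourier_integral (\<lambda>x. g x + h x) \<xi> = fourier_integral g \<xi> + fourier_integral h \<xi>"
  unfolding fourier_integral_def
  by (simp add: distrib_left integrable_cis_mult assms)

lemma fourier_integral_scaleR:
  "fourier_integral (\<lambda>x. c *\<^sub>R g x) \<xi> = c *\<^sub>R fourier_integral g \<xi>"
  unfolding fourier_integral_def by simp

lemma has_fourier_transform_add:
  assumes "has_fourier_transform g f" "has_fourier_transform g' f'"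
  shows "has_fourier_transform (\<lambda>x. g x + g' x) (\<lambda>\<xi>. f \<xi> + f' \<xi>)"
proof -
  have sq: "square_integrable g" "square_integrable f" "square_integrable g'" "square_integrable f'"
    and lim: "(\<lambda>n. L2_sq lborel (\<lambda>\<xi>. fourier_integral (trunc n g) \<xi> - f \<xi>)) \<longlonglongrightarrow> 0"
      "(\<lambda>n. L2_sq lborel (\<lambda>\<xi>. fourier_integral (trunc n g') \<xi> - f' \<xi>)) \<longlonglongrightarrow> 0"
    using assms by (auto simp: has_fourier_transform_iff)
  have [measurable]: "g \<in> borel_measurable borel" "f \<in> borel_measurable borel"
    "g' \<in> borel_measurable borel" "f' \<in> borel_measurable borel"
    using sq by (auto simp: square_integrable_iff_L2_sq)
  have eq: "(\<lambda>\<xi>. fourier_integral (trunc n (\<lambda>x. g x + g' x)) \<xi> - (f \<xi> + f' \<xi>)) =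
    (\<lambda>\<xi>. (fourier_integral (trunc n g) \<xi> - f \<xi>) + (fourier_integral (trunc n g') \<xi> - f' \<xi>))" for n
    using fourier_integral_add[OF trunc_integrable[OF sq(1), of n] trunc_integrable[OF sq(3), of n]]
    by (simp add: trunc_def distrib_left fun_eq_iff)
  show ?thesis unfolding has_fourier_transform_iff eq
    by (intro conjI square_integrable_add sq L2_sq_add_tendsto_0 lim) auto
qed

lemma has_fourier_transform_scaleR:
  assumes "has_fourier_transform g f"
  shows "has_fourier_transform (\<lambda>x. c *\<^sub>R g x) (\<lambda>\<xi>. c *\<^sub>R f \<xi>)"
proof -
  have sq: "square_integrable g" "square_integrable f"
    and lim: "(\<lambda>n. L2_sq lborel (\<lambda>\<xi>. fourier_integral (trunc n g) \<xi> - f \<xi>)) \<longlonglongrightarrow> 0"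
    using assms by (auto simp: has_fourier_transform_iff)
  have [measurable]: "g \<in> borel_measurable borel" "f \<in> borel_measurable borel"
    using sq by (auto simp: square_integrable_iff_L2_sq)
  have eq: "(\<lambda>\<xi>. fourier_integral (trunc n (\<lambda>x. c *\<^sub>R g x)) \<xi> - c *\<^sub>R f \<xi>) =
    (\<lambda>\<xi>. c *\<^sub>R (fourier_integral (trunc n g) \<xi> - f \<xi>))" for n
    using fourier_integral_scaleR[of c "trunc n g"]
    by (simp add: trunc_def fun_eq_iff scaleR_diff_right)
  show ?thesis unfolding has_fourier_transform_iff eq
    by (intro conjI square_integrable_scaleR sq L2_sq_scaleR_tendsto_0 lim) auto
qed

subsection \<open>Gaussian variables and Wiener integrals\<close>

lemma normal_density_char:
  assumes s: "\<sigma> > 0"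
  shows "(\<integral>x. cis (t * x) * of_real (normal_density 0 \<sigma> x) \<partial>lborel) = of_real (exp (- \<sigma>\<^sup>2 * t\<^sup>2 / 2))"
proof -
  have "(\<integral>x. cis (t * x) * of_real (normal_density 0 \<sigma> x) \<partial>lborel) =
      \<bar>\<sigma>\<bar> *\<^sub>R (\<integral>x. cis (t * (0 + \<sigma> * x)) * of_real (normal_density 0 \<sigma> (0 + \<sigma> * x)) \<partial>lborel)"
    by (rule lborel_integral_real_affine) (use s in auto)
  also have "\<dots> = (\<integral>x. cis ((t * \<sigma>) * x) * of_real (std_normal_density x) \<partial>lborel)"
    unfolding integral_scaleR_right[symmetric]
  proof (intro Bochner_Integration.integral_cong refl)
    fix x
    have "\<sigma> * normal_density 0 \<sigma> (0 + \<sigma> * x) = std_normal_density x"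
      using s by (simp add: normal_density_def real_sqrt_mult power_mult_distrib)
    then have "complex_of_real (std_normal_density x) = of_real \<sigma> * of_real (normal_density 0 \<sigma> (0 + \<sigma> * x))"
      by (simp flip: of_real_mult)
    then show "\<bar>\<sigma>\<bar> *\<^sub>R (cis (t * (0 + \<sigma> * x)) * of_real (normal_density 0 \<sigma> (0 + \<sigma> * x))) =
        cis (t * \<sigma> * x) * of_real (std_normal_density x)"
      using s by (simp add: scaleR_conv_of_real mult_ac)
  qed
  also have "\<dots> = of_real (exp (- \<sigma>\<^sup>2 * t\<^sup>2 / 2))"
    unfolding std_normal_char by (simp add: power_mult_distrib mult.commute)
  finally show ?thesis .
qed

lemma centered_gaussian_nondegenerate:
  assumes "\<sigma> > 0" and d: "distributed M lborel Y (\<lambda>y. ennreal (normal_density 0 \<sigma> y))"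
  shows "L2_sq M Y = ennreal (\<sigma>\<^sup>2)"
    and "(\<integral>\<omega>. cis (t * Y \<omega>) \<partial>M) = of_real (exp (- \<sigma>\<^sup>2 * t\<^sup>2 / 2))"
    and "integrable M (\<lambda>\<omega>. exp (t * Y \<omega>))"
    and "(\<integral>\<omega>. exp (t * Y \<omega>) \<partial>M) = exp (t\<^sup>2 * \<sigma>\<^sup>2 / 2)"
proof -
  have [measurable]: "Y \<in> borel_measurable M" using distributed_measurable[OF d] by simp
  have "L2_sq M Y = (\<integral>\<^sup>+ y. ennreal (normal_density 0 \<sigma> y) * ennreal (y\<^sup>2) \<partial>lborel)"
    unfolding L2_sq_def using distributed_nn_integral[OF d, of "\<lambda>y. ennreal (y\<^sup>2)"] by simp
  also have "\<dots> = (\<integral>\<^sup>+ y. ennreal (normal_density 0 \<sigma> y * (y - 0) ^ (2 * 1)) \<partial>lborel)"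
    by (simp add: ennreal_mult)
  also have "\<dots> = ennreal (\<sigma>\<^sup>2)"
    using normal_moment_even[OF assms(1), of 0 1]
    by (subst nn_integral_eq_integral)
      (auto simp: has_bochner_integral_iff fact_numeral)
  finally show "L2_sq M Y = ennreal (\<sigma>\<^sup>2)" .
  have "(\<integral>\<omega>. cis (t * Y \<omega>) \<partial>M) = (\<integral>x. cis (t * x) \<partial>distr M lborel Y)"
    by (simp add: integral_distr)
  also have "\<dots> = (\<integral>x. cis (t * x) * of_real (normal_density 0 \<sigma> x) \<partial>lborel)"
    unfolding distributed_distr_eq_density[OF d]
    by (subst integral_density) (auto simp: scaleR_conv_of_real mult.commute)
  finally show "(\<integral>\<omega>. cis (t * Y \<omega>) \<partial>M) = of_real (exp (- \<sigma>\<^sup>2 * t\<^sup>2 / 2))"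
    unfolding normal_density_char[OF assms(1)] .
  \<comment> \<open>Completing the square: tilting the density by \<open>exp (t * y)\<close> moves
    its mean to \<open>t * \<sigma>\<^sup>2\<close> and leaves a constant, which is the moment
    generating function.\<close>
  have eq: "normal_density 0 \<sigma> y * exp (t * y) = exp (t\<^sup>2 * \<sigma>\<^sup>2 / 2) * normal_density (t * \<sigma>\<^sup>2) \<sigma> y" for y
  proof -
    have "- (y - 0)\<^sup>2 / (2 * \<sigma>\<^sup>2) + t * y = t\<^sup>2 * \<sigma>\<^sup>2 / 2 + - (y - t * \<sigma>\<^sup>2)\<^sup>2 / (2 * \<sigma>\<^sup>2)"
      using assms(1) by (simp add: field_simps power2_eq_square)
    then show ?thesis by (simp add: normal_density_def flip: exp_add)
  qed
  show "integrable M (\<lambda>\<omega>. exp (t * Y \<omega>))"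
    by (subst distributed_integrable[OF d, symmetric]) (auto simp: eq assms(1))
  show "(\<integral>\<omega>. exp (t * Y \<omega>) \<partial>M) = exp (t\<^sup>2 * \<sigma>\<^sup>2 / 2)"
    by (subst distributed_integral[OF d, symmetric]) (auto simp: eq assms(1))
qed

lemma L2_sq_eq_0_iff:
  assumes [measurable]: "f \<in> borel_measurable M"
  shows "L2_sq M f = 0 \<longleftrightarrow> (AE x in M. f x = 0)"
  unfolding L2_sq_def by (subst nn_integral_0_iff_AE) auto

text \<open>Written with the second moment instead of \<sigma>, the formula covers the degenerate
  law too, where the second moment is 0 and the characteristic function is constantly 1.\<close>

lemma centered_gaussian_char:
  assumes "prob_space M" "centered_gaussian M Y"
  shows "L2_sq M Y < \<infinity>"
    and "(\<integral>\<omega>. cis (t * Y \<omega>) \<partial>M) = of_real (exp (- enn2real (L2_sq M Y) * t\<^sup>2 / 2))"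
proof -
  interpret prob_space M by fact
  have [measurable]: "Y \<in> borel_measurable M" using assms(2) by (simp add: centered_gaussian_def)
  have "L2_sq M Y < \<infinity> \<and> (\<integral>\<omega>. cis (t * Y \<omega>) \<partial>M) = of_real (exp (- enn2real (L2_sq M Y) * t\<^sup>2 / 2))"
  proof (cases "AE \<omega> in M. Y \<omega> = 0")
    case True
    then have "L2_sq M Y = 0" by (simp add: L2_sq_eq_0_iff)
    moreover have "(\<integral>\<omega>. cis (t * Y \<omega>) \<partial>M) = (\<integral>\<omega>. 1 \<partial>M)"
      by (intro integral_cong_AE) (use True in auto)
    ultimately show ?thesis by (simp add: prob_space)
  next
    case False
    then obtain \<sigma> where "\<sigma> > 0" "distributed M lborel Y (\<lambda>y. ennreal (normal_density 0 \<sigma> y))"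
      using assms(2) by (auto simp: centered_gaussian_def)
    from centered_gaussian_nondegenerate[OF this] show ?thesis by simp
  qed
  then show "L2_sq M Y < \<infinity>"
    and "(\<integral>\<omega>. cis (t * Y \<omega>) \<partial>M) = of_real (exp (- enn2real (L2_sq M Y) * t\<^sup>2 / 2))" by auto
qed

text \<open>All later probability estimates pass through this formula, so a Gaussian variable enters
  them only by its second moment.\<close>

lemma centered_gaussian_exp:
  assumes "prob_space M" "centered_gaussian M Y"
  shows "integrable M (\<lambda>\<omega>. exp (t * Y \<omega>))"
    and "(\<integral>\<omega>. exp (t * Y \<omega>) \<partial>M) = exp (t\<^sup>2 * enn2real (L2_sq M Y) / 2)"
proof -
  interpret prob_space M by fact
  have [measurable]: "Y \<in> borel_measurable M" using assms(2) by (simp add: centered_gaussian_def)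
  have "integrable M (\<lambda>\<omega>. exp (t * Y \<omega>)) \<and> (\<integral>\<omega>. exp (t * Y \<omega>) \<partial>M) = exp (t\<^sup>2 * enn2real (L2_sq M Y) / 2)"
  proof (cases "AE \<omega> in M. Y \<omega> = 0")
    case True
    then have "L2_sq M Y = 0" by (simp add: L2_sq_eq_0_iff)
    moreover have "(\<integral>\<omega>. exp (t * Y \<omega>) \<partial>M) = (\<integral>\<omega>. 1 \<partial>M)"
      by (intro integral_cong_AE) (use True in auto)
    moreover have "integrable M (\<lambda>\<omega>. exp (t * Y \<omega>)) \<longleftrightarrow> integrable M (\<lambda>\<omega>. 1 :: real)"
      by (intro integrable_cong_AE) (use True in auto)
    ultimately show ?thesis by (simp add: prob_space)
  next
    case False
    then obtain \<sigma> where "\<sigma> > 0" "distributed M lborel Y (\<lambda>y. ennreal (normal_density 0 \<sigma> y))"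
      using assms(2) by (auto simp: centered_gaussian_def)
    from centered_gaussian_nondegenerate[OF this] show ?thesis by simp
  qed
  then show "integrable M (\<lambda>\<omega>. exp (t * Y \<omega>))"
    and "(\<integral>\<omega>. exp (t * Y \<omega>) \<partial>M) = exp (t\<^sup>2 * enn2real (L2_sq M Y) / 2)" by auto
qed

lemma norm_cis_diff_le: "norm (cis a - cis b) \<le> \<bar>a - b\<bar>"
proof -
  have "norm (cis a - cis b) = norm (cis b * (cis (a - b) - 1))"
    by (simp add: algebra_simps cis_mult)
  also have "\<dots> = norm (iexp (a - b) - 1)" by (simp add: norm_mult cis_conv_exp mult.commute)
  also have "\<dots> \<le> \<bar>a - b\<bar>" using iexp_approx1[of "a - b" 0] by simp
  finally show ?thesis .
qed

text \<open>The map \<open>cis\<close> is Lipschitz with constant 1, and on a probability space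
  Cauchy-Schwarz against the constant 1 bounds the first moment of \<open>Z n - Y\<close> by the
  second.\<close>

lemma char_tendsto_of_L2_sq_tendsto:
  fixes Y :: "'w \<Rightarrow> real"
  assumes "prob_space M" and [measurable]: "Y \<in> borel_measurable M" "\<And>n::nat. Z n \<in> borel_measurable M"
    and lim: "(\<lambda>n. L2_sq M (\<lambda>\<omega>. Z n \<omega> - Y \<omega>)) \<longlonglongrightarrow> 0"
  shows "(\<lambda>n. \<integral>\<omega>. cis (t * Z n \<omega>) \<partial>M) \<longlonglongrightarrow> (\<integral>\<omega>. cis (t * Y \<omega>) \<partial>M)"
proof -
  interpret prob_space M by fact
  let ?d = "\<lambda>n. norm ((\<integral>\<omega>. cis (t * Z n \<omega>) \<partial>M) - (\<integral>\<omega>. cis (t * Y \<omega>) \<partial>M))"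
  have le: "ennreal ((?d n)\<^sup>2) \<le> ennreal (t\<^sup>2) * L2_sq M (\<lambda>\<omega>. Z n \<omega> - Y \<omega>)" for n
  proof -
    have i: "integrable M (\<lambda>\<omega>. cis (t * U \<omega>))" if [measurable]: "U \<in> borel_measurable M" for U
      by (rule integrable_const_bound[where B=1]) auto
    have "(\<integral>\<omega>. cis (t * Z n \<omega>) \<partial>M) - (\<integral>\<omega>. cis (t * Y \<omega>) \<partial>M) =
        (\<integral>\<omega>. cis (t * Z n \<omega>) - cis (t * Y \<omega>) \<partial>M)"
      by (rule Bochner_Integration.integral_diff[symmetric]) (auto intro: i)
    then have "ennreal (?d n) \<le> (\<integral>\<^sup>+ \<omega>. ennreal (norm (cis (t * Z n \<omega>) - cis (t * Y \<omega>))) \<partial>M)"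
      by (simp only:) (intro integral_norm_bound_ennreal Bochner_Integration.integrable_diff i, auto)
    also have "\<dots> \<le> (\<integral>\<^sup>+ \<omega>. ennreal (norm (t *\<^sub>R (Z n \<omega> - Y \<omega>))) * 1 \<partial>M)"
    proof (intro nn_integral_mono)
      fix \<omega>
      show "ennreal (norm (cis (t * Z n \<omega>) - cis (t * Y \<omega>))) \<le> ennreal (norm (t *\<^sub>R (Z n \<omega> - Y \<omega>))) * 1"
        using norm_cis_diff_le[of "t * Z n \<omega>" "t * Y \<omega>"]
        by (simp add: right_diff_distrib ennreal_leI)
    qed
    finally have "(ennreal (?d n))\<^sup>2 \<le> (\<integral>\<^sup>+ \<omega>. ennreal (norm (t *\<^sub>R (Z n \<omega> - Y \<omega>))) * 1 \<partial>M)\<^sup>2"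
      by (rule power_mono) simp
    also have "\<dots> \<le> (\<integral>\<^sup>+ \<omega>. (ennreal (norm (t *\<^sub>R (Z n \<omega> - Y \<omega>))))\<^sup>2 \<partial>M) * (\<integral>\<^sup>+ \<omega>. 1\<^sup>2 \<partial>M)"
      by (rule Cauchy_Schwarz_nn_integral) auto
    also have "\<dots> = L2_sq M (\<lambda>\<omega>. t *\<^sub>R (Z n \<omega> - Y \<omega>))"
      by (simp add: L2_sq_def ennreal_power emeasure_space_1)
    also have "\<dots> = ennreal (t\<^sup>2) * L2_sq M (\<lambda>\<omega>. Z n \<omega> - Y \<omega>)" by (rule L2_sq_scaleR) simp
    finally show ?thesis by (simp add: ennreal_power)
  qed
  have "(\<lambda>n. ennreal (t\<^sup>2) * L2_sq M (\<lambda>\<omega>. Z n \<omega> - Y \<omega>)) \<longlonglongrightarrow> ennreal (t\<^sup>2) * 0"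
    by (intro tendsto_mult_ennreal tendsto_const lim) auto
  then have lim2: "(\<lambda>n. ennreal (t\<^sup>2) * L2_sq M (\<lambda>\<omega>. Z n \<omega> - Y \<omega>)) \<longlonglongrightarrow> 0" by simp
  have "(\<lambda>n. ennreal ((?d n)\<^sup>2)) \<longlonglongrightarrow> 0"
  proof (rule tendsto_sandwich)
    show "(\<lambda>_. 0 :: ennreal) \<longlonglongrightarrow> 0" by simp
    show "(\<lambda>n. ennreal (t\<^sup>2) * L2_sq M (\<lambda>\<omega>. Z n \<omega> - Y \<omega>)) \<longlonglongrightarrow> 0" by fact
  qed (use le in auto)
  then have "(\<lambda>n. (?d n)\<^sup>2) \<longlonglongrightarrow> 0" by (simp add: ennreal_tendsto_0_iff)
  then have "(\<lambda>n. sqrt ((?d n)\<^sup>2)) \<longlonglongrightarrow> sqrt 0" by (rule tendsto_real_sqrt)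
  then have "?d \<longlonglongrightarrow> 0" by simp
  then show ?thesis by (rule LIM_zero_cancel[OF tendsto_norm_zero_cancel])
qed

lemma L2_sq_finite_of_diff:
  fixes Y :: "'w \<Rightarrow> 'b::{real_normed_vector, second_countable_topology}"
  assumes [measurable]: "Y \<in> borel_measurable M" "\<And>n::nat. Z n \<in> borel_measurable M"
    and fin: "\<And>n. L2_sq M (Z n) < \<infinity>" and lim: "(\<lambda>n. L2_sq M (\<lambda>\<omega>. Z n \<omega> - Y \<omega>)) \<longlonglongrightarrow> 0"
  shows "L2_sq M Y < \<infinity>"
proof -
  have "eventually (\<lambda>n. L2_sq M (\<lambda>\<omega>. Z n \<omega> - Y \<omega>) < 1) sequentially"
    using lim by (rule order_tendstoD) simp
  then obtain n where n: "L2_sq M (\<lambda>\<omega>. Z n \<omega> - Y \<omega>) < 1" by (auto simp: eventually_sequentially)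
  have "L2_sq M Y \<le> 2 * L2_sq M (Z n) + 2 * L2_sq M (\<lambda>\<omega>. Y \<omega> - Z n \<omega>)"
    using L2_sq_add_le2[of "Z n" M "\<lambda>\<omega>. Y \<omega> - Z n \<omega>"] by simp
  also have "\<dots> < \<infinity>"
    using fin[of n] less_trans[OF n ennreal_one_less_top]
    by (simp add: L2_sq_minus_commute[of M Y] ennreal_mult_less_top ennreal_add_less_top)
  finally show ?thesis .
qed

text \<open>The variances converge, so the characteristic functions tend to the Gaussian one with
  the limiting variance, and the characteristic function determines the law. Limiting variance 0 is
  treated apart, having no density.\<close>

lemma centered_gaussian_limit:
  assumes "prob_space M" and Y[measurable]: "Y \<in> borel_measurable M"
    and Z: "\<And>n::nat. centered_gaussian M (Z n)"
    and lim: "(\<lambda>n. L2_sq M (\<lambda>\<omega>. Z n \<omega> - Y \<omega>)) \<longlonglongrightarrow> 0"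
  shows "centered_gaussian M Y" and "(\<lambda>n. L2_sq M (Z n)) \<longlonglongrightarrow> L2_sq M Y"
proof -
  interpret prob_space M by fact
  have Zm[measurable]: "Z n \<in> borel_measurable M" for n using Z by (simp add: centered_gaussian_def)
  have fin: "L2_sq M Y < \<infinity>"
    by (rule L2_sq_finite_of_diff[of _ _ Z]) (use lim centered_gaussian_char(1)[OF assms(1) Z] in auto)
  show slim: "(\<lambda>n. L2_sq M (Z n)) \<longlonglongrightarrow> L2_sq M Y"
    by (rule L2_sq_tendsto) (use fin lim in auto)
  define v where "v = enn2real (L2_sq M Y)"
  have vlim: "(\<lambda>n. enn2real (L2_sq M (Z n))) \<longlonglongrightarrow> v"
    by (rule tendsto_enn2real) (use slim fin in \<open>auto simp: v_def\<close>)
  show "centered_gaussian M Y"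
  proof (cases "v = 0")
    case True
    then have "L2_sq M Y = 0" using fin by (auto simp: v_def enn2real_eq_0_iff)
    then show ?thesis by (simp add: centered_gaussian_def L2_sq_eq_0_iff)
  next
    case False
    then have v: "v > 0" by (simp add: v_def less_le)
    define \<sigma> where "\<sigma> = sqrt v"
    have s: "\<sigma> > 0" "\<sigma>\<^sup>2 = v" using v by (auto simp: \<sigma>_def)
    define N where "N = density lborel (\<lambda>y. ennreal (normal_density 0 \<sigma> y))"
    have "real_distribution N"
      unfolding N_def real_distribution_def real_distribution_axioms_def
      using prob_space_normal_density[OF s(1)] by simp
    moreover have "real_distribution (distr M borel Y)" by (rule real_distribution_distr) simp
    moreover have "char (distr M borel Y) = char N"
    proof (rule ext)
      fix t
      have "(\<lambda>n. \<integral>\<omega>. cis (t * Z n \<omega>) \<partial>M) \<longlonglongrightarrow> (\<integral>\<omega>. cis (t * Y \<omega>) \<partial>M)"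
        by (rule char_tendsto_of_L2_sq_tendsto) (use assms in auto)
      moreover have "(\<lambda>n. \<integral>\<omega>. cis (t * Z n \<omega>) \<partial>M) \<longlonglongrightarrow> of_real (exp (- v * t\<^sup>2 / 2))"
        unfolding centered_gaussian_char(2)[OF assms(1) Z] by (intro tendsto_intros vlim) auto
      ultimately have "(\<integral>\<omega>. cis (t * Y \<omega>) \<partial>M) = of_real (exp (- v * t\<^sup>2 / 2))"
        by (rule LIMSEQ_unique)
      moreover have "char (distr M borel Y) t = (\<integral>\<omega>. cis (t * Y \<omega>) \<partial>M)"
        unfolding char_def by (subst integral_distr) (auto simp: cis_conv_exp)
      moreover have "char N t = (\<integral>x. cis (t * x) * of_real (normal_density 0 \<sigma> x) \<partial>lborel)"
        unfolding char_def N_def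
        by (subst integral_density) (auto simp: cis_conv_exp scaleR_conv_of_real mult.commute)
      ultimately show "char (distr M borel Y) t = char N t"
        using normal_density_char[OF s(1), of t] s(2) by simp
    qed
    ultimately have eq: "distr M borel Y = N" by (intro Levy_uniqueness)
    \<comment> \<open>\<open>distributed\<close> refers to \<open>lborel\<close>, the uniqueness of
      laws to \<open>borel\<close>. Both have the same measurable sets, hence the same image
      measure.\<close>
    have "distr M lborel Y = distr M borel Y" by (rule distr_cong) auto
    with eq have "distributed M lborel Y (\<lambda>y. ennreal (normal_density 0 \<sigma> y))"
      unfolding distributed_def N_def by simp
    then show ?thesis using s by (auto simp: centered_gaussian_def)
  qed
qed

section \<open>Wiener integrals: isometry and linearity\<close>

lemma brownian_measure_gaussian:
  assumes "brownian_measure M W" "finite S" "S \<subseteq> finite_area_sets"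
  shows "centered_gaussian M (\<lambda>\<omega>. \<Sum>A\<in>S. c A * W A \<omega>)"
  using assms by (simp add: brownian_measure_def)

lemma real_L2_mult_integrable:
  fixes f g :: "'a \<Rightarrow> real"
  assumes [measurable]: "f \<in> borel_measurable M" "g \<in> borel_measurable M"
    and f: "L2_sq M f < \<infinity>" and g: "L2_sq M g < \<infinity>"
  shows "integrable M (\<lambda>x. f x * g x)"
proof -
  have "integrable M (\<lambda>x. complex_of_real (f x) * complex_of_real (g x))"
    by (rule L2_mult_integrable) (use f g in \<open>auto simp: L2_sq_def\<close>)
  then have "integrable M (\<lambda>x. complex_of_real (f x * g x))" by simp
  then show ?thesis unfolding complex_of_real_integrable_eq .
qed

text \<open>The squared norm of a combination depends on the family only through its Gram matrix.
  This lets random variables and functions on the plane be compared.\<close>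

lemma L2_sq_sum_eq:
  fixes F :: "'i \<Rightarrow> 'a \<Rightarrow> real"
  assumes "finite S" and [measurable]: "\<And>i. i \<in> S \<Longrightarrow> F i \<in> borel_measurable M"
    and fin: "\<And>i. i \<in> S \<Longrightarrow> L2_sq M (F i) < \<infinity>"
  shows "L2_sq M (\<lambda>x. \<Sum>i\<in>S. c i * F i x) = ennreal (\<Sum>i\<in>S. \<Sum>j\<in>S. c i * c j * (\<integral>x. F i x * F j x \<partial>M))"
proof -
  have i: "integrable M (\<lambda>x. F i x * F j x)" if "i \<in> S" "j \<in> S" for i j
    using that by (intro real_L2_mult_integrable fin) auto
  have eq: "(\<Sum>i\<in>S. c i * F i x)\<^sup>2 = (\<Sum>i\<in>S. \<Sum>j\<in>S. c i * c j * (F i x * F j x))" for x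
    unfolding power2_eq_square sum_product by (simp add: mult_ac)
  have "L2_sq M (\<lambda>x. \<Sum>i\<in>S. c i * F i x) = (\<integral>\<^sup>+ x. ennreal ((\<Sum>i\<in>S. c i * F i x)\<^sup>2) \<partial>M)"
    by (simp add: L2_sq_def)
  also have "\<dots> = ennreal (\<integral>x. (\<Sum>i\<in>S. c i * F i x)\<^sup>2 \<partial>M)"
  proof (rule nn_integral_eq_integral)
    show "integrable M (\<lambda>x. (\<Sum>i\<in>S. c i * F i x)\<^sup>2)"
      unfolding eq by (intro Bochner_Integration.integrable_sum integrable_mult_right i)
  qed simp
  also have "(\<integral>x. (\<Sum>i\<in>S. c i * F i x)\<^sup>2 \<partial>M) = (\<Sum>i\<in>S. \<Sum>j\<in>S. c i * c j * (\<integral>x. F i x * F j x \<partial>M))"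
    unfolding eq by (simp add: Bochner_Integration.integral_sum Bochner_Integration.integrable_sum i)
  finally show ?thesis .
qed

text \<open>The covariance of \<open>W A\<close> and \<open>W A'\<close> is the inner product of the
  two indicators, so the two Gram matrices coincide. The sets in \<open>S\<close> may
  overlap.\<close>

lemma brownian_measure_isometry:
  assumes "prob_space M" and B: "brownian_measure M W" and S: "finite S" "S \<subseteq> finite_area_sets"
  shows "L2_sq M (\<lambda>\<omega>. \<Sum>A\<in>S. c A * W A \<omega>) = L2_sq lborel (\<lambda>x. \<Sum>A\<in>S. c A * indicator A x)"
proof -
  have W: "centered_gaussian M (W A)" if "A \<in> finite_area_sets" for A
    using brownian_measure_gaussian[OF B, of "{A}" "\<lambda>_. 1"] that by simp
  have A: "A \<in> sets borel" "emeasure lborel A < \<infinity>" if "A \<in> S" for A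
    using S that by (auto simp: finite_area_sets_def)
  have fin: "L2_sq lborel (indicator A :: _ \<Rightarrow> real) < \<infinity>" if "A \<in> S" for A
  proof -
    have "L2_sq lborel (indicator A :: _ \<Rightarrow> real) = (\<integral>\<^sup>+ x. indicator A x \<partial>lborel)"
      unfolding L2_sq_def by (intro nn_integral_cong) (auto simp: indicator_def)
    then show ?thesis using A[OF that] by simp
  qed
  have cov: "(\<integral>\<omega>. W A \<omega> * W A' \<omega> \<partial>M) = (\<integral>x. indicator A x * indicator A' x \<partial>lborel)"
    if "A \<in> S" "A' \<in> S" for A A'
  proof -
    have "(\<integral>x. indicator A x * indicator A' x \<partial>lborel) = measure lborel (A \<inter> A')"
      using A[OF that(1)] A[OF that(2)] by (simp flip: indicator_inter_arith)
    moreover have "A \<in> finite_area_sets" "A' \<in> finite_area_sets" using that S by auto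
    ultimately show ?thesis using B unfolding brownian_measure_def by simp
  qed
  have "L2_sq M (\<lambda>\<omega>. \<Sum>A\<in>S. c A * W A \<omega>) = ennreal (\<Sum>A\<in>S. \<Sum>A'\<in>S. c A * c A' * (\<integral>\<omega>. W A \<omega> * W A' \<omega> \<partial>M))"
    using S W centered_gaussian_char(1)[OF assms(1) W]
    by (intro L2_sq_sum_eq) (auto simp: centered_gaussian_def)
  also have "\<dots> = ennreal (\<Sum>A\<in>S. \<Sum>A'\<in>S. c A * c A' * (\<integral>x. indicator A x * indicator A' x \<partial>lborel))"
    by (intro arg_cong[where f=ennreal] sum.cong refl) (simp add: cov)
  also have "\<dots> = L2_sq lborel (\<lambda>x. \<Sum>A\<in>S. c A * indicator A x)"
    using S A fin by (intro L2_sq_sum_eq[symmetric]) auto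
  finally show ?thesis .
qed

lemma has_wiener_integral_iff:
  "has_wiener_integral M W f Y \<longleftrightarrow>
     square_integrable f \<and> Y \<in> borel_measurable M \<and>
     (\<exists>S c. (\<forall>n::nat. finite (S n) \<and> S n \<subseteq> finite_area_sets) \<and>
        (\<lambda>n. L2_sq lborel (\<lambda>x. (\<Sum>A\<in>S n. c n A * indicator A x) - f x)) \<longlonglongrightarrow> 0 \<and>
        (\<lambda>n. L2_sq M (\<lambda>\<omega>. (\<Sum>A\<in>S n. c n A * W A \<omega>) - Y \<omega>)) \<longlonglongrightarrow> 0)"
  by (simp add: has_wiener_integral_def L2_sq_def)

lemma simple_measurable:
  assumes "S \<subseteq> finite_area_sets"
  shows "(\<lambda>x. \<Sum>A\<in>S. c A * indicator A x :: real) \<in> borel_measurable borel"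
  using assms by (intro borel_measurable_sum borel_measurable_times borel_measurable_indicator)
    (auto simp: finite_area_sets_def)

text \<open>The same simple approximants converge on both sides, and for them the isometry is exact;
  it passes to the limit together with normality.\<close>

lemma has_wiener_integral_gaussian:
  assumes "prob_space M" "brownian_measure M W" "has_wiener_integral M W f Y"
  shows "centered_gaussian M Y" and "L2_sq M Y = L2_sq lborel f"
proof -
  obtain S c where f: "square_integrable f" and Y: "Y \<in> borel_measurable M"
    and S: "\<And>n::nat. finite (S n)" "\<And>n. S n \<subseteq> finite_area_sets"
    and lim: "(\<lambda>n. L2_sq lborel (\<lambda>x. (\<Sum>A\<in>S n. c n A * indicator A x) - f x)) \<longlonglongrightarrow> 0"
      "(\<lambda>n. L2_sq M (\<lambda>\<omega>. (\<Sum>A\<in>S n. c n A * W A \<omega>) - Y \<omega>)) \<longlonglongrightarrow> 0"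
    using assms(3) unfolding has_wiener_integral_iff by blast
  have G: "centered_gaussian M (\<lambda>\<omega>. \<Sum>A\<in>S n. c n A * W A \<omega>)" for n
    by (rule brownian_measure_gaussian) (use assms S in auto)
  note 1 = centered_gaussian_limit[OF assms(1) Y G lim(2)]
  show "centered_gaussian M Y" by (rule 1)
  have "(\<lambda>n. L2_sq lborel (\<lambda>x. \<Sum>A\<in>S n. c n A * indicator A x)) \<longlonglongrightarrow> L2_sq lborel f"
    by (rule L2_sq_tendsto) (use f lim(1) simple_measurable[OF S(2)] in \<open>auto simp: square_integrable_iff_L2_sq\<close>)
  with 1(2) show "L2_sq M Y = L2_sq lborel f"
    unfolding brownian_measure_isometry[OF assms(1,2) S] by (rule LIMSEQ_unique)
qed

text \<open>Simple functions are encoded as sums over finite sets of regions. To add two of them,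
  the index sets are united and a region occurring in both receives the sum of its
  coefficients.\<close>

lemma sum_union_restrict:
  fixes F :: "'i \<Rightarrow> real"
  assumes "finite S" "finite S'"
  shows "(\<Sum>A\<in>S \<union> S'. ((if A \<in> S then c A else 0) + (if A \<in> S' then c' A else 0)) * F A) =
    (\<Sum>A\<in>S. c A * F A) + (\<Sum>A\<in>S'. c' A * F A)"
proof -
  have "(\<Sum>A\<in>S \<union> S'. (if A \<in> S then c A else 0) * F A) = (\<Sum>A\<in>S. c A * F A)"
    by (rule sum.mono_neutral_cong_right) (use assms in auto)
  moreover have "(\<Sum>A\<in>S \<union> S'. (if A \<in> S' then c' A else 0) * F A) = (\<Sum>A\<in>S'. c' A * F A)"
    by (rule sum.mono_neutral_cong_right) (use assms in auto)
  ultimately show ?thesis by (simp add: distrib_right sum.distrib)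
qed

lemma has_wiener_integral_add:
  assumes B: "brownian_measure M W" and "has_wiener_integral M W f Y" "has_wiener_integral M W f' Y'"
  shows "has_wiener_integral M W (\<lambda>x. f x + f' x) (\<lambda>\<omega>. Y \<omega> + Y' \<omega>)"
proof -
  obtain S c where f: "square_integrable f" and Y: "Y \<in> borel_measurable M"
    and S: "\<And>n::nat. finite (S n)" "\<And>n. S n \<subseteq> finite_area_sets"
    and lim: "(\<lambda>n. L2_sq lborel (\<lambda>x. (\<Sum>A\<in>S n. c n A * indicator A x) - f x)) \<longlonglongrightarrow> 0"
      "(\<lambda>n. L2_sq M (\<lambda>\<omega>. (\<Sum>A\<in>S n. c n A * W A \<omega>) - Y \<omega>)) \<longlonglongrightarrow> 0"
    using assms(2) unfolding has_wiener_integral_iff by blast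
  obtain S' c' where f': "square_integrable f'" and Y': "Y' \<in> borel_measurable M"
    and S': "\<And>n::nat. finite (S' n)" "\<And>n. S' n \<subseteq> finite_area_sets"
    and lim': "(\<lambda>n. L2_sq lborel (\<lambda>x. (\<Sum>A\<in>S' n. c' n A * indicator A x) - f' x)) \<longlonglongrightarrow> 0"
      "(\<lambda>n. L2_sq M (\<lambda>\<omega>. (\<Sum>A\<in>S' n. c' n A * W A \<omega>) - Y' \<omega>)) \<longlonglongrightarrow> 0"
    using assms(3) unfolding has_wiener_integral_iff by blast
  have [measurable]: "Y \<in> borel_measurable M" "Y' \<in> borel_measurable M" by fact+
  have fm[measurable]: "f \<in> borel_measurable borel" "f' \<in> borel_measurable borel"
    using f f' by (auto simp: square_integrable_iff_L2_sq)
  have [measurable]: "(\<lambda>\<omega>. \<Sum>A\<in>S n. c n A * W A \<omega>) \<in> borel_measurable M"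
    "(\<lambda>\<omega>. \<Sum>A\<in>S' n. c' n A * W A \<omega>) \<in> borel_measurable M" for n
    using brownian_measure_gaussian[OF B S] brownian_measure_gaussian[OF B S']
    by (auto simp: centered_gaussian_def)
  have [measurable]: "(\<lambda>x. \<Sum>A\<in>S n. c n A * indicator A x) \<in> borel_measurable borel"
    "(\<lambda>x. \<Sum>A\<in>S' n. c' n A * indicator A x) \<in> borel_measurable borel" for n
    by (intro simple_measurable S S')+
  define T where "T n = S n \<union> S' n" for n
  define d where "d n A = (if A \<in> S n then c n A else 0) + (if A \<in> S' n then c' n A else 0)" for n A
  have "(\<lambda>n. L2_sq lborel (\<lambda>x. ((\<Sum>A\<in>S n. c n A * indicator A x) - f x) + ((\<Sum>A\<in>S' n. c' n A * indicator A x) - f' x))) \<longlonglongrightarrow> 0"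
    by (rule L2_sq_add_tendsto_0[OF _ _ lim(1) lim'(1)]) auto
  then have 1: "(\<lambda>n. L2_sq lborel (\<lambda>x. (\<Sum>A\<in>T n. d n A * indicator A x) - (f x + f' x))) \<longlonglongrightarrow> 0"
    unfolding T_def d_def sum_union_restrict[OF S(1) S'(1)] by (simp add: algebra_simps)
  have "(\<lambda>n. L2_sq M (\<lambda>\<omega>. ((\<Sum>A\<in>S n. c n A * W A \<omega>) - Y \<omega>) + ((\<Sum>A\<in>S' n. c' n A * W A \<omega>) - Y' \<omega>))) \<longlonglongrightarrow> 0"
    by (rule L2_sq_add_tendsto_0[OF _ _ lim(2) lim'(2)]) auto
  then have 2: "(\<lambda>n. L2_sq M (\<lambda>\<omega>. (\<Sum>A\<in>T n. d n A * W A \<omega>) - (Y \<omega> + Y' \<omega>))) \<longlonglongrightarrow> 0"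
    unfolding T_def d_def sum_union_restrict[OF S(1) S'(1)] by (simp add: algebra_simps)
  have "finite (T n) \<and> T n \<subseteq> finite_area_sets" for n using S S' by (auto simp: T_def)
  with 1 2 show ?thesis unfolding has_wiener_integral_iff
    by (intro conjI square_integrable_add f f') (auto intro!: exI[of _ T] exI[of _ d])
qed

lemma has_wiener_integral_scale:
  assumes B: "brownian_measure M W" and "has_wiener_integral M W f Y"
  shows "has_wiener_integral M W (\<lambda>x. a * f x) (\<lambda>\<omega>. a * Y \<omega>)"
proof -
  obtain S c where f: "square_integrable f" and Y: "Y \<in> borel_measurable M"
    and S: "\<And>n::nat. finite (S n)" "\<And>n. S n \<subseteq> finite_area_sets"
    and lim: "(\<lambda>n. L2_sq lborel (\<lambda>x. (\<Sum>A\<in>S n. c n A * indicator A x) - f x)) \<longlonglongrightarrow> 0"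
      "(\<lambda>n. L2_sq M (\<lambda>\<omega>. (\<Sum>A\<in>S n. c n A * W A \<omega>) - Y \<omega>)) \<longlonglongrightarrow> 0"
    using assms(2) unfolding has_wiener_integral_iff by blast
  have [measurable]: "Y \<in> borel_measurable M" by fact
  have fm[measurable]: "f \<in> borel_measurable borel"
    using f by (auto simp: square_integrable_iff_L2_sq)
  have [measurable]: "(\<lambda>\<omega>. \<Sum>A\<in>S n. c n A * W A \<omega>) \<in> borel_measurable M" for n
    using brownian_measure_gaussian[OF B S] by (auto simp: centered_gaussian_def)
  have [measurable]: "(\<lambda>x. \<Sum>A\<in>S n. c n A * indicator A x) \<in> borel_measurable borel" for n
    by (intro simple_measurable S)
  define d where "d n A = a * c n A" for n A
  have "(\<lambda>n. L2_sq lborel (\<lambda>x. a *\<^sub>R ((\<Sum>A\<in>S n. c n A * indicator A x) - f x))) \<longlonglongrightarrow> 0"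
    by (rule L2_sq_scaleR_tendsto_0[OF _ lim(1)]) auto
  then have 1: "(\<lambda>n. L2_sq lborel (\<lambda>x. (\<Sum>A\<in>S n. d n A * indicator A x) - a * f x)) \<longlonglongrightarrow> 0"
    by (simp add: d_def sum_distrib_left mult.assoc right_diff_distrib)
  have "(\<lambda>n. L2_sq M (\<lambda>\<omega>. a *\<^sub>R ((\<Sum>A\<in>S n. c n A * W A \<omega>) - Y \<omega>))) \<longlonglongrightarrow> 0"
    by (rule L2_sq_scaleR_tendsto_0[OF _ lim(2)]) auto
  then have 2: "(\<lambda>n. L2_sq M (\<lambda>\<omega>. (\<Sum>A\<in>S n. d n A * W A \<omega>) - a * Y \<omega>)) \<longlonglongrightarrow> 0"
    by (simp add: d_def sum_distrib_left mult.assoc right_diff_distrib)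
  have "square_integrable (\<lambda>x. a * f x)" using square_integrable_scaleR[OF f, of a] by simp
  with 1 2 S show ?thesis unfolding has_wiener_integral_iff
    by (intro conjI) (auto intro!: exI[of _ S] exI[of _ d])
qed

section \<open>Real spectral integrals\<close>

definition spectral_integral ::
    "'w measure \<Rightarrow> ((real \<times> real) set \<Rightarrow> 'w \<Rightarrow> real) \<Rightarrow> (real \<times> real \<Rightarrow> complex) \<Rightarrow> ('w \<Rightarrow> real) \<Rightarrow> bool" where
  "spectral_integral M W f Y \<longleftrightarrow> has_fourier_wiener_integral M W f (\<lambda>\<omega>. complex_of_real (Y \<omega>))"

text \<open>Because \<open>Y\<close> is real, the imaginary part of the inverse transform
  \<open>g\<close> has Wiener integral 0, and the isometry forces its norm to be 0. The real part
  therefore carries the whole norm of \<open>g\<close>, which Plancherel turns into that of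
  \<open>f\<close>.\<close>

lemma spectral_integral_gaussian:
  assumes M: "prob_space M" and B: "brownian_measure M W" and "spectral_integral M W f Y"
  shows "centered_gaussian M Y" and "L2_sq M Y = L2_sq lborel f"
proof -
  obtain g where g: "has_fourier_transform g f"
    and w: "has_wiener_integral M W (\<lambda>x. Re (g x)) Y" "has_wiener_integral M W (\<lambda>x. Im (g x)) (\<lambda>\<omega>. 0)"
    using assms(3)
    by (auto simp: spectral_integral_def has_fourier_wiener_integral_def has_complex_wiener_integral_def)
  show "centered_gaussian M Y" by (rule has_wiener_integral_gaussian[OF M B w(1)])
  have gm[measurable]: "g \<in> borel_measurable borel"
    using g by (auto simp: has_fourier_transform_iff square_integrable_iff_L2_sq)
  have "L2_sq M Y = L2_sq lborel (\<lambda>x. Re (g x)) + L2_sq lborel (\<lambda>x. Im (g x))"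
    using has_wiener_integral_gaussian(2)[OF M B w(1)] has_wiener_integral_gaussian(2)[OF M B w(2)]
    by (simp add: L2_sq_def)
  also have "\<dots> = L2_sq lborel g"
    unfolding L2_sq_def by (subst nn_integral_add[symmetric]) (auto simp: cmod_power2)
  also have "\<dots> = L2_sq lborel f" by (rule plancherel[OF g])
  finally show "L2_sq M Y = L2_sq lborel f" .
qed

lemma spectral_integral_add:
  assumes B: "brownian_measure M W" and "spectral_integral M W f Y" "spectral_integral M W f' Y'"
  shows "spectral_integral M W (\<lambda>\<xi>. f \<xi> + f' \<xi>) (\<lambda>\<omega>. Y \<omega> + Y' \<omega>)"
proof -
  obtain g where g: "has_fourier_transform g f"
    and w: "has_wiener_integral M W (\<lambda>x. Re (g x)) Y" "has_wiener_integral M W (\<lambda>x. Im (g x)) (\<lambda>\<omega>. 0)"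
    using assms(2)
    by (auto simp: spectral_integral_def has_fourier_wiener_integral_def has_complex_wiener_integral_def)
  obtain g' where g': "has_fourier_transform g' f'"
    and w': "has_wiener_integral M W (\<lambda>x. Re (g' x)) Y'" "has_wiener_integral M W (\<lambda>x. Im (g' x)) (\<lambda>\<omega>. 0)"
    using assms(3)
    by (auto simp: spectral_integral_def has_fourier_wiener_integral_def has_complex_wiener_integral_def)
  show ?thesis
    unfolding spectral_integral_def has_fourier_wiener_integral_def has_complex_wiener_integral_def
    using has_fourier_transform_add[OF g g'] has_wiener_integral_add[OF B w(1) w'(1)]
      has_wiener_integral_add[OF B w(2) w'(2)]
    by (intro exI[of _ "\<lambda>x. g x + g' x"]) simp
qed

lemma spectral_integral_scale:
  assumes B: "brownian_measure M W" and "spectral_integral M W f Y"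
  shows "spectral_integral M W (\<lambda>\<xi>. of_real a * f \<xi>) (\<lambda>\<omega>. a * Y \<omega>)"
proof -
  obtain g where g: "has_fourier_transform g f"
    and w: "has_wiener_integral M W (\<lambda>x. Re (g x)) Y" "has_wiener_integral M W (\<lambda>x. Im (g x)) (\<lambda>\<omega>. 0)"
    using assms(2)
    by (auto simp: spectral_integral_def has_fourier_wiener_integral_def has_complex_wiener_integral_def)
  show ?thesis
    unfolding spectral_integral_def has_fourier_wiener_integral_def has_complex_wiener_integral_def
    using has_fourier_transform_scaleR[OF g, of a] has_wiener_integral_scale[OF B w(1), of a]
      has_wiener_integral_scale[OF B w(2), of a]
    by (intro exI[of _ "\<lambda>x. a *\<^sub>R g x"]) (simp add: scaleR_conv_of_real)
qed

subsection \<open>Spectral weights of square increments\<close>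

text \<open>The prefactor \<open>h\<close> is the square root of the planar Jacobian
  \<open>h\<^sup>2\<close>, so this dilation preserves the \<open>L\<^sup>2\<close> norm.\<close>

definition scaled_weight :: "(real \<times> real \<Rightarrow> real) \<Rightarrow> real \<Rightarrow> real \<times> real \<Rightarrow> real" where
  "scaled_weight p h \<xi> = h * p (h *\<^sub>R \<xi>)"

text \<open>The set \<open>B\<close> localises the mass: the part of the scaled weight at the
  frequencies \<xi> with \<open>h *\<^sub>R \<xi> \<in> B\<close> does not depend on
  \<open>h\<close>. Bounds on the tails of \<open>p\<close> thus hold uniformly over all
  scales.\<close>

lemma nn_integral_scaled_weight:
  fixes p :: "real \<times> real \<Rightarrow> real" and B :: "(real \<times> real) set"
  assumes [measurable]: "p \<in> borel_measurable borel" "B \<in> sets borel" and h: "h > 0"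
  shows "(\<integral>\<^sup>+ \<xi>. ennreal ((scaled_weight p h \<xi>)\<^sup>2) * indicator B (h *\<^sub>R \<xi>) \<partial>lborel) =
    (\<integral>\<^sup>+ u. ennreal ((p u)\<^sup>2) * indicator B u \<partial>lborel)"
proof -
  have "(\<integral>\<^sup>+ u. ennreal ((p u)\<^sup>2) * indicator B u \<partial>lborel) =
      ennreal (\<bar>h\<bar> ^ DIM(real \<times> real)) * (\<integral>\<^sup>+ \<xi>. ennreal ((p (0 + h *\<^sub>R \<xi>))\<^sup>2) * indicator B (0 + h *\<^sub>R \<xi>) \<partial>lborel)"
    by (rule nn_integral_lborel_affine) (use h in auto)
  also have "\<dots> = (\<integral>\<^sup>+ \<xi>. ennreal (h\<^sup>2) * (ennreal ((p (h *\<^sub>R \<xi>))\<^sup>2) * indicator B (h *\<^sub>R \<xi>)) \<partial>lborel)"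
    by (simp add: nn_integral_cmult power2_eq_square)
  also have "\<dots> = (\<integral>\<^sup>+ \<xi>. ennreal ((scaled_weight p h \<xi>)\<^sup>2) * indicator B (h *\<^sub>R \<xi>) \<partial>lborel)"
    by (simp add: scaled_weight_def power_mult_distrib ennreal_mult mult.assoc)
  finally show ?thesis ..
qed

lemma scaled_weight_measurable [measurable]:
  assumes [measurable]: "p \<in> borel_measurable borel"
  shows "scaled_weight p h \<in> borel_measurable borel"
  unfolding scaled_weight_def by measurable

lemma L2_sq_scaled_weight:
  fixes p :: "real \<times> real \<Rightarrow> real"
  assumes "p \<in> borel_measurable borel" "h > 0"
  shows "L2_sq lborel (scaled_weight p h) = L2_sq lborel p"
  using nn_integral_scaled_weight[OF assms(1) _ assms(2), of UNIV] by (simp add: L2_sq_def)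

text \<open>Points have to leave the sets \<open>B n\<close> only where \<open>p\<close> is nonzero.
  This admits shrinking balls around 0, which always contain 0 itself.\<close>

lemma L2_sq_tail_tendsto_0:
  fixes p :: "'a::euclidean_space \<Rightarrow> real"
  assumes [measurable]: "p \<in> borel_measurable borel" and fin: "L2_sq lborel p < \<infinity>"
    and [measurable]: "\<And>n::nat. B n \<in> sets borel"
    and B: "\<And>x. p x \<noteq> 0 \<Longrightarrow> eventually (\<lambda>n. x \<notin> B n) sequentially"
  shows "(\<lambda>n. \<integral>\<^sup>+ u. ennreal ((p u)\<^sup>2) * indicator (B n) u \<partial>lborel) \<longlonglongrightarrow> 0"
proof -
  have "(\<lambda>n. \<integral>\<^sup>+ u. ennreal ((p u)\<^sup>2) * indicator (B n) u \<partial>lborel) \<longlonglongrightarrow> (\<integral>\<^sup>+ u. 0 \<partial>(lborel :: 'a measure))"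
  proof (rule nn_integral_dominated_convergence[where w="\<lambda>x. ennreal ((p x)\<^sup>2)"])
    show "AE x in lborel. ennreal ((p x)\<^sup>2) * indicator (B j) x \<le> ennreal ((p x)\<^sup>2)" for j
      by (intro AE_I2) (auto simp: indicator_def)
    show "AE x in lborel. (\<lambda>i. ennreal ((p x)\<^sup>2) * indicator (B i) x) \<longlonglongrightarrow> 0"
    proof (intro AE_I2 tendsto_eventually)
      fix x
      show "eventually (\<lambda>i. ennreal ((p x)\<^sup>2) * indicator (B i) x = 0) sequentially"
      proof (cases "p x = 0")
        case False
        from B[OF this] show ?thesis by eventually_elim simp
      qed simp
    qed
    show "(\<integral>\<^sup>+ x. ennreal ((p x)\<^sup>2) \<partial>lborel) < \<infinity>" using fin by (simp add: L2_sq_def)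
  qed auto
  then show ?thesis by simp
qed

text \<open>The small weight \<open>d\<close> goes to the factor with its full mass, the large
  weight \<open>1 / (4 * d)\<close> to the factor whose mass is small in the region at hand.\<close>

lemma mult_le_weighted_squares:
  fixes a b d :: real
  assumes "d > 0"
  shows "a * b \<le> d * a\<^sup>2 + (1 / (4 * d)) * b\<^sup>2"
proof -
  have "0 \<le> (2 * d * a - b)\<^sup>2 / (4 * d)" using assms by simp
  also have "\<dots> = d * a\<^sup>2 + (1 / (4 * d)) * b\<^sup>2 - a * b"
    using assms by (simp add: power2_eq_square field_simps)
  finally show ?thesis by simp
qed

text \<open>The mass of \<^term>\<open>scaled_weight p h\<close> sits at frequencies of order \<open>1 / h\<close>, so weights of very
  different scales are almost orthogonal.\<close>

lemma scaled_weight_decorrelation: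
  fixes p :: "real \<times> real \<Rightarrow> real"
  assumes pm[measurable]: "p \<in> borel_measurable borel" and p0: "p 0 = 0"
    and fin: "L2_sq lborel p < \<infinity>" and eps: "\<epsilon> > 0"
  obtains c where "0 < c" "c < 1"
    "\<And>h k. 0 < h \<Longrightarrow> h \<le> c * k \<Longrightarrow>
      (\<integral>\<^sup>+ \<xi>. ennreal (scaled_weight p h \<xi> * scaled_weight p k \<xi>) \<partial>lborel) \<le> ennreal \<epsilon>"
proof -
  obtain Q where Q: "L2_sq lborel p = ennreal Q" "0 \<le> Q" using fin by (cases "L2_sq lborel p") auto
  \<comment> \<open>The full masses contribute \<open>2 * d * Q\<close>, at most half of \<epsilon>;
    \<open>Q + 1\<close> keeps the denominator positive.\<close>
  define d where "d = \<epsilon> / (4 * (Q + 1))"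
  have d: "d > 0" using eps Q by (simp add: d_def)
  have dQ: "2 * d * Q \<le> \<epsilon> / 2" using eps Q by (simp add: d_def field_simps)
  define far where "far n = - ball (0 :: real \<times> real) (real n)" for n
  define near where "near n = ball (0 :: real \<times> real) (1 / real (Suc n))" for n
  have [measurable]: "far n \<in> sets borel" "near n \<in> sets borel" for n
    unfolding far_def near_def by auto
  define T where "T n = (\<integral>\<^sup>+ u. ennreal ((p u)\<^sup>2) * indicator (far n) u \<partial>lborel)" for n
  define S where "S n = (\<integral>\<^sup>+ u. ennreal ((p u)\<^sup>2) * indicator (near n) u \<partial>lborel)" for n
  have "T \<longlonglongrightarrow> 0" unfolding T_def
  proof (rule L2_sq_tail_tendsto_0[OF pm fin])
    fix x :: "real \<times> real"
    have "eventually (\<lambda>n. norm x + 1 \<le> real n) sequentially"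
      using filterlim_real_sequentially unfolding filterlim_at_top by blast
    then show "eventually (\<lambda>n. x \<notin> far n) sequentially"
      by eventually_elim (auto simp: far_def)
  qed simp
  \<comment> \<open>A tail mass below \<open>d * \<epsilon>\<close> meets the weight
    \<open>1 / (4 * d)\<close> and costs \<epsilon> / 4. With the second tail this gives the other
    half of \<epsilon>.\<close>
  then have "eventually (\<lambda>n. T n < ennreal (d * \<epsilon>)) sequentially"
    by (rule order_tendstoD) (use d eps in simp)
  then obtain n where n: "T n < ennreal (d * \<epsilon>)" by (auto simp: eventually_sequentially)
  have "S \<longlonglongrightarrow> 0" unfolding S_def
  proof (rule L2_sq_tail_tendsto_0[OF pm fin])
    fix x :: "real \<times> real" assume "p x \<noteq> 0"
    then have "x \<noteq> 0" using p0 by auto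
    then have "eventually (\<lambda>n. 1 / real (Suc n) < norm x) sequentially"
      by (intro order_tendstoD[OF LIMSEQ_Suc[OF lim_1_over_n]]) auto
    then show "eventually (\<lambda>n. x \<notin> near n) sequentially"
      by eventually_elim (auto simp: near_def)
  qed simp
  then have "eventually (\<lambda>n. S n < ennreal (d * \<epsilon>)) sequentially"
    by (rule order_tendstoD) (use d eps in simp)
  then obtain m where m: "S m < ennreal (d * \<epsilon>)" by (auto simp: eventually_sequentially)
  \<comment> \<open>Chosen so that \<open>k * norm \<xi> < n\<close> and
    \<open>h \<le> c * k\<close> imply \<open>h * norm \<xi> < 1 / Suc m\<close>. Taking
    \<open>n + 2\<close> makes the quotient \<open>n / (n + 2)\<close> less than 1 and also gives
    \<open>c < 1\<close>.\<close>
  define c where "c = 1 / (real (Suc m) * real (n + 2))"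
  have c: "0 < c" "c < 1"
  proof -
    have "1 * 1 < real (Suc m) * real (n + 2)" by (intro mult_le_less_imp_less) auto
    then show "0 < c" "c < 1" unfolding c_def by (auto simp: divide_less_eq)
  qed
  show thesis
  proof (rule that[OF c])
    fix h k :: real assume h: "0 < h" "h \<le> c * k"
    then have k: "k > 0" using c by (smt (verit) zero_less_mult_pos)
    let ?a = "scaled_weight p h" and ?b = "scaled_weight p k"
    define e where "e = 1 / (4 * d)"
    have e: "e > 0" using d by (simp add: e_def)
    \<comment> \<open>Every frequency is either large on the scale of \<open>k\<close> or small on
      the scale of \<open>h\<close>. In each case one of the two factors has only tail mass there
      and takes the large weight \<open>e\<close>.\<close>
    have pwr: "?a \<xi> * ?b \<xi> \<le> d * ((?a \<xi>)\<^sup>2 + (?b \<xi>)\<^sup>2) +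
        e * ((?b \<xi>)\<^sup>2 * indicator (far n) (k *\<^sub>R \<xi>) + (?a \<xi>)\<^sup>2 * indicator (near m) (h *\<^sub>R \<xi>))" for \<xi>
    proof (cases "k *\<^sub>R \<xi> \<in> far n")
      case True
      have "0 \<le> d * (?b \<xi>)\<^sup>2" "0 \<le> e * ((?a \<xi>)\<^sup>2 * indicator (near m) (h *\<^sub>R \<xi>))"
        using d e by auto
      moreover have "?a \<xi> * ?b \<xi> \<le> d * (?a \<xi>)\<^sup>2 + e * (?b \<xi>)\<^sup>2"
        unfolding e_def by (rule mult_le_weighted_squares[OF d])
      ultimately show ?thesis using True by (simp add: distrib_left)
    next
      case False
      then have "k * norm \<xi> < real n" using k by (simp add: far_def)
      have "h * norm \<xi> \<le> c * (k * norm \<xi>)" using h by (metis mult.assoc mult_right_mono norm_ge_zero)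
      also have "\<dots> \<le> c * real n" using \<open>k * norm \<xi> < real n\<close> c by (intro mult_left_mono) auto
      also have "\<dots> = 1 / real (Suc m) * (real n / real (n + 2))" by (simp add: c_def)
      also have "\<dots> < 1 / real (Suc m) * 1" by (intro mult_strict_left_mono) auto
      finally have near: "h *\<^sub>R \<xi> \<in> near m" using h by (simp add: near_def)
      have "0 \<le> d * (?a \<xi>)\<^sup>2" using d by auto
      moreover have "?b \<xi> * ?a \<xi> \<le> d * (?b \<xi>)\<^sup>2 + e * (?a \<xi>)\<^sup>2"
        unfolding e_def by (rule mult_le_weighted_squares[OF d])
      ultimately show ?thesis using False near by (simp add: distrib_left mult.commute)
    qed
    have pw: "ennreal (?a \<xi> * ?b \<xi>) \<le> ennreal d * (ennreal ((?a \<xi>)\<^sup>2) + ennreal ((?b \<xi>)\<^sup>2)) +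
        ennreal e * (ennreal ((?b \<xi>)\<^sup>2) * indicator (far n) (k *\<^sub>R \<xi>) +
          ennreal ((?a \<xi>)\<^sup>2) * indicator (near m) (h *\<^sub>R \<xi>))" for \<xi>
    proof -
      have "ennreal (x * indicator A y) = ennreal x * indicator A y" if "0 \<le> x" for x and y :: "real \<times> real" and A
        by (simp add: indicator_def)
      moreover have "ennreal (d * (u + v) + e * (u' + v')) = ennreal d * (ennreal u + ennreal v) + ennreal e * (ennreal u' + ennreal v')"
        if "0 \<le> u" "0 \<le> v" "0 \<le> u'" "0 \<le> v'" for u v u' v'
        using that d e by (simp add: ennreal_lincomb del: ennreal_plus) simp
      ultimately show ?thesis using ennreal_leI[OF pwr[of \<xi>]] by (simp del: ennreal_plus)
    qed
    have "(\<integral>\<^sup>+ \<xi>. ennreal (?a \<xi> * ?b \<xi>) \<partial>lborel) \<le>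
      (\<integral>\<^sup>+ \<xi>. ennreal d * (ennreal ((?a \<xi>)\<^sup>2) + ennreal ((?b \<xi>)\<^sup>2)) +
        ennreal e * (ennreal ((?b \<xi>)\<^sup>2) * indicator (far n) (k *\<^sub>R \<xi>) +
          ennreal ((?a \<xi>)\<^sup>2) * indicator (near m) (h *\<^sub>R \<xi>)) \<partial>lborel)"
      by (intro nn_integral_mono pw)
    also have "\<dots> = ennreal d * (L2_sq lborel ?a + L2_sq lborel ?b) + ennreal e * (T n + S m)"
      unfolding T_def S_def
      using nn_integral_scaled_weight[OF pm _ h(1), of "near m"] nn_integral_scaled_weight[OF pm _ k, of "far n"]
      by (simp add: nn_integral_add nn_integral_cmult L2_sq_def)
    also have "\<dots> = ennreal d * (ennreal Q + ennreal Q) + ennreal e * (T n + S m)"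
      using h k by (simp add: L2_sq_scaled_weight Q)
    also have "\<dots> \<le> ennreal d * (ennreal Q + ennreal Q) + ennreal e * (ennreal (d * \<epsilon>) + ennreal (d * \<epsilon>))"
      using n m by (intro add_left_mono mult_left_mono add_mono) auto
    also have "\<dots> = ennreal (d * (Q + Q) + e * (d * \<epsilon> + d * \<epsilon>))"
    proof -
      have 1: "ennreal Q + ennreal Q = ennreal (Q + Q)"
        "ennreal (d * \<epsilon>) + ennreal (d * \<epsilon>) = ennreal (d * \<epsilon> + d * \<epsilon>)"
        using Q d eps by (simp_all only: ennreal_plus mult_nonneg_nonneg less_imp_le)
      show ?thesis unfolding 1 by (rule ennreal_lincomb[symmetric]) (use Q d e eps in auto)
    qed
    also have "\<dots> \<le> ennreal \<epsilon>"
      using d dQ by (intro ennreal_leI) (simp add: e_def field_simps)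
    finally show "(\<integral>\<^sup>+ \<xi>. ennreal (?a \<xi> * ?b \<xi>) \<partial>lborel) \<le> ennreal \<epsilon>" .
  qed
qed

section \<open>Kernels of the normalised square increments\<close>

definition increment_kernel :: "real \<Rightarrow> real \<Rightarrow> real \<Rightarrow> real \<times> real \<Rightarrow> real \<times> real \<Rightarrow> complex" where
  "increment_kernel \<alpha> H h = (\<lambda>(x1, x2) \<xi>. of_real (h powr (- (2 * H))) *
     (wtfbf_kernel \<alpha> H (x1 + h, x2 + h) \<xi> + of_real (- 1) * wtfbf_kernel \<alpha> H (x1 + h, x2) \<xi> +
      of_real (- 1) * wtfbf_kernel \<alpha> H (x1, x2 + h) \<xi> + wtfbf_kernel \<alpha> H (x1, x2) \<xi>))"

definition normalised_increment ::
    "(real \<times> real \<Rightarrow> 'w \<Rightarrow> real) \<Rightarrow> real \<Rightarrow> real \<Rightarrow> real \<times> real \<Rightarrow> 'w \<Rightarrow> real" where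
  "normalised_increment X H h x \<omega> = h powr (- (2 * H)) * rect_increment (\<lambda>y. X y \<omega>) (h, h) x"

text \<open>The signs in \<open>increment_kernel\<close> are written as factors
  \<open>of_real (- 1)\<close> so that the rules for sums and real multiples apply to it term by
  term.\<close>

lemma spectral_integral_increment:
  assumes B: "brownian_measure M W" and X: "is_wtfbf M W \<alpha> H X"
  shows "spectral_integral M W (increment_kernel \<alpha> H h x) (normalised_increment X H h x)"
proof -
  obtain x1 x2 where x: "x = (x1, x2)" by (cases x)
  have X: "spectral_integral M W (wtfbf_kernel \<alpha> H y) (X y)" for y
    using X unfolding is_wtfbf_def spectral_integral_def by blast
  have "spectral_integral M W (increment_kernel \<alpha> H h x) (\<lambda>\<omega>. h powr (- (2 * H)) *
      (X (x1 + h, x2 + h) \<omega> + (- 1) * X (x1 + h, x2) \<omega> + (- 1) * X (x1, x2 + h) \<omega> + X (x1, x2) \<omega>))"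
    unfolding increment_kernel_def x prod.case
    by (intro spectral_integral_scale[OF B] spectral_integral_add[OF B] X)
  then show ?thesis
    by (simp add: normalised_increment_def[abs_def] rect_increment_def x)
qed

text \<open>The modulus of the kernel of the increment over a unit square. Moving the square only
  multiplies the kernel by phases, so one weight serves all base points.\<close>

definition unit_weight :: "real \<Rightarrow> real \<Rightarrow> real \<times> real \<Rightarrow> real" where
  "unit_weight \<alpha> H \<xi> = norm (wtfbf_kernel \<alpha> H (1, 1) \<xi>)"

text \<open>Minimum and maximum are both homogeneous of degree 1, and in the sum of the exponents
  \<open>H_minus\<close> and \<open>H_plus\<close> contribute \<open>2 * H\<close>, so \<alpha>
  cancels.\<close>

lemma phi_scale:
  assumes h: "h > 0"
  shows "phi \<alpha> H (h *\<^sub>R \<xi>) = h powr (2 * H + 1) * phi \<alpha> H \<xi>"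
proof -
  obtain a b where ab: "\<xi> = (a, b)" by (cases \<xi>)
  have 1: "min \<bar>h * a\<bar> \<bar>h * b\<bar> = h * min \<bar>a\<bar> \<bar>b\<bar>" "max \<bar>h * a\<bar> \<bar>h * b\<bar> = h * max \<bar>a\<bar> \<bar>b\<bar>"
    using h by (auto simp: abs_mult min_mult_distrib_left max_mult_distrib_left)
  have "h powr (2 * H + 1) = h powr (H_minus \<alpha> H + 1/2) * h powr (H_plus \<alpha> H + 1/2)"
    unfolding powr_add[symmetric] by (simp add: H_minus_def H_plus_def algebra_simps)
  then show ?thesis unfolding ab phi_def scaleR_Pair prod.case real_scaleR_def 1
    using h by (simp add: powr_mult)
qed

lemma phi_nonneg: "0 \<le> phi \<alpha> H \<xi>"
  by (cases \<xi>) (simp add: phi_def)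

text \<open>The four kernels combine into a product over the coordinates: two phases times the
  kernel of step \<open>h\<close> based at the origin. The normalisation
  \<open>h powr (- (2 * H))\<close> and the degree \<open>2 * H + 1\<close> of \<open>phi\<close>
  leave exactly the factor \<open>h\<close> of an isometric dilation.\<close>

lemma norm_increment_kernel:
  assumes h: "h > 0"
  shows "norm (increment_kernel \<alpha> H h x \<xi>) = scaled_weight (unit_weight \<alpha> H) h \<xi>"
proof -
  obtain x1 x2 where x: "x = (x1, x2)" by (cases x)
  obtain a b where ab: "\<xi> = (a, b)" by (cases \<xi>)
  define P where "P = complex_of_real (phi \<alpha> H (a, b))"
  have "wtfbf_kernel \<alpha> H (x1 + h, x2 + h) \<xi> + of_real (- 1) * wtfbf_kernel \<alpha> H (x1 + h, x2) \<xi> +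
      of_real (- 1) * wtfbf_kernel \<alpha> H (x1, x2 + h) \<xi> + wtfbf_kernel \<alpha> H (x1, x2) \<xi> =
      cis (x1 * a) * cis (x2 * b) * ((cis (h * a) - 1) * (cis (h * b) - 1) / P)"
  proof -
    have c: "cis ((x1 + h) * a) = cis (x1 * a) * cis (h * a)" "cis ((x2 + h) * b) = cis (x2 * b) * cis (h * b)"
      by (simp_all add: cis_mult distrib_right)
    show ?thesis unfolding ab wtfbf_kernel_def prod.case c P_def[symmetric]
      by (simp add: diff_divide_distrib add_divide_distrib algebra_simps)
  qed
  then have "norm (increment_kernel \<alpha> H h x \<xi>) =
      h powr (- (2 * H)) * (norm ((cis (h * a) - 1) * (cis (h * b) - 1)) / phi \<alpha> H (a, b))"
    unfolding increment_kernel_def x prod.case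
    by (simp add: norm_mult norm_divide P_def phi_nonneg)
  moreover have "scaled_weight (unit_weight \<alpha> H) h \<xi> =
      h * (norm ((cis (h * a) - 1) * (cis (h * b) - 1)) / (h powr (2 * H + 1) * phi \<alpha> H (a, b)))"
    using phi_scale[OF h, of \<alpha> H "(a, b)"]
    by (simp add: scaled_weight_def unit_weight_def wtfbf_kernel_def ab norm_mult norm_divide phi_nonneg)
  moreover have "h / h powr (2 * H + 1) = h powr (- (2 * H))"
  proof -
    have "h / h powr (2 * H + 1) = h powr 1 / h powr (2 * H + 1)" using h by simp
    also have "\<dots> = h powr (- (2 * H))" unfolding powr_diff[symmetric] by simp
    finally show ?thesis .
  qed
  moreover have "h * (u / (r * v)) = (h / r) * (u / v)" for u r v by simp
  ultimately show ?thesis by (simp only:)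
qed

lemma unit_weight_0: "unit_weight \<alpha> H 0 = 0"
  by (simp add: unit_weight_def wtfbf_kernel_def zero_prod_def)

lemma unit_weight_nonneg: "0 \<le> unit_weight \<alpha> H \<xi>"
  by (simp add: unit_weight_def)

lemma spectral_integral_square_integrable:
  "spectral_integral M W f Y \<Longrightarrow> square_integrable f"
  by (auto simp: spectral_integral_def has_fourier_wiener_integral_def has_fourier_transform_def)

text \<open>Nothing has to be integrated: the field exists by assumption, and a stochastic integral
  of the kernel at \<open>(1, 1)\<close> presupposes that the kernel is square integrable.\<close>

lemma unit_weight_L2:
  assumes "is_wtfbf M W \<alpha> H X"
  shows "unit_weight \<alpha> H \<in> borel_measurable borel" "L2_sq lborel (unit_weight \<alpha> H) < \<infinity>"
proof -
  have "spectral_integral M W (wtfbf_kernel \<alpha> H (1, 1)) (X (1, 1))"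
    using assms unfolding is_wtfbf_def spectral_integral_def by blast
  then have "square_integrable (wtfbf_kernel \<alpha> H (1, 1))" by (rule spectral_integral_square_integrable)
  then show "unit_weight \<alpha> H \<in> borel_measurable borel" "L2_sq lborel (unit_weight \<alpha> H) < \<infinity>"
    unfolding unit_weight_def[abs_def] square_integrable_iff_L2_sq by (auto simp: L2_sq_def)
qed

lemma cis_neq_1: "0 < t \<Longrightarrow> t < pi \<Longrightarrow> cis t \<noteq> 1"
  using sin_gt_zero[of t] by (auto simp: complex_eq_iff)

text \<open>On the open square with corners \<open>(1, 1)\<close> and \<open>(2, 2)\<close> both
  frequencies lie strictly between 0 and \<open>pi\<close>, so neither factor of the numerator
  vanishes, and the square has positive area.\<close>

lemma unit_weight_L2_sq_pos:
  assumes "is_wtfbf M W \<alpha> H X"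
  shows "L2_sq lborel (unit_weight \<alpha> H) > 0"
proof (rule ccontr)
  assume "\<not> ?thesis"
  then have "AE \<xi> in lborel. unit_weight \<alpha> H \<xi> = 0"
    using unit_weight_L2(1)[OF assms] by (simp add: L2_sq_eq_0_iff)
  moreover have "unit_weight \<alpha> H \<xi> \<noteq> 0" if "\<xi> \<in> box (1, 1) (2, 2)" for \<xi>
  proof -
    obtain a b where ab: "\<xi> = (a, b)" by (cases \<xi>)
    have r: "1 < a" "a < 2" "1 < b" "b < 2" using that by (auto simp: ab box_def Basis_prod_def)
    have "a < pi" "b < pi" using r pi_gt3 by auto
    then have "cis a \<noteq> 1" "cis b \<noteq> 1" using r cis_neq_1[of a] cis_neq_1[of b] by auto
    moreover have "phi \<alpha> H (a, b) \<noteq> 0" using r by (simp add: phi_def min_def max_def)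
    ultimately show ?thesis by (simp add: unit_weight_def wtfbf_kernel_def ab)
  qed
  ultimately have "AE \<xi> in lborel. \<xi> \<notin> box (1, 1) (2::real, 2::real)"
    by (auto elim: eventually_mono)
  then have "emeasure lborel (box (1, 1) (2::real, 2::real)) = 0"
    by (subst (asm) AE_iff_measurable[OF _ refl]) auto
  then show False by (simp add: emeasure_lborel_box_eq Basis_prod_def)
qed

subsection \<open>Exceedance almost surely\<close>

text \<open>Chebyshev's inequality for the sum of the exponentials \<open>exp (s * Y i)\<close>.
  Without exceedance the sum lies at least \<open>N\<close> below its mean, so the probability is at
  most the variance divided by the square of \<open>N\<close>. The diagonal gives the first term of
  the bound, the covariances give the second.\<close>

lemma (in prob_space) second_moment_no_exceedance:
  fixes Y :: "nat \<Rightarrow> 'a \<Rightarrow> real"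
  assumes [measurable]: "\<And>i. Y i \<in> borel_measurable M"
    and int1: "\<And>i t. integrable M (\<lambda>\<omega>. exp (t * Y i \<omega>))"
    and exp1: "\<And>i t. expectation (\<lambda>\<omega>. exp (t * Y i \<omega>)) = exp (t\<^sup>2 * Q / 2)"
    and int2: "\<And>i j t. i \<noteq> j \<Longrightarrow> integrable M (\<lambda>\<omega>. exp (t * (Y i \<omega> + Y j \<omega>)))"
    and exp2: "\<And>i j t. i \<noteq> j \<Longrightarrow> expectation (\<lambda>\<omega>. exp (t * (Y i \<omega> + Y j \<omega>))) \<le> exp (t\<^sup>2 * (Q + \<epsilon>))"
    and s: "0 < s" "exp (s * K) + 1 \<le> exp (s\<^sup>2 * Q / 2)" and N: "0 < N"
  shows "prob {\<omega> \<in> space M. \<forall>i<N. Y i \<omega> \<le> K} \<le>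
    exp (2 * s\<^sup>2 * Q) / real N + (exp (s\<^sup>2 * (Q + \<epsilon>)) - exp (s\<^sup>2 * Q))"
proof -
  define \<mu> where "\<mu> = exp (s\<^sup>2 * Q / 2)"
  define Z where "Z i \<omega> = exp (s * Y i \<omega>)" for i \<omega>
  define S where "S \<omega> = (\<Sum>i<N. Z i \<omega>)" for \<omega>
  define A where "A = {\<omega> \<in> space M. \<forall>i<N. Y i \<omega> \<le> K}"
  have [measurable]: "A \<in> sets M" unfolding A_def by measurable
  have mu2: "\<mu>\<^sup>2 = exp (s\<^sup>2 * Q)" by (simp add: \<mu>_def power2_eq_square flip: exp_add)
  have ZZ: "Z i \<omega> * Z j \<omega> = exp (s * (Y i \<omega> + Y j \<omega>))" for i j \<omega>
    by (simp add: Z_def distrib_left exp_add)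
  have ZZ': "Z i \<omega> * Z i \<omega> = exp (2 * s * Y i \<omega>)" for i \<omega>
    by (simp add: Z_def flip: exp_add)
  have iZ: "integrable M (Z i)" for i unfolding Z_def by (rule int1)
  have iZZ: "integrable M (\<lambda>\<omega>. Z i \<omega> * Z j \<omega>)" for i j
  proof (cases "i = j")
    case True then show ?thesis using int1[of "2 * s" i] by (simp add: ZZ')
  next
    case False then show ?thesis unfolding ZZ by (rule int2)
  qed
  \<comment> \<open>The diagonal moment is added to the off-diagonal bound instead of replacing it,
    so the double sum splits into a constant over all pairs and \<open>N\<close> diagonal
    terms.\<close>
  have eZZ: "expectation (\<lambda>\<omega>. Z i \<omega> * Z j \<omega>) \<le> exp (s\<^sup>2 * (Q + \<epsilon>)) + (if i = j then exp (2 * s\<^sup>2 * Q) else 0)" for i j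
  proof (cases "i = j")
    case True then show ?thesis using exp1[of "2 * s" i] by (simp add: ZZ' power_mult_distrib mult_ac add_increasing)
  next
    case False then show ?thesis using exp2[of i j s] by (simp add: ZZ)
  qed
  have S2: "(S \<omega>)\<^sup>2 = (\<Sum>i<N. \<Sum>j<N. Z i \<omega> * Z j \<omega>)" for \<omega>
    unfolding S_def power2_eq_square sum_product ..
  have iS: "integrable M S" unfolding S_def using iZ by simp
  have iS2: "integrable M (\<lambda>\<omega>. (S \<omega>)\<^sup>2)" unfolding S2 using iZZ by simp
  have eS: "expectation S = real N * \<mu>"
  proof -
    have "expectation (Z i) = \<mu>" for i unfolding Z_def \<mu>_def by (rule exp1)
    then show ?thesis unfolding S_def using iZ by simp
  qed
  have eS2: "expectation (\<lambda>\<omega>. (S \<omega>)\<^sup>2) \<le> (real N)\<^sup>2 * exp (s\<^sup>2 * (Q + \<epsilon>)) + real N * exp (2 * s\<^sup>2 * Q)"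
  proof -
    have "expectation (\<lambda>\<omega>. (S \<omega>)\<^sup>2) = (\<Sum>i<N. \<Sum>j<N. expectation (\<lambda>\<omega>. Z i \<omega> * Z j \<omega>))"
      unfolding S2 using iZZ by simp
    also have "\<dots> \<le> (\<Sum>i<N. \<Sum>j<N. exp (s\<^sup>2 * (Q + \<epsilon>)) + (if i = j then exp (2 * s\<^sup>2 * Q) else 0))"
      by (intro sum_mono eZZ)
    also have "\<dots> = (real N)\<^sup>2 * exp (s\<^sup>2 * (Q + \<epsilon>)) + real N * exp (2 * s\<^sup>2 * Q)"
      by (simp add: sum.distrib power2_eq_square distrib_left mult.assoc)
    finally show ?thesis .
  qed
  have sq: "(S \<omega> - real N * \<mu>)\<^sup>2 = (S \<omega>)\<^sup>2 - 2 * real N * \<mu> * S \<omega> + (real N)\<^sup>2 * \<mu>\<^sup>2" for \<omega>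
    by (simp add: power2_diff power_mult_distrib)
  have ivar: "integrable M (\<lambda>\<omega>. (S \<omega> - real N * \<mu>)\<^sup>2)"
    unfolding sq using iS iS2 by simp
  have "expectation (\<lambda>\<omega>. (S \<omega> - real N * \<mu>)\<^sup>2) = expectation (\<lambda>\<omega>. (S \<omega>)\<^sup>2) - (real N)\<^sup>2 * \<mu>\<^sup>2"
    unfolding sq using iS iS2 by (simp add: eS prob_space power2_eq_square)
  also have "\<dots> \<le> real N * exp (2 * s\<^sup>2 * Q) + (real N)\<^sup>2 * (exp (s\<^sup>2 * (Q + \<epsilon>)) - exp (s\<^sup>2 * Q))"
    using eS2 by (simp add: mu2 algebra_simps)
  finally have var: "expectation (\<lambda>\<omega>. (S \<omega> - real N * \<mu>)\<^sup>2) \<le>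
      real N * exp (2 * s\<^sup>2 * Q) + (real N)\<^sup>2 * (exp (s\<^sup>2 * (Q + \<epsilon>)) - exp (s\<^sup>2 * Q))" .
  have "(real N)\<^sup>2 * prob A = expectation (\<lambda>\<omega>. (real N)\<^sup>2 * indicator A \<omega>)" by simp
  also have "\<dots> \<le> expectation (\<lambda>\<omega>. (S \<omega> - real N * \<mu>)\<^sup>2)"
  proof (rule integral_mono)
    show "integrable M (\<lambda>\<omega>. (real N)\<^sup>2 * indicator A \<omega>)"
      by (intro integrable_mult_right integrable_real_indicator) (auto simp: emeasure_eq_measure)
    fix \<omega>
    show "(real N)\<^sup>2 * indicator A \<omega> \<le> (S \<omega> - real N * \<mu>)\<^sup>2"
    proof (cases "\<omega> \<in> A")
      case True
      \<comment> \<open>The unit gap between \<open>exp (s * K)\<close> and \<mu> adds up over the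
        indices to a deviation of at least \<open>N\<close>.\<close>
      have "Z i \<omega> \<le> \<mu> - 1" if "i < N" for i
      proof -
        have "Z i \<omega> \<le> exp (s * K)" using True that s(1) by (auto simp: Z_def A_def)
        then show ?thesis using s(2) by (simp add: \<mu>_def)
      qed
      then have "S \<omega> \<le> (\<Sum>i<N. \<mu> - 1)" unfolding S_def by (intro sum_mono) auto
      then have "real N \<le> real N * \<mu> - S \<omega>" by (simp add: algebra_simps)
      then have "(real N)\<^sup>2 \<le> (real N * \<mu> - S \<omega>)\<^sup>2" by (intro power_mono) auto
      then show ?thesis using True by (simp add: power2_commute)
    qed simp
  qed (rule ivar)
  also note var
  finally have "prob A \<le> (real N * exp (2 * s\<^sup>2 * Q) + (real N)\<^sup>2 * (exp (s\<^sup>2 * (Q + \<epsilon>)) - exp (s\<^sup>2 * Q))) / (real N)\<^sup>2"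
    using N by (simp add: pos_le_divide_eq mult.commute)
  also have "\<dots> = exp (2 * s\<^sup>2 * Q) / real N + (exp (s\<^sup>2 * (Q + \<epsilon>)) - exp (s\<^sup>2 * Q))"
    using N by (simp add: field_simps power2_eq_square)
  finally show ?thesis unfolding A_def .
qed

section \<open>Exceedance by the normalised increments\<close>

lemma normalised_increment_gaussian:
  assumes M: "prob_space M" and B: "brownian_measure M W" and X: "is_wtfbf M W \<alpha> H X"
    and h: "h > 0"
  shows "normalised_increment X H h x \<in> borel_measurable M"
    and "integrable M (\<lambda>\<omega>. exp (t * normalised_increment X H h x \<omega>))"
    and "(\<integral>\<omega>. exp (t * normalised_increment X H h x \<omega>) \<partial>M) =
      exp (t\<^sup>2 * enn2real (L2_sq lborel (unit_weight \<alpha> H)) / 2)"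
proof -
  note si = spectral_integral_increment[OF B X, of h x]
  note g = spectral_integral_gaussian[OF M B si]
  have "L2_sq lborel (increment_kernel \<alpha> H h x) = L2_sq lborel (scaled_weight (unit_weight \<alpha> H) h)"
    unfolding L2_sq_def by (simp add: norm_increment_kernel[OF h])
  also have "\<dots> = L2_sq lborel (unit_weight \<alpha> H)"
    by (rule L2_sq_scaled_weight[OF unit_weight_L2(1)[OF X] h])
  finally have "L2_sq M (normalised_increment X H h x) = L2_sq lborel (unit_weight \<alpha> H)" using g(2) by simp
  with centered_gaussian_exp[OF M g(1), of t]
  show "integrable M (\<lambda>\<omega>. exp (t * normalised_increment X H h x \<omega>))"
    and "(\<integral>\<omega>. exp (t * normalised_increment X H h x \<omega>) \<partial>M) =
      exp (t\<^sup>2 * enn2real (L2_sq lborel (unit_weight \<alpha> H)) / 2)" by simp_all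
  show "normalised_increment X H h x \<in> borel_measurable M"
    using g(1) by (simp add: centered_gaussian_def)
qed

text \<open>The modulus of the sum of the kernels is at most the sum of the two weights, so the
  variance is at most \<open>2 * (Q + \<epsilon>)\<close> whatever the phases. The exponential
  moment is increasing in the variance.\<close>

lemma normalised_increment_pair:
  assumes M: "prob_space M" and B: "brownian_measure M W" and X: "is_wtfbf M W \<alpha> H X"
    and h: "h > 0" "k > 0"
    and dec: "(\<integral>\<^sup>+ \<xi>. ennreal (scaled_weight (unit_weight \<alpha> H) h \<xi> * scaled_weight (unit_weight \<alpha> H) k \<xi>) \<partial>lborel)
      \<le> ennreal \<epsilon>" and e: "\<epsilon> \<ge> 0"
  shows "integrable M (\<lambda>\<omega>. exp (t * (normalised_increment X H h x \<omega> + normalised_increment X H k x \<omega>)))"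
    and "(\<integral>\<omega>. exp (t * (normalised_increment X H h x \<omega> + normalised_increment X H k x \<omega>)) \<partial>M)
      \<le> exp (t\<^sup>2 * (enn2real (L2_sq lborel (unit_weight \<alpha> H)) + \<epsilon>))"
proof -
  let ?p = "unit_weight \<alpha> H"
  define Q where "Q = enn2real (L2_sq lborel ?p)"
  have Q: "L2_sq lborel ?p = ennreal Q" "0 \<le> Q" using unit_weight_L2(2)[OF X] by (auto simp: Q_def)
  note pm[measurable] = unit_weight_L2(1)[OF X]
  note si = spectral_integral_add[OF B spectral_integral_increment[OF B X, of h x] spectral_integral_increment[OF B X, of k x]]
  note g = spectral_integral_gaussian[OF M B si]
  have sw0: "0 \<le> scaled_weight ?p r \<xi>" if "r > 0" for r \<xi>
    using that by (simp add: scaled_weight_def unit_weight_nonneg)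
  have "L2_sq lborel (\<lambda>\<xi>. increment_kernel \<alpha> H h x \<xi> + increment_kernel \<alpha> H k x \<xi>) \<le>
    (\<integral>\<^sup>+ \<xi>. ennreal ((scaled_weight ?p h \<xi>)\<^sup>2) + ennreal ((scaled_weight ?p k \<xi>)\<^sup>2) +
       2 * ennreal (scaled_weight ?p h \<xi> * scaled_weight ?p k \<xi>) \<partial>lborel)"
    unfolding L2_sq_def
  proof (intro nn_integral_mono)
    fix \<xi>
    let ?a = "scaled_weight ?p h \<xi>" and ?b = "scaled_weight ?p k \<xi>"
    have "norm (increment_kernel \<alpha> H h x \<xi> + increment_kernel \<alpha> H k x \<xi>) \<le> ?a + ?b"
      using norm_triangle_ineq[of "increment_kernel \<alpha> H h x \<xi>" "increment_kernel \<alpha> H k x \<xi>"] h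
      by (simp add: norm_increment_kernel)
    then have "(norm (increment_kernel \<alpha> H h x \<xi> + increment_kernel \<alpha> H k x \<xi>))\<^sup>2 \<le> (?a + ?b)\<^sup>2"
      by (rule power_mono) simp
    also have "(?a + ?b)\<^sup>2 = ?a\<^sup>2 + ?b\<^sup>2 + 2 * (?a * ?b)" by (simp add: power2_sum)
    finally have "ennreal ((norm (increment_kernel \<alpha> H h x \<xi> + increment_kernel \<alpha> H k x \<xi>))\<^sup>2) \<le>
      ennreal (?a\<^sup>2 + ?b\<^sup>2 + 2 * (?a * ?b))" by (rule ennreal_leI)
    also have "\<dots> = ennreal (?a\<^sup>2) + ennreal (?b\<^sup>2) + 2 * ennreal (?a * ?b)"
      using sw0[OF h(1), of \<xi>] sw0[OF h(2), of \<xi>] by (simp add: ennreal_mult')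
    finally show "ennreal ((norm (increment_kernel \<alpha> H h x \<xi> + increment_kernel \<alpha> H k x \<xi>))\<^sup>2) \<le> \<dots>" .
  qed
  also have "\<dots> = L2_sq lborel (scaled_weight ?p h) + L2_sq lborel (scaled_weight ?p k) +
      2 * (\<integral>\<^sup>+ \<xi>. ennreal (scaled_weight ?p h \<xi> * scaled_weight ?p k \<xi>) \<partial>lborel)"
    by (simp add: nn_integral_add nn_integral_cmult L2_sq_def)
  also have "\<dots> \<le> ennreal Q + ennreal Q + 2 * ennreal \<epsilon>"
    unfolding L2_sq_scaled_weight[OF pm h(1)] L2_sq_scaled_weight[OF pm h(2)] Q(1)
    by (intro add_left_mono mult_left_mono dec) auto
  also have "\<dots> = ennreal (2 * (Q + \<epsilon>))"
  proof -
    have "2 * (Q + \<epsilon>) = Q + Q + 2 * \<epsilon>" by simp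
    moreover have "ennreal (Q + Q + 2 * \<epsilon>) = ennreal (Q + Q) + ennreal (2 * \<epsilon>)"
      using Q e by (intro ennreal_plus) auto
    moreover have "ennreal (Q + Q) = ennreal Q + ennreal Q" by (rule ennreal_plus[OF Q(2) Q(2)])
    moreover have "ennreal (2 * \<epsilon>) = 2 * ennreal \<epsilon>" by (simp add: ennreal_mult')
    ultimately show ?thesis by (simp only:)
  qed
  finally have "L2_sq M (\<lambda>\<omega>. normalised_increment X H h x \<omega> + normalised_increment X H k x \<omega>) \<le> ennreal (2 * (Q + \<epsilon>))"
    using g(2) by simp
  then have le: "enn2real (L2_sq M (\<lambda>\<omega>. normalised_increment X H h x \<omega> + normalised_increment X H k x \<omega>)) \<le> 2 * (Q + \<epsilon>)"
    using Q e by (intro enn2real_leI) auto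
  note ex = centered_gaussian_exp[OF M g(1), of t]
  show "integrable M (\<lambda>\<omega>. exp (t * (normalised_increment X H h x \<omega> + normalised_increment X H k x \<omega>)))"
    by (rule ex)
  have "t\<^sup>2 * enn2real (L2_sq M (\<lambda>\<omega>. normalised_increment X H h x \<omega> + normalised_increment X H k x \<omega>)) \<le> t\<^sup>2 * (2 * (Q + \<epsilon>))"
    using le by (intro mult_left_mono) auto
  then show "(\<integral>\<omega>. exp (t * (normalised_increment X H h x \<omega> + normalised_increment X H k x \<omega>)) \<partial>M)
      \<le> exp (t\<^sup>2 * (enn2real (L2_sq lborel (unit_weight \<alpha> H)) + \<epsilon>))"
    unfolding ex(2) Q_def[symmetric] by (simp add: algebra_simps)
qed

text \<open>The constants are fixed in this order: \<open>s\<close> from \<open>K\<close> and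
  \<open>Q\<close>, then \<epsilon> from \<open>s\<close> and \<open>r\<close>, then the ratio
  \<open>c\<close> from \<epsilon>, and \<open>N\<close> from \<open>s\<close> and \<open>r\<close>.
  The set \<open>A\<close> looks at finitely many scales only, hence is measurable.\<close>

lemma no_exceedance_small:
  assumes M: "prob_space M" and B: "brownian_measure M W" and X: "is_wtfbf M W \<alpha> H X"
    and d: "\<delta> > 0" and K: "K \<ge> 0" and r: "r > 0"
  shows "\<exists>A\<in>sets M. measure M A \<le> r \<and>
    {\<omega> \<in> space M. \<forall>h. 0 < h \<and> h < \<delta> \<longrightarrow> normalised_increment X H h x \<omega> \<le> K} \<subseteq> A"
proof -
  interpret prob_space M by fact
  let ?p = "unit_weight \<alpha> H"
  define Q where "Q = enn2real (L2_sq lborel ?p)"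
  have Qpos: "Q > 0"
    using unit_weight_L2_sq_pos[OF X] unit_weight_L2(2)[OF X] by (simp add: Q_def enn2real_positive_iff)
  \<comment> \<open>Gives \<open>s * Q / 2 \<ge> K + 1\<close> and \<open>s \<ge> 1\<close>, hence
    \<open>s\<^sup>2 * Q / 2 \<ge> s * K + 1\<close>: the quadratic exponent beats the linear one by
    a margin.\<close>
  define s where "s = 2 * (K + 1) / Q + 1"
  have s: "s \<ge> 1" using K Qpos by (simp add: s_def)
  have "exp (s * K) + 1 \<le> exp (s\<^sup>2 * Q / 2)"
  proof -
    have "s * K + 1 \<le> s * (K + 1)" using s by (simp add: algebra_simps)
    also have "\<dots> \<le> s * (s * Q / 2)"
      using s K Qpos by (intro mult_left_mono) (simp_all add: s_def field_simps)
    finally have "s * K + 1 \<le> s\<^sup>2 * Q / 2" by (simp add: power2_eq_square)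
    \<comment> \<open>The margin 1 in the exponent absorbs the added 1, since
      \<open>exp 1 \<ge> 2\<close> and, for \<open>K \<ge> 0\<close>,
      \<open>exp (s * K) \<ge> 1\<close>.\<close>
    moreover have "exp (s * K) + 1 \<le> exp (s * K + 1)"
    proof -
      have "1 \<le> exp (s * K)" using s K by simp
      moreover have "2 * exp (s * K) \<le> exp 1 * exp (s * K)"
        using exp_ge_add_one_self[of 1] by (intro mult_right_mono) auto
      moreover have "exp (s * K + 1) = exp 1 * exp (s * K)" by (simp add: exp_add)
      ultimately show ?thesis by linarith
    qed
    ultimately show ?thesis using exp_le_cancel_iff order_trans by blast
  qed
  note s2 = this
  \<comment> \<open>The solution of \<open>exp (s\<^sup>2 * (Q + \<epsilon>)) - exp (s\<^sup>2 * Q)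
    = r / 2\<close>, so the covariances use up exactly half of \<open>r\<close>.\<close>
  define \<epsilon> where "\<epsilon> = ln (1 + r / (2 * exp (s\<^sup>2 * Q))) / s\<^sup>2"
  have e: "\<epsilon> > 0" using r s by (simp add: \<epsilon>_def ln_gt_zero)
  have eval: "exp (s\<^sup>2 * (Q + \<epsilon>)) - exp (s\<^sup>2 * Q) = r / 2"
  proof -
    have "exp (s\<^sup>2 * \<epsilon>) = 1 + r / (2 * exp (s\<^sup>2 * Q))"
      using r s by (simp add: \<epsilon>_def add_pos_pos)
    then have "exp (s\<^sup>2 * (Q + \<epsilon>)) = exp (s\<^sup>2 * Q) * (1 + r / (2 * exp (s\<^sup>2 * Q)))"
      by (simp add: distrib_left exp_add)
    moreover have "E * (1 + r / (2 * E)) - E = r / 2" if "E > 0" for E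
      using that by (simp add: field_simps)
    ultimately show ?thesis by (simp only: exp_gt_zero)
  qed
  obtain c where c: "0 < c" "c < 1" and dec: "\<And>h k. 0 < h \<Longrightarrow> h \<le> c * k \<Longrightarrow>
      (\<integral>\<^sup>+ \<xi>. ennreal (scaled_weight ?p h \<xi> * scaled_weight ?p k \<xi>) \<partial>lborel) \<le> ennreal \<epsilon>"
    using scaled_weight_decorrelation[OF unit_weight_L2(1)[OF X] unit_weight_0 unit_weight_L2(2)[OF X] e] by blast
  \<comment> \<open>With common ratio \<open>c\<close>, any two distinct scales, and not only
    neighbours, are separated enough for the decorrelation bound. The factor \<delta> / 2 puts the
    first scale below \<delta>.\<close>
  define h where "h n = \<delta> / 2 * c ^ n" for n
  have h0: "0 < h n" for n using d c by (simp add: h_def)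
  have hd: "h n < \<delta>" for n
  proof -
    have "\<delta> / 2 * c ^ n \<le> \<delta> / 2 * 1" using d c by (intro mult_left_mono power_le_one) auto
    then show ?thesis using d by (simp add: h_def)
  qed
  have hle: "h j \<le> c * h i" if "i < j" for i j
  proof -
    have "c ^ j \<le> c ^ Suc i" using that c by (intro power_decreasing) auto
    then have "\<delta> / 2 * c ^ j \<le> \<delta> / 2 * c ^ Suc i" using d by (intro mult_left_mono) auto
    then show ?thesis by (simp add: h_def mult_ac)
  qed
  have dec': "(\<integral>\<^sup>+ \<xi>. ennreal (scaled_weight ?p (h i) \<xi> * scaled_weight ?p (h j) \<xi>) \<partial>lborel) \<le> ennreal \<epsilon>"
    if "i \<noteq> j" for i j
  proof (cases "i < j")
    case True
    then show ?thesis using dec[OF h0 hle[OF True]] by (simp add: mult.commute)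
  next
    case False
    then show ?thesis using that by (intro dec h0 hle) auto
  qed
  \<comment> \<open>Enough scales for the diagonal term to use at most the other half of
    \<open>r\<close>.\<close>
  define N where "N = nat \<lceil>2 * exp (2 * s\<^sup>2 * Q) / r\<rceil> + 1"
  have N: "0 < N" "exp (2 * s\<^sup>2 * Q) / real N \<le> r / 2"
  proof -
    have "2 * exp (2 * s\<^sup>2 * Q) / r \<le> real N" unfolding N_def by linarith
    moreover have "0 < real N" by (simp add: N_def)
    ultimately show "exp (2 * s\<^sup>2 * Q) / real N \<le> r / 2" using r by (simp add: field_simps)
  qed (simp add: N_def)
  let ?Y = "\<lambda>n. normalised_increment X H (h n) x"
  have [measurable]: "?Y n \<in> borel_measurable M" for n
    by (rule normalised_increment_gaussian[OF M B X h0])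
  have "prob {\<omega> \<in> space M. \<forall>i<N. ?Y i \<omega> \<le> K} \<le>
      exp (2 * s\<^sup>2 * Q) / real N + (exp (s\<^sup>2 * (Q + \<epsilon>)) - exp (s\<^sup>2 * Q))"
  proof (rule second_moment_no_exceedance)
    show "expectation (\<lambda>\<omega>. exp (t * ?Y i \<omega>)) = exp (t\<^sup>2 * Q / 2)" for i t
      unfolding Q_def by (rule normalised_increment_gaussian[OF M B X h0])
    show "expectation (\<lambda>\<omega>. exp (t * (?Y i \<omega> + ?Y j \<omega>))) \<le> exp (t\<^sup>2 * (Q + \<epsilon>))" if "i \<noteq> j" for i j t
      unfolding Q_def by (rule normalised_increment_pair[OF M B X h0 h0 dec'[OF that]]) (use e in simp)
    show "integrable M (\<lambda>\<omega>. exp (t * (?Y i \<omega> + ?Y j \<omega>)))" if "i \<noteq> j" for i j t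
      by (rule normalised_increment_pair[OF M B X h0 h0 dec'[OF that]]) (use e in simp)
  qed (use s s2 N normalised_increment_gaussian[OF M B X h0] in auto)
  then have "prob {\<omega> \<in> space M. \<forall>i<N. ?Y i \<omega> \<le> K} \<le> r" using N(2) eval by linarith
  then show ?thesis
    by (intro bexI[of _ "{\<omega> \<in> space M. \<forall>i<N. ?Y i \<omega> \<le> K}"]) (use h0 hd in auto)
qed

text \<open>The bad event lies in measurable sets of probability at most \<open>1 / Suc n\<close>
  for every \<open>n\<close>. Their intersection is a null set, which is all that an almost sure
  statement requires.\<close>

lemma AE_exceedance:
  assumes M: "prob_space M" and B: "brownian_measure M W" and X: "is_wtfbf M W \<alpha> H X"
    and d: "\<delta> > 0" and K: "K \<ge> 0"
  shows "AE \<omega> in M. \<exists>h. 0 < h \<and> h < \<delta> \<and> K < normalised_increment X H h x \<omega>"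
proof -
  interpret prob_space M by fact
  define bad where "bad = {\<omega> \<in> space M. \<forall>h. 0 < h \<and> h < \<delta> \<longrightarrow> normalised_increment X H h x \<omega> \<le> K}"
  have "\<exists>A. A \<in> sets M \<and> prob A \<le> 1 / real (Suc n) \<and> bad \<subseteq> A" for n
    using no_exceedance_small[OF M B X d K, of "1 / real (Suc n)" x] unfolding bad_def[symmetric] by auto
  then obtain A where A: "\<And>n. A n \<in> sets M" "\<And>n. prob (A n) \<le> 1 / real (Suc n)" "\<And>n. bad \<subseteq> A n"
    by metis
  have IA: "(\<Inter>n. A n) \<in> sets M" using A(1) by auto
  have "prob (\<Inter>n. A n) \<le> 1 / real (Suc n)" for n
  proof -
    have "prob (\<Inter>n. A n) \<le> prob (A n)" by (rule finite_measure_mono) (use A(1) in auto)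
    then show ?thesis using A(2)[of n] by linarith
  qed
  then have "prob (\<Inter>n. A n) \<le> 0"
    by (intro LIMSEQ_le_const[OF LIMSEQ_Suc[OF lim_1_over_n]]) auto
  then have "emeasure M (\<Inter>n. A n) = 0" by (simp add: emeasure_eq_measure measure_le_0_iff)
  then have "(\<Inter>n. A n) \<in> null_sets M" using IA by auto
  then show ?thesis
  proof (rule AE_I')
    show "{\<omega> \<in> space M. \<not> (\<exists>h. 0 < h \<and> h < \<delta> \<and> K < normalised_increment X H h x \<omega>)} \<subseteq> (\<Inter>n. A n)"
      using A(3) unfolding bad_def by (fastforce simp: not_less)
  qed
qed

section \<open>Reduction to countably many squares\<close>

lemma interior_rational:
  fixes I :: "real set"
  assumes "interior I \<noteq> {}"
  obtains q \<delta> where "q \<in> \<rat>" "\<delta> > 0" "\<And>h. 0 \<le> h \<Longrightarrow> h < \<delta> \<Longrightarrow> q + h \<in> I"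
proof -
  obtain a where "a \<in> interior I" using assms by auto
  then obtain e where e: "e > 0" "ball a e \<subseteq> I" by (auto simp: mem_interior)
  obtain q where q: "q \<in> \<rat>" "a < q" "q < a + e" using Rats_dense_in_real[of a "a + e"] e by auto
  have "q + h \<in> I" if "0 \<le> h" "h < a + e - q" for h
    using that q e by (intro subsetD[OF e(2)]) (auto simp: dist_real_def)
  with q show thesis by (intro that[of q "a + e - q"]) simp_all
qed

theorem theorem3p1:
  fixes M :: "'w measure"
    and W :: "(real \<times> real) set \<Rightarrow> 'w \<Rightarrow> real"
    and X :: "real \<times> real \<Rightarrow> 'w \<Rightarrow> real"
    and \<alpha> H :: real
  assumes "prob_space M"
    and "brownian_measure M W"
    and "0 \<le> \<alpha>" "\<alpha> \<le> 1"
    and "0 < H" "H < 1"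
    and "is_wtfbf M W \<alpha> H X"
    and "\<And>\<omega>. \<omega> \<in> space M \<Longrightarrow> continuous_on UNIV (\<lambda>x. X x \<omega>)"
  shows "AE \<omega> in M. \<forall>I J :: real set.
    is_interval I \<and> bounded I \<and> interior I \<noteq> {} \<and>
    is_interval J \<and> bounded J \<and> interior J \<noteq> {} \<longrightarrow>
    Sup {ereal (\<bar>rect_increment (\<lambda>x. X x \<omega>) (h1, h2) (x1, x2)\<bar> /
                (max \<bar>h1\<bar> \<bar>h2\<bar> powr (1 - \<alpha>) * min \<bar>h1\<bar> \<bar>h2\<bar> powr (1 + \<alpha>)) powr H)
         | x1 x2 h1 h2.
           (x1, x2) \<in> I \<times> J \<and> (x1 + h1, x2 + h2) \<in> I \<times> J \<and> h1 \<noteq> 0 \<and> h2 \<noteq> 0} = \<infinity>"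
proof -
  \<comment> \<open>One null set must work for all intervals at once, so the quantifiers are reduced
    to countable data: a rational corner, a size bound \<open>1 / Suc n\<close> and a level
    \<open>k\<close>.\<close>
  have "AE \<omega> in M. \<forall>x\<in>\<rat> \<times> \<rat>. \<forall>n k :: nat. \<exists>h. 0 < h \<and> h < 1 / real (Suc n) \<and>
      real k < normalised_increment X H h x \<omega>"
  proof (subst AE_ball_countable, intro countable_SIGMA countable_rat, intro ballI)
    fix x :: "real \<times> real"
    show "AE \<omega> in M. \<forall>n k :: nat. \<exists>h. 0 < h \<and> h < 1 / real (Suc n) \<and>
        real k < normalised_increment X H h x \<omega>"
      unfolding AE_all_countable by (intro allI AE_exceedance[OF assms(1,2,7)]) auto
  qed
  then show ?thesis
  proof (rule eventually_mono, intro allI impI)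
    fix \<omega> and I J :: "real set"
    assume ex: "\<forall>x\<in>\<rat> \<times> \<rat>. \<forall>n k :: nat. \<exists>h. 0 < h \<and> h < 1 / real (Suc n) \<and>
      real k < normalised_increment X H h x \<omega>"
      and IJ: "is_interval I \<and> bounded I \<and> interior I \<noteq> {} \<and> is_interval J \<and> bounded J \<and> interior J \<noteq> {}"
    let ?S = "{ereal (\<bar>rect_increment (\<lambda>x. X x \<omega>) (h1, h2) (x1, x2)\<bar> /
                (max \<bar>h1\<bar> \<bar>h2\<bar> powr (1 - \<alpha>) * min \<bar>h1\<bar> \<bar>h2\<bar> powr (1 + \<alpha>)) powr H)
         | x1 x2 h1 h2.
           (x1, x2) \<in> I \<times> J \<and> (x1 + h1, x2 + h2) \<in> I \<times> J \<and> h1 \<noteq> 0 \<and> h2 \<noteq> 0}"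
    obtain a d where a: "a \<in> \<rat>" "d > 0" "\<And>h. 0 \<le> h \<Longrightarrow> h < d \<Longrightarrow> a + h \<in> I"
      using IJ interior_rational[of I] by blast
    obtain b e where b: "b \<in> \<rat>" "e > 0" "\<And>h. 0 \<le> h \<Longrightarrow> h < e \<Longrightarrow> b + h \<in> J"
      using IJ interior_rational[of J] by blast
    \<comment> \<open>Squares with lower corner \<open>(a, b)\<close> and side below both
      \<open>d\<close> and \<open>e\<close> stay inside \<open>I \<times> J\<close>.\<close>
    obtain n where n: "1 / real (Suc n) < min d e"
      using reals_Archimedean[of "min d e"] a(2) b(2) by (auto simp: inverse_eq_divide)
    show "Sup ?S = \<infinity>"
    proof (rule ereal_top)
      fix c :: real
      obtain k :: nat where k: "c \<le> real k" using real_arch_simple by blast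
      obtain h where h: "0 < h" "h < 1 / real (Suc n)" "real k < normalised_increment X H h (a, b) \<omega>"
        using ex a(1) b(1) by blast
      let ?R = "rect_increment (\<lambda>x. X x \<omega>) (h, h) (a, b)"
      have mem: "(a, b) \<in> I \<times> J \<and> (a + h, b + h) \<in> I \<times> J \<and> h \<noteq> 0 \<and> h \<noteq> 0"
        using a(3)[of 0] a(3)[of h] b(3)[of 0] b(3)[of h] a(2) b(2) h n by auto
      \<comment> \<open>On a square maximum and minimum coincide, and \<open>1 - \<alpha>\<close>
        and \<open>1 + \<alpha>\<close> add up to 2.\<close>
      have den: "(max \<bar>h\<bar> \<bar>h\<bar> powr (1 - \<alpha>) * min \<bar>h\<bar> \<bar>h\<bar> powr (1 + \<alpha>)) powr H = h powr (2 * H)"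
        using h(1) by (simp add: powr_powr flip: powr_add del: powr_numeral)
      have "c \<le> h powr (- (2 * H)) * ?R"
        using k h(3) by (simp add: normalised_increment_def)
      also have "\<dots> \<le> h powr (- (2 * H)) * \<bar>?R\<bar>" by (intro mult_left_mono) auto
      also have "\<dots> = \<bar>?R\<bar> / h powr (2 * H)" by (simp add: powr_minus_divide)
      finally have "ereal c \<le> ereal (\<bar>?R\<bar> /
          (max \<bar>h\<bar> \<bar>h\<bar> powr (1 - \<alpha>) * min \<bar>h\<bar> \<bar>h\<bar> powr (1 + \<alpha>)) powr H)"
        unfolding den by simp
      also have "\<dots> \<le> Sup ?S" using mem by (intro Sup_upper) blast
      finally show "ereal c \<le> Sup ?S" .
    qed
  qed
qed

end
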